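(* Let $\mathbf V$ be a variety of algebras, $A\in\mathbf V$, $Z=\mathbb Z[A,\mathbf V]$ the enveloping ringoid, and $M$ an $A$-module totally in $\mathbf V$. For $a,b\in A$ let $f_M:{}_aZ_b\to{}_a\mathrm{End}(M)_b$ be the group homomorphism sending $z$ to $(m\mapsto zm)$ (so that $f_M((u)_b)=u^M_{\langle b\rangle}$). Then: (1) $f_M:Z\to\mathrm{End}(M)$ is a ringoid homomorphism; (2) $f_M$ has range in $Z_M$, i.e. $f_M(z)\in{}_b(Z_M)_a$ for all $a,b\in A$ and $z\in{}_bZ_a$; (3) $f_M$, considered as a homomorphism from $Z$ to $Z_M$, is cofaithful, i.e. one-one and onto on objects and onto on all hom-sets.
   Context: A type $\Omega$ is a family of sets $\Omega_n$ ($n\in\mathbb{N}$, $0\in\mathbb N$) of $n$-ary operation symbols; algebras may be empty. Let $A$ be an algebra of type $\Omega$. Modules and pointed overalgebras. An $A$-module $M$ is an $|A|$-tuple of abelian groups $({}_aM)_{a\in A}$ with, for each $n$-ary $\omega$ and $\mathbf{a}\in A^n$, a group homomorphism $\omega^M_{\mathbf a}:{}_{\mathbf a}M\to{}_{\omega(\mathbf a)}M$, where ${}_{\mathbf a}M={}_{a_1}M\times\cdots\times{}_{a_n}M$. Write $\omega^M_{\mathbf a,i}:{}_{a_i}M\to{}_{\omega(\mathbf a)}M$ for the homomorphism $\omega^M_{\mathbf a,i}(m)=\omega^M_{\mathbf a}({}_{a_1}0,\ldots,{}_{a_{i-1}}0,m,{}_{a_{i+1}}0,\ldots,{}_{a_n}0)$.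 A pointed $A$-overalgebra $P$ is the same as an $A$-module with pointed sets ${}_aP$ (basepoint ${}_a*$) and pointed maps instead. A homomorphism is an $A$-tuple of group homomorphisms (resp. pointed maps) ${}_a\phi:{}_aM\to{}_aM'$ with ${}_{\omega(\mathbf a)}\phi(\omega^M_{\mathbf a}(\mathbf m))=\omega^{M'}_{\mathbf a}({}_{a_1}\phi(m_1),\ldots,{}_{a_n}\phi(m_n))$. The forgetful functor $\mathcal{U}$ takes an $A$-module to the pointed $A$-overalgebra with the same maps and basepoints ${}_a0$. The total algebra $A\ltimes M$ is $\{\langle a,m\rangle: m\in{}_aM\}$ with $\omega(\langle a_1,m_1\rangle,\ldots)=\langle\omega(\mathbf a),\omega^M_{\mathbf a}(\mathbf m)\rangle$; $M$ is totally in $\mathbf V$ if $A\ltimes M\in\mathbf V$. $\mathrm{Ab}[A,\mathbf V]$ and $\mathrm{Pnt}[A,\mathbf V]$ denote the categories of $A$-modules and pointed $A$-overalgebras totally in $\mathbf V$. Modulization. Given a pointed $A$-overalgebra $P$, let $\hat{\mathcal M}P$ be the $A$-module with ${}_a(\hat{\mathcal M}P)$ the free abelian group on the set ${}_aP$ and $\omega^{\hat{\mathcal M}P}_{\mathbf a}(\mathbf m)=\sum_{i}\omega^{\hat{\mathcal M}P}_{\mathbf a,i}(m_i)$, where $\omega^{\hat{\mathcal M}P}_{\mathbf a,i}$ is the group homomorphism with $\omega^{\hat{\mathcal M}P}_{\mathbf a,i}(p)=\omega^P_{\mathbf a}({}_{a_1}*,\ldots,{}_{a_{i-1}}*,p,{}_{a_{i+1}}*,\ldots,{}_{a_n}*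 )$ for $p\in{}_{a_i}P$. Let $\mathcal KP$ be the smallest submodule (family of subgroups closed under all $\omega_{\mathbf a}$) containing every ${}_a*$ and every $\omega^P_{\mathbf a}(\mathbf p)-\sum_i\omega^{\hat{\mathcal M}P}_{\mathbf a,i}(p_i)$. Then $\mathcal MP=\hat{\mathcal M}P/\mathcal KP$, and ${}_a(\eta P):{}_aP\to{}_a(\mathcal MP)$ sends $p$ to its class; $\langle\mathcal MP,\eta P\rangle$ is a universal arrow from $P$ to $\mathcal U$, and $\mathcal MP$ is totally in $\mathbf V$ if $P$ is. Unary polynomials. $U=\mathrm{Pol}_1(A,\mathbf V)$ is the coproduct in $\mathbf V$ of $A$ and the free algebra $\mathcal F_{\mathbf V}\{x\}$, with insertion $\iota_A:A\to U$; one writes $a$ for $\iota_A(a)$. For $u\in U$, $b\in A$, $u(b)\in A$ is the image of $u$ under the homomorphism $\pi_b:U\to A$ with $a\mapsto a$, $x\mapsto b$. For $b\in A$, $U_b$ is the pointed $A$-overalgebra (totally in $\mathbf V$) with ${}_aU_b=\pi_b^{-1}(a)$, basepoint $\iota_A(a)$, and $\omega^{U_b}_{\mathbf a}(\mathbf u)=\omega^U(\mathbf u)$. It is free in $\mathrm{Pnt}[A,\mathbf V]$ on $x\in{}_bU_b$; for $M\in\mathrm{Ab}[A,\mathbf V]$ and $m\in{}_bM$, $u^M_{\langle b\rangle}(m)\in{}_{u(b)}M$ is the image of $u$ under the unique homomorphism $U_b\to\mathcal UM$ sending $x$ to $m$. Enveloping ringoid. Put ${}_aZ_b={}_a(\mathcal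 MU_b)$ and $(u)_b={}_{u(b)}(\eta U_b)(u)\in{}_{u(b)}Z_b$. $\mathcal MU_b$ is free in $\mathrm{Ab}[A,\mathbf V]$ on $(x)_b$: for $M\in\mathrm{Ab}[A,\mathbf V]$ and $m\in{}_bM$ there is a unique homomorphism $\theta_{b,m}:\mathcal MU_b\to M$ sending $(x)_b$ to $m$. For $z\in{}_aZ_b$, $m\in{}_bM$ put $zm={}_a(\theta_{b,m})(z)\in{}_aM$. For $z\in{}_aZ_b$, $z'\in{}_bZ_c$, $zz'\in{}_aZ_c$ is the result of the action of $z$ on $z'\in{}_b(\mathcal MU_c)$. With this multiplication $Z=\mathbb Z[A,\mathbf V]$ is a ringoid (small category whose hom-sets are abelian groups with bilinear composition) with object set $|A|$, ${}_aZ_b$ being the hom-set from $b$ to $a$, $1_b=(x)_b$ and ${}_a0_b=(a)_b$. A ringoid homomorphism is an additive functor. $\mathrm{End}(M)$ is the ringoid with object set $|A|$ and ${}_{a'}\mathrm{End}(M)_a=\mathrm{Hom}({}_aM,{}_{a'}M)$ (abelian group homomorphisms). A subringoid of a ringoid $X$ is a family of subgroups ${}_bX'_a\subseteq{}_bX_a$, containing the identities and closed under composition. $Z_M$ is the smallest subringoid of $\mathrm{End}(M)$ (with the same objects) containing all the homomorphisms $\omega^M_{\mathbf a,i}$. *)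

theory Defs
  imports "HOL-Algebra.Free_Abelian_Groups"
begin

section \<open>Algebras and varieties\<close>

text \<open>
  A type is a family \<open>\<Omega> :: nat \<Rightarrow> 'f set\<close>, where \<open>\<Omega> n\<close> is the set of \<open>n\<close>-ary operation symbols;
  each \<open>\<Omega> n\<close> may be empty, and so may the carrier of an algebra. An \<open>n\<close>-tuple is a list of
  length \<open>n\<close>, so that an operation symbol is interpreted by a function on lists.
\<close>

definition tuples :: "nat \<Rightarrow> 'a set \<Rightarrow> 'a list set" where
  "tuples n S = {xs. length xs = n \<and> set xs \<subseteq> S}"

record ('f, 'a) alg = "'a partial_object" +
  opn :: "'f \<Rightarrow> 'a list \<Rightarrow> 'a"

locale universal_algebra =
  fixes \<Omega> :: "nat \<Rightarrow> 'f set" and A :: "('f, 'a) alg"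
  assumes opn_closed: "\<lbrakk>\<omega> \<in> \<Omega> n; as \<in> tuples n (carrier A)\<rbrakk> \<Longrightarrow> opn A \<omega> as \<in> carrier A"

definition alg_hom :: "(nat \<Rightarrow> 'f set) \<Rightarrow> ('f, 'a) alg \<Rightarrow> ('f, 'b) alg \<Rightarrow> ('a \<Rightarrow> 'b) set" where
  "alg_hom \<Omega> A B = {h \<in> carrier A \<rightarrow>\<^sub>E carrier B.
     \<forall>n. \<forall>\<omega>\<in>\<Omega> n. \<forall>as\<in>tuples n (carrier A). h (opn A \<omega> as) = opn B \<omega> (map h as)}"

datatype ('f, 'v) trm = Var 'v | App 'f "('f, 'v) trm list"

inductive_set terms :: "(nat \<Rightarrow> 'f set) \<Rightarrow> 'v set \<Rightarrow> ('f, 'v) trm set"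
  for \<Omega> :: "nat \<Rightarrow> 'f set" and X :: "'v set" where
  Var: "x \<in> X \<Longrightarrow> Var x \<in> terms \<Omega> X"
| App: "\<omega> \<in> \<Omega> n \<Longrightarrow> length ts = n \<Longrightarrow> \<forall>t\<in>set ts. t \<in> terms \<Omega> X \<Longrightarrow> App \<omega> ts \<in> terms \<Omega> X"

primrec eval :: "('f, 'a) alg \<Rightarrow> ('v \<Rightarrow> 'a) \<Rightarrow> ('f, 'v) trm \<Rightarrow> 'a" where
  "eval A v (Var x) = v x"
| "eval A v (App \<omega> ts) = opn A \<omega> (map (eval A v) ts)"

definition term_alg :: "(nat \<Rightarrow> 'f set) \<Rightarrow> 'v set \<Rightarrow> ('f, ('f, 'v) trm) alg" where
  "term_alg \<Omega> X = \<lparr>carrier = terms \<Omega> X, opn = App\<rparr>"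

text \<open>
  A variety is given by a set \<open>E\<close> of identities in countably many variables; it is the class of
  all algebras satisfying \<open>E\<close>, over whatever type of elements. An identity whose terms contain a
  variable holds in the empty algebra; one whose terms contain none presupposes a nullary symbol,
  and then no algebra is empty.
\<close>

definition in_variety ::
  "(nat \<Rightarrow> 'f set) \<Rightarrow> (('f, nat) trm \<times> ('f, nat) trm) set \<Rightarrow> ('f, 'a) alg \<Rightarrow> bool" where
  "in_variety \<Omega> E A \<longleftrightarrow> universal_algebra \<Omega> A \<and>
     (\<forall>(s, t)\<in>E. \<forall>v. range v \<subseteq> carrier A \<longrightarrow> eval A v s = eval A v t)"


section \<open>Algebras presented by generators and relations; coproducts in a variety\<close>

definition quotient_alg :: "('f, 'a) alg \<Rightarrow> ('a \<times> 'a) set \<Rightarrow> ('f, 'a set) alg" where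
  "quotient_alg A \<theta> = \<lparr>carrier = carrier A // \<theta>,
     opn = (\<lambda>\<omega> Cs. \<Union>as\<in>listset Cs. \<theta> `` {opn A \<omega> as})\<rparr>"

text \<open>
  The smallest congruence of the term algebra on \<open>X\<close> that contains \<open>R\<close> and whose quotient
  satisfies \<open>E\<close>.
\<close>

inductive_set presented_cong ::
  "(nat \<Rightarrow> 'f set) \<Rightarrow> (('f, nat) trm \<times> ('f, nat) trm) set \<Rightarrow> 'v set \<Rightarrow>
   (('f, 'v) trm \<times> ('f, 'v) trm) set \<Rightarrow> (('f, 'v) trm \<times> ('f, 'v) trm) set"
  for \<Omega> :: "nat \<Rightarrow> 'f set" and E X R where
  rel: "(s, t) \<in> R \<Longrightarrow> (s, t) \<in> presented_cong \<Omega> E X R"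
| identity: "\<lbrakk>(s, t) \<in> E; range \<sigma> \<subseteq> terms \<Omega> X\<rbrakk> \<Longrightarrow>
    (eval (term_alg \<Omega> X) \<sigma> s, eval (term_alg \<Omega> X) \<sigma> t) \<in> presented_cong \<Omega> E X R"
| refl: "t \<in> terms \<Omega> X \<Longrightarrow> (t, t) \<in> presented_cong \<Omega> E X R"
| sym: "(s, t) \<in> presented_cong \<Omega> E X R \<Longrightarrow> (t, s) \<in> presented_cong \<Omega> E X R"
| trans: "\<lbrakk>(s, t) \<in> presented_cong \<Omega> E X R; (t, r) \<in> presented_cong \<Omega> E X R\<rbrakk> \<Longrightarrow>
    (s, r) \<in> presented_cong \<Omega> E X R"
| cong: "\<lbrakk>\<omega> \<in> \<Omega> n; length ss = n; length ts = n;
    \<forall>i<n. (ss ! i, ts ! i) \<in> presented_cong \<Omega> E X R\<rbrakk> \<Longrightarrow>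
    (App \<omega> ss, App \<omega> ts) \<in> presented_cong \<Omega> E X R"

definition presented_alg where
  "presented_alg \<Omega> E X R = quotient_alg (term_alg \<Omega> X) (presented_cong \<Omega> E X R)"

definition presented_gen where
  "presented_gen \<Omega> E X R x = presented_cong \<Omega> E X R `` {Var x}"

definition free_alg ::
  "(nat \<Rightarrow> 'f set) \<Rightarrow> (('f, nat) trm \<times> ('f, nat) trm) set \<Rightarrow> 'v set \<Rightarrow> ('f, ('f, 'v) trm set) alg"
  where "free_alg \<Omega> E X = presented_alg \<Omega> E X {}"

definition free_gen ::
  "(nat \<Rightarrow> 'f set) \<Rightarrow> (('f, nat) trm \<times> ('f, nat) trm) set \<Rightarrow> 'v set \<Rightarrow> 'v \<Rightarrow> ('f, 'v) trm set"
  where "free_gen \<Omega> E X = presented_gen \<Omega> E X {}"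

text \<open>
  The coproduct in the variety is presented by the disjoint union of the two carriers, subject to
  the operation tables of both algebras; its universal property is proved below.
\<close>

definition diagram ::
  "(nat \<Rightarrow> 'f set) \<Rightarrow> ('a \<Rightarrow> 'v) \<Rightarrow> ('f, 'a) alg \<Rightarrow> (('f, 'v) trm \<times> ('f, 'v) trm) set" where
  "diagram \<Omega> \<iota> A = {(App \<omega> (map (Var \<circ> \<iota>) as), Var (\<iota> (opn A \<omega> as))) | n \<omega> as.
     \<omega> \<in> \<Omega> n \<and> as \<in> tuples n (carrier A)}"

definition coprod ::
  "(nat \<Rightarrow> 'f set) \<Rightarrow> (('f, nat) trm \<times> ('f, nat) trm) set \<Rightarrow> ('f, 'a) alg \<Rightarrow> ('f, 'b) alg \<Rightarrow>
   ('f, ('f, 'a + 'b) trm set) alg" where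
  "coprod \<Omega> E A B =
     presented_alg \<Omega> E (carrier A <+> carrier B) (diagram \<Omega> Inl A \<union> diagram \<Omega> Inr B)"

definition coprod_in ::
  "(nat \<Rightarrow> 'f set) \<Rightarrow> (('f, nat) trm \<times> ('f, nat) trm) set \<Rightarrow> ('f, 'a) alg \<Rightarrow> ('f, 'b) alg \<Rightarrow>
   'a + 'b \<Rightarrow> ('f, 'a + 'b) trm set" where
  "coprod_in \<Omega> E A B =
     presented_gen \<Omega> E (carrier A <+> carrier B) (diagram \<Omega> Inl A \<union> diagram \<Omega> Inr B)"


subsection \<open>Universal properties\<close>

lemma in_listset_iff: "xs \<in> listset As \<longleftrightarrow> list_all2 (\<in>) xs As"
  by (induction As arbitrary: xs) (auto simp: set_Cons_def list_all2_Cons2)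

lemma eval_closed:
  assumes "universal_algebra \<Omega> A" "t \<in> terms \<Omega> X" "\<And>x. x \<in> X \<Longrightarrow> v x \<in> carrier A"
  shows "eval A v t \<in> carrier A"
  using assms(2)
proof induction
  case (App \<omega> n ts)
  then have "map (eval A v) ts \<in> tuples n (carrier A)" by (auto simp: tuples_def)
  then show ?case using universal_algebra.opn_closed[OF assms(1) \<open>\<omega> \<in> \<Omega> n\<close>] by simp
qed (simp add: assms)

lemma alg_hom_eval:
  assumes "universal_algebra \<Omega> A" "h \<in> alg_hom \<Omega> A B" "t \<in> terms \<Omega> X"
    and v: "\<And>x. x \<in> X \<Longrightarrow> v x \<in> carrier A"
  shows "h (eval A v t) = eval B (h \<circ> v) t"
  using assms(3)
proof induction
  case (App \<omega> n ts)
  then have "map (eval A v) ts \<in> tuples n (carrier A)"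
    using eval_closed[OF assms(1) _ v] by (fastforce simp: tuples_def)
  then have "h (eval A v (App \<omega> ts)) = opn B \<omega> (map h (map (eval A v) ts))"
    using assms(2) App by (simp add: alg_hom_def)
  also have "map h (map (eval A v) ts) = map (eval B (h \<circ> v)) ts"
    using App by (simp add: comp_def)
  finally show ?case by (simp add: comp_def)
qed simp

lemma alg_hom_closed: "\<lbrakk>h \<in> alg_hom \<Omega> A B; a \<in> carrier A\<rbrakk> \<Longrightarrow> h a \<in> carrier B"
  by (auto simp: alg_hom_def)

lemma alg_hom_opn:
  "\<lbrakk>h \<in> alg_hom \<Omega> A B; \<omega> \<in> \<Omega> n; as \<in> tuples n (carrier A)\<rbrakk> \<Longrightarrow>
    h (opn A \<omega> as) = opn B \<omega> (map h as)"
  unfolding alg_hom_def by blast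

lemma alg_homI:
  assumes "\<And>a. a \<in> carrier A \<Longrightarrow> h a \<in> carrier B" "h \<in> extensional (carrier A)"
    and "\<And>n \<omega> as. \<omega> \<in> \<Omega> n \<Longrightarrow> as \<in> tuples n (carrier A) \<Longrightarrow>
      h (opn A \<omega> as) = opn B \<omega> (map h as)"
  shows "h \<in> alg_hom \<Omega> A B"
  using assms by (simp add: alg_hom_def PiE_def)

lemma alg_hom_compose:
  assumes "universal_algebra \<Omega> A" and h: "h \<in> alg_hom \<Omega> A B" and g: "g \<in> alg_hom \<Omega> B C"
  shows "compose (carrier A) g h \<in> alg_hom \<Omega> A C"
proof (rule alg_homI)
  fix n \<omega> as assume \<omega>: "\<omega> \<in> \<Omega> n" and as: "as \<in> tuples n (carrier A)"
  have "map h as \<in> tuples n (carrier B)"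
    using as alg_hom_closed[OF h] by (auto simp: tuples_def)
  then have "g (h (opn A \<omega> as)) = opn C \<omega> (map g (map h as))"
    using alg_hom_opn[OF h \<omega> as] alg_hom_opn[OF g \<omega>] by simp
  moreover have "map g (map h as) = map (compose (carrier A) g h) as"
    using as by (auto simp: tuples_def compose_def)
  moreover have "opn A \<omega> as \<in> carrier A"
    by (rule universal_algebra.opn_closed[OF assms(1) \<omega> as])
  ultimately show "compose (carrier A) g h (opn A \<omega> as) = opn C \<omega> (map (compose (carrier A) g h) as)"
    by (metis compose_eq)
qed (simp_all add: compose_def alg_hom_closed[OF g] alg_hom_closed[OF h])

lemma alg_hom_id:
  assumes "universal_algebra \<Omega> A"
  shows "(\<lambda>a\<in>carrier A. a) \<in> alg_hom \<Omega> A A"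
proof (rule alg_homI)
  fix n \<omega> as assume \<omega>: "\<omega> \<in> \<Omega> n" and as: "as \<in> tuples n (carrier A)"
  have "map (\<lambda>a\<in>carrier A. a) as = as"
    using as by (intro map_idI) (auto simp: tuples_def)
  then show "(\<lambda>a\<in>carrier A. a) (opn A \<omega> as) = opn A \<omega> (map (\<lambda>a\<in>carrier A. a) as)"
    using universal_algebra.opn_closed[OF assms \<omega> as] by simp
qed simp_all

lemma universal_algebra_term_alg: "universal_algebra \<Omega> (term_alg \<Omega> X)"
  by unfold_locales (auto simp: term_alg_def tuples_def intro!: terms.App)

lemma presented_cong_in_terms:
  assumes "E \<subseteq> terms \<Omega> UNIV \<times> terms \<Omega> UNIV" "R \<subseteq> terms \<Omega> X \<times> terms \<Omega> X"
    and "(s, t) \<in> presented_cong \<Omega> E X R"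
  shows "s \<in> terms \<Omega> X \<and> t \<in> terms \<Omega> X"
  using assms(3)
proof induction
  case (identity s t \<sigma>)
  then have "s \<in> terms \<Omega> UNIV" "t \<in> terms \<Omega> UNIV" using assms(1) by auto
  then show ?case
    using eval_closed[OF universal_algebra_term_alg, of _ \<Omega> UNIV \<sigma> X] identity
    by (auto simp: term_alg_def)
next
  case (cong \<omega> n ss ts)
  then show ?case by (auto simp: in_set_conv_nth intro!: terms.App)
qed (use assms(2) in auto)

lemma equiv_presented_cong:
  assumes "E \<subseteq> terms \<Omega> UNIV \<times> terms \<Omega> UNIV" "R \<subseteq> terms \<Omega> X \<times> terms \<Omega> X"
  shows "equiv (terms \<Omega> X) (presented_cong \<Omega> E X R)"
proof (rule equivI)
  show "presented_cong \<Omega> E X R \<subseteq> terms \<Omega> X \<times> terms \<Omega> X"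
    using presented_cong_in_terms[OF assms] by auto
  show "refl_on (terms \<Omega> X) (presented_cong \<Omega> E X R)"
    by (auto simp: refl_on_def presented_cong.refl)
  show "sym (presented_cong \<Omega> E X R)" by (auto intro: symI presented_cong.sym)
  show "trans (presented_cong \<Omega> E X R)" by (auto intro: transI presented_cong.trans)
qed

context
  fixes \<Omega> :: "nat \<Rightarrow> 'f set" and E :: "(('f, nat) trm \<times> ('f, nat) trm) set" and X :: "'v set" and R
  assumes E: "E \<subseteq> terms \<Omega> UNIV \<times> terms \<Omega> UNIV" and R: "R \<subseteq> terms \<Omega> X \<times> terms \<Omega> X"
begin

private abbreviation "\<Theta> \<equiv> presented_cong \<Omega> E X R"

lemma opn_presented_alg:
  assumes "\<omega> \<in> \<Omega> n" "ts \<in> tuples n (terms \<Omega> X)"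
  shows "opn (presented_alg \<Omega> E X R) \<omega> (map (\<lambda>t. \<Theta> `` {t}) ts) = \<Theta> `` {App \<omega> ts}"
proof -
  note eq = equiv_presented_cong[OF E R]
  have "\<Theta> `` {App \<omega> ss} = \<Theta> `` {App \<omega> ts}" if "ss \<in> listset (map (\<lambda>t. \<Theta> `` {t}) ts)" for ss
  proof -
    have "length ss = n" "\<forall>i<n. (ts ! i, ss ! i) \<in> \<Theta>"
      using that assms(2) by (auto simp: in_listset_iff list_all2_conv_all_nth tuples_def)
    then have "(App \<omega> ts, App \<omega> ss) \<in> \<Theta>"
      using assms by (intro presented_cong.cong[of \<omega> \<Omega> n]) (auto simp: tuples_def)
    then show ?thesis by (rule equiv_class_eq[OF eq, symmetric])
  qed
  moreover have "ts \<in> listset (map (\<lambda>t. \<Theta> `` {t}) ts)"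
    using assms(2)
    by (auto simp: in_listset_iff list_all2_conv_all_nth tuples_def
        intro!: presented_cong.refl)
  ultimately have "(\<Union>ss\<in>listset (map (\<lambda>t. \<Theta> `` {t}) ts). \<Theta> `` {App \<omega> ss}) = \<Theta> `` {App \<omega> ts}"
    by blast
  then show ?thesis
    by (simp add: presented_alg_def quotient_alg_def term_alg_def)
qed

lemma carrier_presented_alg: "carrier (presented_alg \<Omega> E X R) = (\<lambda>t. \<Theta> `` {t}) ` terms \<Omega> X"
  by (auto simp: presented_alg_def quotient_alg_def term_alg_def quotient_def)

lemma tuples_presented_algE:
  assumes "Cs \<in> tuples n (carrier (presented_alg \<Omega> E X R))"
  obtains ts where "ts \<in> tuples n (terms \<Omega> X)" "Cs = map (\<lambda>t. \<Theta> `` {t}) ts"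
proof -
  have "Cs \<in> lists ((\<lambda>t. \<Theta> `` {t}) ` terms \<Omega> X)"
    using assms by (auto simp: tuples_def carrier_presented_alg)
  then obtain ts where "ts \<in> lists (terms \<Omega> X)" "Cs = map (\<lambda>t. \<Theta> `` {t}) ts"
    by (auto simp: lists_image)
  with assms that show ?thesis by (auto simp: tuples_def)
qed

lemma universal_algebra_presented_alg: "universal_algebra \<Omega> (presented_alg \<Omega> E X R)"
proof
  fix \<omega> n Cs assume \<omega>: "\<omega> \<in> \<Omega> n" and "Cs \<in> tuples n (carrier (presented_alg \<Omega> E X R))"
  then obtain ts where ts: "ts \<in> tuples n (terms \<Omega> X)" "Cs = map (\<lambda>t. \<Theta> `` {t}) ts"
    using tuples_presented_algE by metis
  then have "App \<omega> ts \<in> terms \<Omega> X"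
    using \<omega> by (auto simp: tuples_def intro!: terms.App)
  then show "opn (presented_alg \<Omega> E X R) \<omega> Cs \<in> carrier (presented_alg \<Omega> E X R)"
    unfolding ts(2) opn_presented_alg[OF \<omega> ts(1)] by (auto simp: carrier_presented_alg)
qed

lemma eval_presented_alg:
  assumes "t \<in> terms \<Omega> Y" "\<And>y. y \<in> Y \<Longrightarrow> \<sigma> y \<in> terms \<Omega> X"
  shows "eval (presented_alg \<Omega> E X R) (\<lambda>y. \<Theta> `` {\<sigma> y}) t = \<Theta> `` {eval (term_alg \<Omega> X) \<sigma> t}"
  using assms(1)
proof induction
  case (App \<omega> n ts)
  have "map (eval (term_alg \<Omega> X) \<sigma>) ts \<in> tuples n (terms \<Omega> X)"
    using App eval_closed[OF universal_algebra_term_alg, of _ \<Omega> Y \<sigma> X] assms(2)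
    by (auto simp: tuples_def term_alg_def)
  from opn_presented_alg[OF \<open>\<omega> \<in> \<Omega> n\<close> this] App show ?case
    by (simp add: comp_def term_alg_def cong: map_cong)
qed simp

lemma in_variety_presented_alg: "in_variety \<Omega> E (presented_alg \<Omega> E X R)"
proof -
  have "eval (presented_alg \<Omega> E X R) v s = eval (presented_alg \<Omega> E X R) v t"
    if st: "(s, t) \<in> E" and v: "range v \<subseteq> carrier (presented_alg \<Omega> E X R)"
    for s t and v :: "nat \<Rightarrow> ('f, 'v) trm set"
  proof -
    from v have "\<forall>i. \<exists>r\<in>terms \<Omega> X. v i = \<Theta> `` {r}" by (auto simp: carrier_presented_alg)
    then obtain \<sigma> where \<sigma>: "\<And>i. \<sigma> i \<in> terms \<Omega> X" "\<And>i. v i = \<Theta> `` {\<sigma> i}" by metis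
    have v_eq: "v = (\<lambda>i. \<Theta> `` {\<sigma> i})" using \<sigma>(2) by auto
    have "s \<in> terms \<Omega> UNIV" "t \<in> terms \<Omega> UNIV" using E st by auto
    moreover have "(eval (term_alg \<Omega> X) \<sigma> s, eval (term_alg \<Omega> X) \<sigma> t) \<in> \<Theta>"
      using st \<sigma>(1) by (auto intro: presented_cong.identity)
    then have "\<Theta> `` {eval (term_alg \<Omega> X) \<sigma> s} = \<Theta> `` {eval (term_alg \<Omega> X) \<sigma> t}"
      by (rule equiv_class_eq[OF equiv_presented_cong[OF E R]])
    ultimately show ?thesis
      unfolding v_eq using \<sigma>(1) eval_presented_alg[of _ UNIV \<sigma>] by metis
  qed
  then show ?thesis
    using universal_algebra_presented_alg unfolding in_variety_def by blast
qed

lemma presented_gen_closed: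
  "x \<in> X \<Longrightarrow> presented_gen \<Omega> E X R x \<in> carrier (presented_alg \<Omega> E X R)"
  by (auto simp: presented_gen_def carrier_presented_alg intro: terms.Var)

lemma eval_presented_gen:
  assumes "t \<in> terms \<Omega> X"
  shows "eval (presented_alg \<Omega> E X R) (presented_gen \<Omega> E X R) t = \<Theta> `` {t}"
proof -
  have "eval (term_alg \<Omega> X) Var t = t"
    using assms by induction (auto simp: term_alg_def intro: map_idI)
  with eval_presented_alg[OF assms, of Var] show ?thesis
    by (simp add: presented_gen_def[abs_def] terms.Var)
qed

lemma presented_alg_universal:
  assumes B: "in_variety \<Omega> E B" and v: "\<And>x. x \<in> X \<Longrightarrow> v x \<in> carrier B"
    and vR: "\<And>s t. (s, t) \<in> R \<Longrightarrow> eval B v s = eval B v t"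
  shows "\<exists>!h. h \<in> alg_hom \<Omega> (presented_alg \<Omega> E X R) B \<and> (\<forall>x\<in>X. h (presented_gen \<Omega> E X R x) = v x)"
proof -
  let ?P = "presented_alg \<Omega> E X R"
  have uB: "universal_algebra \<Omega> B" using B by (simp add: in_variety_def)
  have ev: "eval B v (eval (term_alg \<Omega> X) \<sigma> s) = eval B (\<lambda>i. eval B v (\<sigma> i)) s" for \<sigma> and s :: "('f, nat) trm"
    by (induction s) (auto simp: term_alg_def comp_def cong: map_cong)
  have sound: "eval B v s = eval B v t" if "(s, t) \<in> \<Theta>" for s t
    using that
  proof induction
    case (identity s t \<sigma>)
    have "range (\<lambda>i. eval B v (\<sigma> i)) \<subseteq> carrier B"
      using identity(2) by (auto intro!: eval_closed[OF uB _ v])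
    moreover have "\<forall>w. range w \<subseteq> carrier B \<longrightarrow> eval B w s = eval B w t"
      using B identity(1) by (auto simp: in_variety_def)
    ultimately show ?case unfolding ev by simp
  next
    case (cong \<omega> n ss ts)
    then have "map (eval B v) ss = map (eval B v) ts" by (intro nth_equalityI) auto
    then show ?case by simp
  qed (auto intro: vR)
  define h where "h = (\<lambda>C\<in>carrier ?P. eval B v (SOME t. t \<in> C))"
  have h: "h (\<Theta> `` {t}) = eval B v t" if "t \<in> terms \<Omega> X" for t
  proof -
    have "(SOME s. s \<in> \<Theta> `` {t}) \<in> \<Theta> `` {t}"
      by (rule someI[of _ t]) (simp add: that presented_cong.refl)
    then have "eval B v t = eval B v (SOME s. s \<in> \<Theta> `` {t})" by (intro sound) simp
    moreover have "\<Theta> `` {t} \<in> carrier ?P" using that by (simp add: carrier_presented_alg)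
    ultimately show ?thesis by (simp add: h_def)
  qed
  have hom: "h \<in> alg_hom \<Omega> ?P B"
  proof (rule alg_homI)
    fix C assume "C \<in> carrier ?P"
    then show "h C \<in> carrier B"
      using h eval_closed[OF uB _ v] by (auto simp: carrier_presented_alg)
  next
    fix n \<omega> Cs assume \<omega>: "\<omega> \<in> \<Omega> n" and "Cs \<in> tuples n (carrier ?P)"
    then obtain ts where ts: "ts \<in> tuples n (terms \<Omega> X)" "Cs = map (\<lambda>t. \<Theta> `` {t}) ts"
      using tuples_presented_algE by metis
    then have "App \<omega> ts \<in> terms \<Omega> X" using \<omega> by (auto simp: tuples_def intro!: terms.App)
    moreover have "map h Cs = map (eval B v) ts" using ts h by (auto simp: tuples_def)
    moreover have "eval B v (App \<omega> ts) = opn B \<omega> (map (eval B v) ts)" by simp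
    ultimately show "h (opn ?P \<omega> Cs) = opn B \<omega> (map h Cs)"
      using h opn_presented_alg[OF \<omega> ts(1)] ts(2) by metis
  qed (simp add: h_def)
  show ?thesis
  proof (rule ex1I[of _ h])
    show "h \<in> alg_hom \<Omega> ?P B \<and> (\<forall>x\<in>X. h (presented_gen \<Omega> E X R x) = v x)"
      using hom by (simp add: presented_gen_def h terms.Var)
  next
    fix k assume k: "k \<in> alg_hom \<Omega> ?P B \<and> (\<forall>x\<in>X. k (presented_gen \<Omega> E X R x) = v x)"
    have "k (\<Theta> `` {t}) = eval B v t" if "t \<in> terms \<Omega> X" for t
    proof -
      have "eval B (k \<circ> presented_gen \<Omega> E X R) t = eval B v t"
        using that
      proof induction
        case (App \<omega> n ts)
        then show ?case by (simp add: comp_def cong: map_cong)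
      qed (use k in simp)
      then show ?thesis
        using alg_hom_eval[OF universal_algebra_presented_alg conjunct1[OF k] that,
            of "presented_gen \<Omega> E X R"] presented_gen_closed
        by (simp add: eval_presented_gen[OF that])
    qed
    then have "k C = h C" if "C \<in> carrier ?P" for C
      using that h by (auto simp: carrier_presented_alg)
    moreover have "k \<in> extensional (carrier ?P)" "h \<in> extensional (carrier ?P)"
      using k hom by (auto simp: alg_hom_def PiE_def)
    ultimately show "k = h" by (intro extensionalityI[of k "carrier ?P" h])
  qed
qed

end

lemma diagram_in_terms:
  assumes "universal_algebra \<Omega> A" "\<iota> ` carrier A \<subseteq> X"
  shows "diagram \<Omega> \<iota> A \<subseteq> terms \<Omega> X \<times> terms \<Omega> X"
proof
  fix p assume "p \<in> diagram \<Omega> \<iota> A"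
  then obtain n \<omega> as where *: "\<omega> \<in> \<Omega> n" "as \<in> tuples n (carrier A)"
    "p = (App \<omega> (map (Var \<circ> \<iota>) as), Var (\<iota> (opn A \<omega> as)))"
    by (auto simp: diagram_def)
  have "App \<omega> (map (Var \<circ> \<iota>) as) \<in> terms \<Omega> X"
  proof (rule terms.App[where n = n])
    show "\<omega> \<in> \<Omega> n" by (rule *(1))
    show "length (map (Var \<circ> \<iota>) as) = n" using *(2) by (simp add: tuples_def)
    show "\<forall>t\<in>set (map (Var \<circ> \<iota>) as). t \<in> terms \<Omega> X"
      using *(2) assms(2) by (auto simp: tuples_def intro!: terms.Var)
  qed
  with * show "p \<in> terms \<Omega> X \<times> terms \<Omega> X"
    using universal_algebra.opn_closed[OF assms(1) *(1,2)] assms(2) by (auto intro!: terms.Var)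
qed

lemma free_alg_universal:
  assumes "E \<subseteq> terms \<Omega> UNIV \<times> terms \<Omega> UNIV" "in_variety \<Omega> E B" "\<And>x. x \<in> X \<Longrightarrow> v x \<in> carrier B"
  shows "\<exists>!h. h \<in> alg_hom \<Omega> (free_alg \<Omega> E X) B \<and> (\<forall>x\<in>X. h (free_gen \<Omega> E X x) = v x)"
  unfolding free_alg_def free_gen_def using assms by (intro presented_alg_universal) auto

lemma in_variety_free_alg:
  "E \<subseteq> terms \<Omega> UNIV \<times> terms \<Omega> UNIV \<Longrightarrow> in_variety \<Omega> E (free_alg \<Omega> E X)"
  unfolding free_alg_def by (intro in_variety_presented_alg) auto

context
  fixes \<Omega> :: "nat \<Rightarrow> 'f set" and E :: "(('f, nat) trm \<times> ('f, nat) trm) set" and A :: "('f, 'a) alg" and B :: "('f, 'b) alg"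
  assumes E: "E \<subseteq> terms \<Omega> UNIV \<times> terms \<Omega> UNIV"
    and A: "in_variety \<Omega> E A" and B: "in_variety \<Omega> E B"
begin

private lemma relations:
  "diagram \<Omega> Inl A \<union> diagram \<Omega> Inr B
    \<subseteq> terms \<Omega> (carrier A <+> carrier B) \<times> terms \<Omega> (carrier A <+> carrier B)"
  using A B diagram_in_terms[of \<Omega> A Inl "carrier A <+> carrier B"]
    diagram_in_terms[of \<Omega> B Inr "carrier A <+> carrier B"]
  by (auto simp: in_variety_def)

lemma in_variety_coprod: "in_variety \<Omega> E (coprod \<Omega> E A B)"
  unfolding coprod_def by (rule in_variety_presented_alg[OF E relations])

lemma coprod_insertion_hom:
  "(\<lambda>a\<in>carrier A. coprod_in \<Omega> E A B (Inl a)) \<in> alg_hom \<Omega> A (coprod \<Omega> E A B)"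
  "(\<lambda>b\<in>carrier B. coprod_in \<Omega> E A B (Inr b)) \<in> alg_hom \<Omega> B (coprod \<Omega> E A B)"
proof -
  let ?X = "carrier A <+> carrier B" and ?R = "diagram \<Omega> Inl A \<union> diagram \<Omega> Inr B"
  have *: "(\<lambda>c\<in>carrier C. coprod_in \<Omega> E A B (\<iota> c)) \<in> alg_hom \<Omega> C (coprod \<Omega> E A B)"
    if C: "universal_algebra \<Omega> C" and \<iota>: "\<iota> ` carrier C \<subseteq> ?X" and dia: "diagram \<Omega> \<iota> C \<subseteq> ?R"
    for C :: "('f, 'c) alg" and \<iota>
    unfolding alg_hom_def
  proof (intro CollectI conjI allI ballI PiE_I)
    fix n \<omega> cs assume \<omega>: "\<omega> \<in> \<Omega> n" and cs: "cs \<in> tuples n (carrier C)"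
    let ?ts = "map (Var \<circ> \<iota>) cs"
    have ts: "?ts \<in> tuples n (terms \<Omega> ?X)" using cs \<iota> by (auto simp: tuples_def intro!: terms.Var)
    have "(App \<omega> ?ts, Var (\<iota> (opn C \<omega> cs))) \<in> diagram \<Omega> \<iota> C"
      using \<omega> cs unfolding diagram_def by blast
    then have "(App \<omega> ?ts, Var (\<iota> (opn C \<omega> cs))) \<in> ?R"
      using dia by blast
    then have "presented_cong \<Omega> E ?X ?R `` {App \<omega> ?ts} = coprod_in \<Omega> E A B (\<iota> (opn C \<omega> cs))"
      unfolding coprod_in_def presented_gen_def
      by (intro equiv_class_eq[OF equiv_presented_cong[OF E relations]] presented_cong.rel)
    moreover have eq: "map (\<lambda>c\<in>carrier C. coprod_in \<Omega> E A B (\<iota> c)) cs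
        = map (\<lambda>t. presented_cong \<Omega> E ?X ?R `` {t}) ?ts"
      using cs by (auto simp: tuples_def coprod_in_def presented_gen_def)
    ultimately show "(\<lambda>c\<in>carrier C. coprod_in \<Omega> E A B (\<iota> c)) (opn C \<omega> cs)
        = opn (coprod \<Omega> E A B) \<omega> (map (\<lambda>c\<in>carrier C. coprod_in \<Omega> E A B (\<iota> c)) cs)"
      unfolding eq coprod_def opn_presented_alg[OF E relations \<omega> ts]
      using universal_algebra.opn_closed[OF C \<omega> cs] by simp
  qed (use \<iota> presented_gen_closed[OF E relations] in \<open>auto simp: coprod_def coprod_in_def\<close>)
  show "(\<lambda>a\<in>carrier A. coprod_in \<Omega> E A B (Inl a)) \<in> alg_hom \<Omega> A (coprod \<Omega> E A B)"
    using A by (intro *) (auto simp: in_variety_def)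
  show "(\<lambda>b\<in>carrier B. coprod_in \<Omega> E A B (Inr b)) \<in> alg_hom \<Omega> B (coprod \<Omega> E A B)"
    using B by (intro *) (auto simp: in_variety_def)
qed

lemma coprod_universal:
  assumes C: "in_variety \<Omega> E C" and h: "h \<in> alg_hom \<Omega> A C" and k: "k \<in> alg_hom \<Omega> B C"
  shows "\<exists>!g. g \<in> alg_hom \<Omega> (coprod \<Omega> E A B) C \<and>
    (\<forall>a\<in>carrier A. g (coprod_in \<Omega> E A B (Inl a)) = h a) \<and>
    (\<forall>b\<in>carrier B. g (coprod_in \<Omega> E A B (Inr b)) = k b)"
proof -
  let ?X = "carrier A <+> carrier B"
  have "\<exists>!g. g \<in> alg_hom \<Omega> (coprod \<Omega> E A B) C \<and>
      (\<forall>x\<in>?X. g (coprod_in \<Omega> E A B x) = case_sum h k x)"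
    unfolding coprod_def coprod_in_def
  proof (rule presented_alg_universal[OF E relations C])
    fix x assume "x \<in> ?X"
    then show "case_sum h k x \<in> carrier C" using h k by (auto simp: alg_hom_def)
  next
    have *: "eval C (case_sum h k) s = eval C (case_sum h k) t"
      if "(s, t) \<in> diagram \<Omega> \<iota> D" "g \<in> alg_hom \<Omega> D C" "\<And>d. case_sum h k (\<iota> d) = g d"
      for s t \<iota> g and D :: "('f, 'd) alg"
    proof -
      obtain n \<omega> ds where "\<omega> \<in> \<Omega> n" "ds \<in> tuples n (carrier D)"
        "s = App \<omega> (map (Var \<circ> \<iota>) ds)" "t = Var (\<iota> (opn D \<omega> ds))"
        using \<open>(s, t) \<in> diagram \<Omega> \<iota> D\<close> by (auto simp: diagram_def)
      moreover from this have "g (opn D \<omega> ds) = opn C \<omega> (map g ds)"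
        using that(2) unfolding alg_hom_def by blast
      ultimately show ?thesis using that(3) by (simp add: comp_def)
    qed
    fix s t assume "(s, t) \<in> diagram \<Omega> Inl A \<union> diagram \<Omega> Inr B"
    then show "eval C (case_sum h k) s = eval C (case_sum h k) t"
      using *[OF _ h, of s t Inl] *[OF _ k, of s t Inr] by auto
  qed
  moreover have "(\<forall>x\<in>?X. P x) \<longleftrightarrow> (\<forall>a\<in>carrier A. P (Inl a)) \<and> (\<forall>b\<in>carrier B. P (Inr b))" for P
    by auto
  ultimately show ?thesis by simp
qed

end


section \<open>Modules and pointed overalgebras\<close>

text \<open>The direct product of a list of groups; for the empty list it is the trivial group.\<close>

definition list_group :: "'m monoid list \<Rightarrow> 'm list monoid" where
  "list_group Gs = \<lparr>carrier = listset (map carrier Gs),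
     monoid.mult = (\<lambda>xs ys. map (\<lambda>i. xs ! i \<otimes>\<^bsub>Gs ! i\<^esub> ys ! i) [0..<length Gs]),
     one = map one Gs\<rparr>"

text \<open>
  Abelian groups are written multiplicatively, as everywhere in \<^theory>\<open>HOL-Algebra.Group\<close>. The
  fibres of a module lie in a common type but need not be disjoint.
\<close>

record ('f, 'a, 'm) module_data =
  fib :: "'a \<Rightarrow> 'm monoid"
  act :: "'f \<Rightarrow> 'a list \<Rightarrow> 'm list \<Rightarrow> 'm"

locale overalgebra_module = universal_algebra \<Omega> A
  for \<Omega> :: "nat \<Rightarrow> 'f set" and A :: "('f, 'a) alg" +
  fixes M :: "('f, 'a, 'm) module_data"
  assumes fib_comm_group: "a \<in> carrier A \<Longrightarrow> comm_group (fib M a)"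
    and act_hom: "\<lbrakk>\<omega> \<in> \<Omega> n; as \<in> tuples n (carrier A)\<rbrakk> \<Longrightarrow>
      act M \<omega> as \<in> hom (list_group (map (fib M) as)) (fib M (opn A \<omega> as))"

text \<open>The homomorphism \<open>\<omega>\<^sup>M\<^bsub>as,i\<^esub>\<close> between fibres; indices start at \<open>0\<close>.\<close>

definition act_at :: "('f, 'a, 'm) module_data \<Rightarrow> 'f \<Rightarrow> 'a list \<Rightarrow> nat \<Rightarrow> 'm \<Rightarrow> 'm" where
  "act_at M \<omega> as i = (\<lambda>m\<in>carrier (fib M (as ! i)). act M \<omega> as ((map (\<lambda>a. \<one>\<^bsub>fib M a\<^esub>) as)[i := m]))"

record ('f, 'a, 'p) pointed_data =
  pset :: "'a \<Rightarrow> 'p set"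
  pt :: "'a \<Rightarrow> 'p"
  pact :: "'f \<Rightarrow> 'a list \<Rightarrow> 'p list \<Rightarrow> 'p"

definition forget :: "('f, 'a, 'm) module_data \<Rightarrow> ('f, 'a, 'm) pointed_data" where
  "forget M = \<lparr>pset = (\<lambda>a. carrier (fib M a)), pt = (\<lambda>a. \<one>\<^bsub>fib M a\<^esub>), pact = act M\<rparr>"

definition total_alg :: "('f, 'a) alg \<Rightarrow> ('f, 'a, 'm) module_data \<Rightarrow> ('f, 'a \<times> 'm) alg" where
  "total_alg A M = \<lparr>carrier = (SIGMA a:carrier A. carrier (fib M a)),
     opn = (\<lambda>\<omega> xs. (opn A \<omega> (map fst xs), act M \<omega> (map fst xs) (map snd xs)))\<rparr>"

definition module_hom ::
  "(nat \<Rightarrow> 'f set) \<Rightarrow> ('f, 'a) alg \<Rightarrow> ('f, 'a, 'm) module_data \<Rightarrow> ('f, 'a, 'n) module_data \<Rightarrow>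
   ('a \<Rightarrow> 'm \<Rightarrow> 'n) set" where
  "module_hom \<Omega> A M N =
     {\<phi> \<in> (\<Pi>\<^sub>E a\<in>carrier A. hom (fib M a) (fib N a) \<inter> extensional (carrier (fib M a))).
       \<forall>n. \<forall>\<omega>\<in>\<Omega> n. \<forall>as\<in>tuples n (carrier A). \<forall>ms\<in>listset (map (\<lambda>a. carrier (fib M a)) as).
         \<phi> (opn A \<omega> as) (act M \<omega> as ms) = act N \<omega> as (map2 \<phi> as ms)}"

definition pointed_hom ::
  "(nat \<Rightarrow> 'f set) \<Rightarrow> ('f, 'a) alg \<Rightarrow> ('f, 'a, 'p) pointed_data \<Rightarrow> ('f, 'a, 'q) pointed_data \<Rightarrow>
   ('a \<Rightarrow> 'p \<Rightarrow> 'q) set" where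
  "pointed_hom \<Omega> A P Q =
     {\<phi> \<in> (\<Pi>\<^sub>E a\<in>carrier A. {h \<in> pset P a \<rightarrow>\<^sub>E pset Q a. h (pt P a) = pt Q a}).
       \<forall>n. \<forall>\<omega>\<in>\<Omega> n. \<forall>as\<in>tuples n (carrier A). \<forall>ps\<in>listset (map (pset P) as).
         \<phi> (opn A \<omega> as) (pact P \<omega> as ps) = pact Q \<omega> as (map2 \<phi> as ps)}"

definition submodule ::
  "(nat \<Rightarrow> 'f set) \<Rightarrow> ('f, 'a) alg \<Rightarrow> ('f, 'a, 'm) module_data \<Rightarrow> ('a \<Rightarrow> 'm set) \<Rightarrow> bool" where
  "submodule \<Omega> A M S \<longleftrightarrow> (\<forall>a\<in>carrier A. subgroup (S a) (fib M a)) \<and>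
     (\<forall>n. \<forall>\<omega>\<in>\<Omega> n. \<forall>as\<in>tuples n (carrier A). \<forall>ms\<in>listset (map S as).
        act M \<omega> as ms \<in> S (opn A \<omega> as))"

text \<open>The union in the action is over all choices of representatives, which give the same coset.\<close>

definition quotient_module ::
  "('f, 'a) alg \<Rightarrow> ('f, 'a, 'm) module_data \<Rightarrow> ('a \<Rightarrow> 'm set) \<Rightarrow> ('f, 'a, 'm set) module_data" where
  "quotient_module A M S = \<lparr>fib = (\<lambda>a. fib M a Mod S a),
     act = (\<lambda>\<omega> as Cs. \<Union>ms\<in>listset Cs. S (opn A \<omega> as) #>\<^bsub>fib M (opn A \<omega> as)\<^esub> act M \<omega> as ms)\<rparr>"


section \<open>Modulization\<close>

definition free_module ::
  "('f, 'a, 'p) pointed_data \<Rightarrow> ('f, 'a, 'p \<Rightarrow>\<^sub>0 int) module_data" where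
  "free_module P = \<lparr>fib = (\<lambda>a. free_Abelian_group (pset P a)),
     act = (\<lambda>\<omega> as ms. \<Sum>i<length as.
       frag_extend (\<lambda>p. frag_of (pact P \<omega> as ((map (pt P) as)[i := p]))) (ms ! i))\<rparr>"

definition modulization_kernel ::
  "(nat \<Rightarrow> 'f set) \<Rightarrow> ('f, 'a) alg \<Rightarrow> ('f, 'a, 'p) pointed_data \<Rightarrow> 'a \<Rightarrow> ('p \<Rightarrow>\<^sub>0 int) set" where
  "modulization_kernel \<Omega> A P a = \<Inter> {S a | S. submodule \<Omega> A (free_module P) S \<and>
     (\<forall>b\<in>carrier A. frag_of (pt P b) \<in> S b) \<and>
     (\<forall>n. \<forall>\<omega>\<in>\<Omega> n. \<forall>as\<in>tuples n (carrier A). \<forall>ps\<in>listset (map (pset P) as).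
        frag_of (pact P \<omega> as ps) - (\<Sum>i<n. act_at (free_module P) \<omega> as i (frag_of (ps ! i)))
          \<in> S (opn A \<omega> as))}"

definition modulization ::
  "(nat \<Rightarrow> 'f set) \<Rightarrow> ('f, 'a) alg \<Rightarrow> ('f, 'a, 'p) pointed_data \<Rightarrow>
   ('f, 'a, ('p \<Rightarrow>\<^sub>0 int) set) module_data" where
  "modulization \<Omega> A P = quotient_module A (free_module P) (modulization_kernel \<Omega> A P)"

definition modulization_unit ::
  "(nat \<Rightarrow> 'f set) \<Rightarrow> ('f, 'a) alg \<Rightarrow> ('f, 'a, 'p) pointed_data \<Rightarrow> 'a \<Rightarrow> 'p \<Rightarrow> ('p \<Rightarrow>\<^sub>0 int) set" where
  "modulization_unit \<Omega> A P a p =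
     modulization_kernel \<Omega> A P a #>\<^bsub>free_Abelian_group (pset P a)\<^esub> frag_of p"


section \<open>Unary polynomials\<close>

type_synonym ('f, 'a) pol = "('f, 'a + ('f, unit) trm set) trm set"

definition Pol1 ::
  "(nat \<Rightarrow> 'f set) \<Rightarrow> (('f, nat) trm \<times> ('f, nat) trm) set \<Rightarrow> ('f, 'a) alg \<Rightarrow>
   ('f, ('f, 'a) pol) alg" where
  "Pol1 \<Omega> E A = coprod \<Omega> E A (free_alg \<Omega> E {()})"

definition pol_const ::
  "(nat \<Rightarrow> 'f set) \<Rightarrow> (('f, nat) trm \<times> ('f, nat) trm) set \<Rightarrow> ('f, 'a) alg \<Rightarrow> 'a \<Rightarrow> ('f, 'a) pol" where
  "pol_const \<Omega> E A a = coprod_in \<Omega> E A (free_alg \<Omega> E {()}) (Inl a)"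

definition pol_var ::
  "(nat \<Rightarrow> 'f set) \<Rightarrow> (('f, nat) trm \<times> ('f, nat) trm) set \<Rightarrow> ('f, 'a) alg \<Rightarrow> ('f, 'a) pol" where
  "pol_var \<Omega> E A = coprod_in \<Omega> E A (free_alg \<Omega> E {()}) (Inr (free_gen \<Omega> E {()} ()))"

text \<open>The homomorphism \<open>\<pi>\<^sub>b\<close>; thus \<open>u(b)\<close> is \<open>pol_eval \<Omega> E A b u\<close>.\<close>

definition pol_eval ::
  "(nat \<Rightarrow> 'f set) \<Rightarrow> (('f, nat) trm \<times> ('f, nat) trm) set \<Rightarrow> ('f, 'a) alg \<Rightarrow>
   'a \<Rightarrow> ('f, 'a) pol \<Rightarrow> 'a" where
  "pol_eval \<Omega> E A b = (THE \<pi>. \<pi> \<in> alg_hom \<Omega> (Pol1 \<Omega> E A) A \<and>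
     (\<forall>a\<in>carrier A. \<pi> (pol_const \<Omega> E A a) = a) \<and> \<pi> (pol_var \<Omega> E A) = b)"

lemma pol_eval_unique_exists:
  assumes E: "E \<subseteq> terms \<Omega> UNIV \<times> terms \<Omega> UNIV" and A: "in_variety \<Omega> E A" and b: "b \<in> carrier A"
  shows "\<exists>!\<pi>. \<pi> \<in> alg_hom \<Omega> (Pol1 \<Omega> E A) A \<and>
     (\<forall>a\<in>carrier A. \<pi> (pol_const \<Omega> E A a) = a) \<and> \<pi> (pol_var \<Omega> E A) = b"
proof -
  let ?F = "free_alg \<Omega> E {()}" and ?x = "free_gen \<Omega> E {()} ()"
  let ?in = "coprod_in \<Omega> E A ?F"
  note F = in_variety_free_alg[OF E, of "{()}"]
  have x: "?x \<in> carrier ?F"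
    using presented_gen_closed[OF E, of "{}" "{()}" "()"] by (simp add: free_alg_def free_gen_def)
  obtain k where k: "k \<in> alg_hom \<Omega> ?F A" "k ?x = b"
    and k_unique: "\<And>k'. k' \<in> alg_hom \<Omega> ?F A \<Longrightarrow> k' ?x = b \<Longrightarrow> k' = k"
    using free_alg_universal[OF E A, of "{()}" "\<lambda>_. b"] b by auto
  have uA: "universal_algebra \<Omega> A" and uF: "universal_algebra \<Omega> ?F"
    using A F by (simp_all add: in_variety_def)
  have j: "(\<lambda>y\<in>carrier ?F. ?in (Inr y)) \<in> alg_hom \<Omega> ?F (Pol1 \<Omega> E A)"
    unfolding Pol1_def by (rule coprod_insertion_hom(2)[OF E A F])
  have iff: "\<pi> (?in (Inr ?x)) = b \<longleftrightarrow> (\<forall>y\<in>carrier ?F. \<pi> (?in (Inr y)) = k y)"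
    if \<pi>: "\<pi> \<in> alg_hom \<Omega> (Pol1 \<Omega> E A) A" for \<pi>
  proof
    assume *: "\<pi> (?in (Inr ?x)) = b"
    have "compose (carrier ?F) \<pi> (\<lambda>y\<in>carrier ?F. ?in (Inr y)) = k"
      using x * by (intro k_unique alg_hom_compose[OF uF j \<pi>]) (simp add: compose_def)
    then show "\<forall>y\<in>carrier ?F. \<pi> (?in (Inr y)) = k y" by (auto simp: compose_def)
  next
    assume "\<forall>y\<in>carrier ?F. \<pi> (?in (Inr y)) = k y"
    then show "\<pi> (?in (Inr ?x)) = b" using x k(2) by simp
  qed
  have "\<exists>!\<pi>. \<pi> \<in> alg_hom \<Omega> (Pol1 \<Omega> E A) A \<and>
      (\<forall>a\<in>carrier A. \<pi> (?in (Inl a)) = a) \<and> (\<forall>y\<in>carrier ?F. \<pi> (?in (Inr y)) = k y)"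
    using coprod_universal[OF E A F A alg_hom_id[OF uA] k(1)] by (simp add: Pol1_def)
  then show ?thesis
    unfolding pol_const_def pol_var_def using iff by (simp cong: conj_cong)
qed

definition pol_overalg ::
  "(nat \<Rightarrow> 'f set) \<Rightarrow> (('f, nat) trm \<times> ('f, nat) trm) set \<Rightarrow> ('f, 'a) alg \<Rightarrow> 'a \<Rightarrow>
   ('f, 'a, ('f, 'a) pol) pointed_data" where
  "pol_overalg \<Omega> E A b = \<lparr>pset = (\<lambda>a. {u \<in> carrier (Pol1 \<Omega> E A). pol_eval \<Omega> E A b u = a}),
     pt = pol_const \<Omega> E A,
     pact = (\<lambda>\<omega> as us. opn (Pol1 \<Omega> E A) \<omega> us)\<rparr>"

text \<open>\<open>pol_act \<Omega> E A M b u m\<close> is \<open>u\<^sup>M\<^bsub>\<langle>b\<rangle>\<^esub>(m)\<close>.\<close>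

definition pol_act ::
  "(nat \<Rightarrow> 'f set) \<Rightarrow> (('f, nat) trm \<times> ('f, nat) trm) set \<Rightarrow> ('f, 'a) alg \<Rightarrow>
   ('f, 'a, 'm) module_data \<Rightarrow> 'a \<Rightarrow> ('f, 'a) pol \<Rightarrow> 'm \<Rightarrow> 'm" where
  "pol_act \<Omega> E A M b u m =
     (THE \<phi>. \<phi> \<in> pointed_hom \<Omega> A (pol_overalg \<Omega> E A b) (forget M) \<and> \<phi> b (pol_var \<Omega> E A) = m)
       (pol_eval \<Omega> E A b u) u"


section \<open>Ringoids\<close>

text \<open>
  \<open>rhom X a b\<close> is the group of arrows from \<open>b\<close> to \<open>a\<close>; \<open>rcomp X a b c\<close> composes
  \<open>rhom X a b\<close> with \<open>rhom X b c\<close>. The group operation, written \<open>\<otimes>\<close>, is the addition of arrows.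
\<close>

record ('o, 'h) ringoid_data =
  robj :: "'o set"
  rhom :: "'o \<Rightarrow> 'o \<Rightarrow> 'h monoid"
  rcomp :: "'o \<Rightarrow> 'o \<Rightarrow> 'o \<Rightarrow> 'h \<Rightarrow> 'h \<Rightarrow> 'h"
  rid :: "'o \<Rightarrow> 'h"

locale ringoid =
  fixes X :: "('o, 'h) ringoid_data"
  assumes rhom_comm_group: "\<lbrakk>a \<in> robj X; b \<in> robj X\<rbrakk> \<Longrightarrow> comm_group (rhom X a b)"
    and rcomp_closed: "\<lbrakk>a \<in> robj X; b \<in> robj X; c \<in> robj X;
      f \<in> carrier (rhom X a b); g \<in> carrier (rhom X b c)\<rbrakk> \<Longrightarrow>
      rcomp X a b c f g \<in> carrier (rhom X a c)"
    and rcomp_add_left: "\<lbrakk>a \<in> robj X; b \<in> robj X; c \<in> robj X;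
      f \<in> carrier (rhom X a b); f' \<in> carrier (rhom X a b); g \<in> carrier (rhom X b c)\<rbrakk> \<Longrightarrow>
      rcomp X a b c (f \<otimes>\<^bsub>rhom X a b\<^esub> f') g = rcomp X a b c f g \<otimes>\<^bsub>rhom X a c\<^esub> rcomp X a b c f' g"
    and rcomp_add_right: "\<lbrakk>a \<in> robj X; b \<in> robj X; c \<in> robj X;
      f \<in> carrier (rhom X a b); g \<in> carrier (rhom X b c); g' \<in> carrier (rhom X b c)\<rbrakk> \<Longrightarrow>
      rcomp X a b c f (g \<otimes>\<^bsub>rhom X b c\<^esub> g') = rcomp X a b c f g \<otimes>\<^bsub>rhom X a c\<^esub> rcomp X a b c f g'"
    and rcomp_assoc: "\<lbrakk>a \<in> robj X; b \<in> robj X; c \<in> robj X; d \<in> robj X;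
      f \<in> carrier (rhom X a b); g \<in> carrier (rhom X b c); h \<in> carrier (rhom X c d)\<rbrakk> \<Longrightarrow>
      rcomp X a c d (rcomp X a b c f g) h = rcomp X a b d f (rcomp X b c d g h)"
    and rid_closed: "a \<in> robj X \<Longrightarrow> rid X a \<in> carrier (rhom X a a)"
    and rid_left: "\<lbrakk>a \<in> robj X; b \<in> robj X; f \<in> carrier (rhom X a b)\<rbrakk> \<Longrightarrow>
      rcomp X a a b (rid X a) f = f"
    and rid_right: "\<lbrakk>a \<in> robj X; b \<in> robj X; f \<in> carrier (rhom X a b)\<rbrakk> \<Longrightarrow>
      rcomp X a b b f (rid X b) = f"

locale ringoid_hom = source: ringoid X + target: ringoid Y
  for X :: "('o, 'h) ringoid_data" and Y :: "('p, 'k) ringoid_data" +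
  fixes F :: "'o \<Rightarrow> 'p" and f :: "'o \<Rightarrow> 'o \<Rightarrow> 'h \<Rightarrow> 'k"
  assumes obj_closed: "a \<in> robj X \<Longrightarrow> F a \<in> robj Y"
    and additive: "\<lbrakk>a \<in> robj X; b \<in> robj X\<rbrakk> \<Longrightarrow> f a b \<in> hom (rhom X a b) (rhom Y (F a) (F b))"
    and preserves_rcomp: "\<lbrakk>a \<in> robj X; b \<in> robj X; c \<in> robj X;
      z \<in> carrier (rhom X a b); z' \<in> carrier (rhom X b c)\<rbrakk> \<Longrightarrow>
      f a c (rcomp X a b c z z') = rcomp Y (F a) (F b) (F c) (f a b z) (f b c z')"
    and preserves_rid: "a \<in> robj X \<Longrightarrow> f a a (rid X a) = rid Y (F a)"

locale cofaithful_ringoid_hom = ringoid_hom +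
  assumes obj_bij: "bij_betw F (robj X) (robj Y)"
    and hom_surj: "\<lbrakk>a \<in> robj X; b \<in> robj X\<rbrakk> \<Longrightarrow>
      f a b ` carrier (rhom X a b) = carrier (rhom Y (F a) (F b))"

definition subringoid :: "('o, 'h) ringoid_data \<Rightarrow> ('o \<Rightarrow> 'o \<Rightarrow> 'h set) \<Rightarrow> bool" where
  "subringoid X S \<longleftrightarrow>
     (\<forall>a\<in>robj X. \<forall>b\<in>robj X. subgroup (S a b) (rhom X a b)) \<and>
     (\<forall>a\<in>robj X. rid X a \<in> S a a) \<and>
     (\<forall>a\<in>robj X. \<forall>b\<in>robj X. \<forall>c\<in>robj X. \<forall>f\<in>S a b. \<forall>g\<in>S b c. rcomp X a b c f g \<in> S a c)"

definition generated_subringoid ::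
  "('o, 'h) ringoid_data \<Rightarrow> ('o \<Rightarrow> 'o \<Rightarrow> 'h set) \<Rightarrow> 'o \<Rightarrow> 'o \<Rightarrow> 'h set" where
  "generated_subringoid X G a b =
     \<Inter> {S a b | S. subringoid X S \<and> (\<forall>c\<in>robj X. \<forall>d\<in>robj X. G c d \<subseteq> S c d)}"

definition restrict_ringoid ::
  "('o, 'h) ringoid_data \<Rightarrow> ('o \<Rightarrow> 'o \<Rightarrow> 'h set) \<Rightarrow> ('o, 'h) ringoid_data" where
  "restrict_ringoid X S = X\<lparr>rhom := (\<lambda>a b. (rhom X a b)\<lparr>carrier := S a b\<rparr>)\<rparr>"

definition hom_monoid :: "'m monoid \<Rightarrow> 'n monoid \<Rightarrow> ('m \<Rightarrow> 'n) monoid" where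
  "hom_monoid G H = \<lparr>carrier = hom G H \<inter> extensional (carrier G),
     monoid.mult = (\<lambda>f g. \<lambda>x\<in>carrier G. f x \<otimes>\<^bsub>H\<^esub> g x),
     one = (\<lambda>x\<in>carrier G. \<one>\<^bsub>H\<^esub>)\<rparr>"

definition End_ringoid ::
  "('f, 'a) alg \<Rightarrow> ('f, 'a, 'm) module_data \<Rightarrow> ('a, 'm \<Rightarrow> 'm) ringoid_data" where
  "End_ringoid A M = \<lparr>robj = carrier A,
     rhom = (\<lambda>a b. hom_monoid (fib M b) (fib M a)),
     rcomp = (\<lambda>a b c. compose (carrier (fib M c))),
     rid = (\<lambda>a. \<lambda>m\<in>carrier (fib M a). m)\<rparr>"

definition op_homs ::
  "(nat \<Rightarrow> 'f set) \<Rightarrow> ('f, 'a) alg \<Rightarrow> ('f, 'a, 'm) module_data \<Rightarrow> 'a \<Rightarrow> 'a \<Rightarrow> ('m \<Rightarrow> 'm) set" where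
  "op_homs \<Omega> A M a b = {act_at M \<omega> as i | n \<omega> as i. \<omega> \<in> \<Omega> n \<and> as \<in> tuples n (carrier A) \<and>
     i < n \<and> a = opn A \<omega> as \<and> b = as ! i}"

text \<open>The subringoid \<open>Z\<^sub>M\<close>, as a family of subgroups and as a ringoid in its own right.\<close>

definition Z_sub ::
  "(nat \<Rightarrow> 'f set) \<Rightarrow> ('f, 'a) alg \<Rightarrow> ('f, 'a, 'm) module_data \<Rightarrow> 'a \<Rightarrow> 'a \<Rightarrow> ('m \<Rightarrow> 'm) set" where
  "Z_sub \<Omega> A M = generated_subringoid (End_ringoid A M) (op_homs \<Omega> A M)"

definition Z_sub_ringoid ::
  "(nat \<Rightarrow> 'f set) \<Rightarrow> ('f, 'a) alg \<Rightarrow> ('f, 'a, 'm) module_data \<Rightarrow> ('a, 'm \<Rightarrow> 'm) ringoid_data" where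
  "Z_sub_ringoid \<Omega> A M = restrict_ringoid (End_ringoid A M) (Z_sub \<Omega> A M)"


section \<open>The enveloping ringoid and its action on modules\<close>

type_synonym ('f, 'a) env = "(('f, 'a) pol \<Rightarrow>\<^sub>0 int) set"

text \<open>
  \<open>env_module\<close> is \<open>\<M>U\<^sub>b\<close>, \<open>env_elem\<close> is \<open>(u)\<^sub>b\<close>, and \<open>env_extend\<close> is \<open>\<theta>\<^bsub>b,m\<^esub>\<close>, the
  unique module homomorphism with \<open>(x)\<^sub>b \<mapsto> m\<close>.
\<close>

definition env_module ::
  "(nat \<Rightarrow> 'f set) \<Rightarrow> (('f, nat) trm \<times> ('f, nat) trm) set \<Rightarrow> ('f, 'a) alg \<Rightarrow> 'a \<Rightarrow>
   ('f, 'a, ('f, 'a) env) module_data" where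
  "env_module \<Omega> E A b = modulization \<Omega> A (pol_overalg \<Omega> E A b)"

definition env_elem ::
  "(nat \<Rightarrow> 'f set) \<Rightarrow> (('f, nat) trm \<times> ('f, nat) trm) set \<Rightarrow> ('f, 'a) alg \<Rightarrow> 'a \<Rightarrow>
   ('f, 'a) pol \<Rightarrow> ('f, 'a) env" where
  "env_elem \<Omega> E A b u = modulization_unit \<Omega> A (pol_overalg \<Omega> E A b) (pol_eval \<Omega> E A b u) u"

definition env_extend ::
  "(nat \<Rightarrow> 'f set) \<Rightarrow> (('f, nat) trm \<times> ('f, nat) trm) set \<Rightarrow> ('f, 'a) alg \<Rightarrow>
   ('f, 'a, 'm) module_data \<Rightarrow> 'a \<Rightarrow> 'm \<Rightarrow> 'a \<Rightarrow> ('f, 'a) env \<Rightarrow> 'm" where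
  "env_extend \<Omega> E A M b m = (THE \<theta>. \<theta> \<in> module_hom \<Omega> A (env_module \<Omega> E A b) M \<and>
     \<theta> b (env_elem \<Omega> E A b (pol_var \<Omega> E A)) = m)"

text \<open>The element \<open>zm\<close>, for \<open>z\<close> an arrow from \<open>b\<close> to \<open>a\<close> and \<open>m\<close> in the fibre over \<open>b\<close>.\<close>

definition env_act ::
  "(nat \<Rightarrow> 'f set) \<Rightarrow> (('f, nat) trm \<times> ('f, nat) trm) set \<Rightarrow> ('f, 'a) alg \<Rightarrow>
   ('f, 'a, 'm) module_data \<Rightarrow> 'a \<Rightarrow> 'a \<Rightarrow> ('f, 'a) env \<Rightarrow> 'm \<Rightarrow> 'm" where
  "env_act \<Omega> E A M a b z m = env_extend \<Omega> E A M b m a z"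

definition env_ringoid ::
  "(nat \<Rightarrow> 'f set) \<Rightarrow> (('f, nat) trm \<times> ('f, nat) trm) set \<Rightarrow> ('f, 'a) alg \<Rightarrow>
   ('a, ('f, 'a) env) ringoid_data" where
  "env_ringoid \<Omega> E A = \<lparr>robj = carrier A,
     rhom = (\<lambda>a b. fib (env_module \<Omega> E A b) a),
     rcomp = (\<lambda>a b c z z'. env_act \<Omega> E A (env_module \<Omega> E A c) a b z z'),
     rid = (\<lambda>b. env_elem \<Omega> E A b (pol_var \<Omega> E A))\<rparr>"

text \<open>\<open>env_rep \<Omega> E A M a b\<close> is \<open>f\<^sub>M\<close> on arrows from \<open>b\<close> to \<open>a\<close>.\<close>

definition env_rep ::
  "(nat \<Rightarrow> 'f set) \<Rightarrow> (('f, nat) trm \<times> ('f, nat) trm) set \<Rightarrow> ('f, 'a) alg \<Rightarrow>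
   ('f, 'a, 'm) module_data \<Rightarrow> 'a \<Rightarrow> 'a \<Rightarrow> ('f, 'a) env \<Rightarrow> 'm \<Rightarrow> 'm" where
  "env_rep \<Omega> E A M a b z = (\<lambda>m\<in>carrier (fib M b). env_act \<Omega> E A M a b z m)"

end

theory Submission
  imports Defs
begin

text \<open>
  All identities between actions come from uniqueness: a homomorphism out of \<open>\<M>U\<^sub>b\<close> is determined
  by the image of \<open>(x)\<^sub>b\<close>. For instance \<open>\<theta>\<^bsub>c,m\<^esub> \<circ> \<theta>\<^bsub>b,z'\<^esub>\<close> sends \<open>(x)\<^sub>b\<close> to \<open>z'm\<close>, so it equals
  \<open>\<theta>\<^bsub>b,z'm\<^esub>\<close>, which says \<open>(zz')m = z(z'm)\<close>; and the sum of \<open>\<theta>\<^bsub>b,m\<^esub>\<close> and \<open>\<theta>\<^bsub>b,m'\<^esub>\<close> is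
  \<open>\<theta>\<^bsub>b,m+m'\<^esub>\<close>, because \<open>M\<close> has abelian fibres. The homomorphisms \<open>\<theta>\<^bsub>b,m\<^esub>\<close> exist for \<open>M\<close> totally
  in the variety because \<open>a \<mapsto> \<langle>a,0\<rangle>\<close>, \<open>x \<mapsto> \<langle>b,m\<rangle>\<close> extends to \<open>U\<close>, and for \<open>\<M>U\<^sub>c\<close> by
  substituting polynomials into polynomials and adding up.

  The image of \<open>f\<^sub>M\<close> lies in \<open>Z\<^sub>M\<close> by induction on polynomials: \<open>\<omega>(u\<^sub>1,\<dots>,u\<^sub>n)\<close> acts as the sum of
  the composites of \<open>\<omega>\<^sup>M\<^bsub>a,i\<^esub>\<close> with the action of \<open>u\<^sub>i\<close>. Conversely the image is a subringoid, and
  it contains \<open>\<omega>\<^sup>M\<^bsub>a,i\<^esub>\<close>, the action of \<open>\<omega>(a\<^sub>1,\<dots>,x,\<dots>,a\<^sub>n)\<close>.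
\<close>

section \<open>Direct products of lists of groups\<close>

text \<open>Both \<open>env_extend\<close> and \<open>pol_act\<close> are definite descriptions, so
  no value of the action can be computed before existence and uniqueness are known. Each is treated
  in two layers: pointed maps out of \<open>Ub b\<close>, then module homomorphisms out of its
  modulization. Uniqueness holds because constants are basepoints, which leaves \<open>x\<close> as
  the only free generator, and because classes of polynomials generate every fibre as a group.

  The obstacle is existence with values in \<open>Z c\<close>. An element of a fibre of
  \<open>Z c\<close> need not be the class of a polynomial, so substitution alone does not reach it.
  What helps is that the values at the class of \<open>x\<close> of all homomorphisms into a fixed
  module form a subgroup, homomorphisms being closed under pointwise sums and inverses.

  An n-ary operation is additive on a product of n fibres, and a tuple is a product of tuples with a
  single nontrivial entry. This reduction to one argument serves twice: in extending a pointed map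
  to the modulization, and in placing the action of a polynomial in \<open>Z_sub\<close>.\<close>

lemma in_listset_map_iff:
  "xs \<in> listset (map F as) \<longleftrightarrow> length xs = length as \<and> (\<forall>i<length as. xs ! i \<in> F (as ! i))"
  by (auto simp: in_listset_iff list_all2_conv_all_nth)

lemma map2_in_listset:
  assumes "xs \<in> listset (map F as)" "\<And>a x. a \<in> set as \<Longrightarrow> x \<in> F a \<Longrightarrow> f a x \<in> G a"
  shows "map2 f as xs \<in> listset (map G as)"
  using assms by (simp add: in_listset_map_iff)

lemma map2_cong_listset:
  assumes "xs \<in> listset (map F as)" "\<And>a x. a \<in> set as \<Longrightarrow> x \<in> F a \<Longrightarrow> f a x = g a x"
  shows "map2 f as xs = map2 g as xs"
  using assms by (intro nth_equalityI) (simp_all add: in_listset_map_iff)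

text \<open>Choice in the shape needed for tuples: it picks representatives of a list of cosets
  simultaneously.\<close>

lemma list_choice:
  assumes "\<And>i. i < n \<Longrightarrow> \<exists>x. P i x"
  obtains xs where "length xs = n" "\<And>i. i < n \<Longrightarrow> P i (xs ! i)"
proof -
  obtain f where "\<And>i. i < n \<Longrightarrow> P i (f i)" using assms by metis
  then show thesis using that[of "map f [0..<n]"] by simp
qed

lemma carrier_list_group:
  "carrier (list_group (map F as)) = listset (map (\<lambda>a. carrier (F a)) as)"
  by (simp add: list_group_def comp_def)

lemma length_list_group_mult [simp]: "length (xs \<otimes>\<^bsub>list_group Gs\<^esub> ys) = length Gs"
  by (simp add: list_group_def)

lemma nth_list_group_mult [simp]:
  "i < length Gs \<Longrightarrow> (xs \<otimes>\<^bsub>list_group Gs\<^esub> ys) ! i = xs ! i \<otimes>\<^bsub>Gs ! i\<^esub> ys ! i"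
  by (simp add: list_group_def)

lemma list_group_mult_closed:
  assumes "xs \<in> listset (map (\<lambda>a. carrier (F a)) as)" "ys \<in> listset (map (\<lambda>a. carrier (F a)) as)"
    and "\<And>a. a \<in> set as \<Longrightarrow> group (F a)"
  shows "xs \<otimes>\<^bsub>list_group (map F as)\<^esub> ys \<in> listset (map (\<lambda>a. carrier (F a)) as)"
  using assms by (auto simp: in_listset_map_iff intro!: monoid.m_closed group.is_monoid)

lemma single_in_listset:
  assumes "i < length as" "m \<in> F (as ! i)" "\<And>a. a \<in> set as \<Longrightarrow> z a \<in> F a"
  shows "(map z as)[i := m] \<in> listset (map F as)"
  using assms by (auto simp: in_listset_map_iff nth_list_update)

lemma map_in_listset:
  assumes "\<And>a. a \<in> set as \<Longrightarrow> z a \<in> F a"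
  shows "map z as \<in> listset (map F as)"
  using assms by (simp add: in_listset_map_iff)

text \<open>A tuple is the product of the tuples that keep one of its entries and are trivial
  elsewhere. The rule turns a claim about n-ary operations into a claim about one argument, provided
  the claim is compatible with products.\<close>

lemma list_group_induct [consumes 1, case_names group one single mult]:
  assumes xs: "xs \<in> listset (map (\<lambda>a. carrier (F a)) as)"
    and group: "\<And>a. a \<in> set as \<Longrightarrow> group (F a)"
    and one: "P (map (\<lambda>a. \<one>\<^bsub>F a\<^esub>) as)"
    and single: "\<And>i m. i < length as \<Longrightarrow> m \<in> carrier (F (as ! i)) \<Longrightarrow> P ((map (\<lambda>a. \<one>\<^bsub>F a\<^esub>) as)[i := m])"
    and mult: "\<And>xs ys. xs \<in> listset (map (\<lambda>a. carrier (F a)) as) \<Longrightarrow>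
      ys \<in> listset (map (\<lambda>a. carrier (F a)) as) \<Longrightarrow> P xs \<Longrightarrow> P ys \<Longrightarrow>
      P (xs \<otimes>\<^bsub>list_group (map F as)\<^esub> ys)"
  shows "P xs"
proof -
  let ?ones = "map (\<lambda>a. \<one>\<^bsub>F a\<^esub>) as" and ?C = "listset (map (\<lambda>a. carrier (F a)) as)"
  have len: "length xs = length as" and xsi: "\<And>i. i < length as \<Longrightarrow> xs ! i \<in> carrier (F (as ! i))"
    using xs by (auto simp: in_listset_map_iff)
  have mon: "\<And>i. i < length as \<Longrightarrow> monoid (F (as ! i))"
    using group by (simp add: group.is_monoid)
  \<comment> \<open>These are the partial products: passing from \<open>k\<close> to
    \<open>Suc k\<close> multiplies by the tuple whose only nontrivial entry is
    \<open>xs ! k\<close>. Membership is carried along because \<open>mult\<close> asks for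
    it.\<close>
  have "take k xs @ drop k ?ones \<in> ?C \<and> P (take k xs @ drop k ?ones)" if "k \<le> length as" for k
    using that
  proof (induction k)
    case 0
    then show ?case using one mon by (auto simp: in_listset_map_iff monoid.one_closed)
  next
    case (Suc k)
    let ?single = "?ones[k := xs ! k]"
    have s: "?single \<in> ?C" "P ?single"
      using Suc.prems xsi mon single[of k "xs ! k"]
      by (auto simp: in_listset_map_iff monoid.one_closed nth_list_update)
    have eq: "take (Suc k) xs @ drop (Suc k) ?ones
        = (take k xs @ drop k ?ones) \<otimes>\<^bsub>list_group (map F as)\<^esub> ?single"
    proof (rule nth_equalityI)
      fix i assume "i < length (take (Suc k) xs @ drop (Suc k) ?ones)"
      then have i: "i < length as" using Suc.prems len by simp
      then interpret monoid "F (as ! i)" by (rule mon)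
      show "(take (Suc k) xs @ drop (Suc k) ?ones) ! i
          = ((take k xs @ drop k ?ones) \<otimes>\<^bsub>list_group (map F as)\<^esub> ?single) ! i"
        using i Suc.prems len xsi[OF i] by (auto simp: nth_append nth_list_update min_def)
    qed (use Suc.prems len in simp)
    show ?case
      unfolding eq using Suc s list_group_mult_closed[OF _ s(1) group] mult by auto
  qed
  from this[of "length as"] len show ?thesis by simp
qed


section \<open>Modules and their homomorphisms\<close>

lemma tuples_nth: "as \<in> tuples n S \<Longrightarrow> i < n \<Longrightarrow> as ! i \<in> S"
  by (auto simp: tuples_def)

lemma tuples_length: "as \<in> tuples n S \<Longrightarrow> length as = n"
  by (simp add: tuples_def)

lemma tuples_set: "as \<in> tuples n S \<Longrightarrow> a \<in> set as \<Longrightarrow> a \<in> S"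
  by (auto simp: tuples_def)

lemma tuplesI: "length as = n \<Longrightarrow> (\<And>i. i < n \<Longrightarrow> as ! i \<in> S) \<Longrightarrow> as \<in> tuples n S"
  by (auto simp: tuples_def in_set_conv_nth)

text \<open>\<open>hom\<close> looks only at values on the carrier. Closure of \<open>G\<close>
  under products is what keeps the restricted function from being evaluated outside its
  domain.\<close>

lemma hom_restrict_iff:
  assumes "monoid G" shows "restrict f (carrier G) \<in> hom G H \<longleftrightarrow> f \<in> hom G H"
  using assms by (auto simp: hom_def Pi_iff monoid.m_closed)

context overalgebra_module
begin

lemma fib_group: "a \<in> carrier A \<Longrightarrow> group (fib M a)"
  using fib_comm_group comm_group.axioms(2) by blast

lemma fib_monoid: "a \<in> carrier A \<Longrightarrow> monoid (fib M a)"
  using fib_group group.is_monoid by blast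

lemma act_closed:
  "\<lbrakk>\<omega> \<in> \<Omega> n; as \<in> tuples n (carrier A); ms \<in> listset (map (\<lambda>a. carrier (fib M a)) as)\<rbrakk> \<Longrightarrow>
    act M \<omega> as ms \<in> carrier (fib M (opn A \<omega> as))"
  using hom_in_carrier[OF act_hom] by (simp add: carrier_list_group)

lemma act_mult:
  "\<lbrakk>\<omega> \<in> \<Omega> n; as \<in> tuples n (carrier A); ms \<in> listset (map (\<lambda>a. carrier (fib M a)) as);
    ms' \<in> listset (map (\<lambda>a. carrier (fib M a)) as)\<rbrakk> \<Longrightarrow>
    act M \<omega> as (ms \<otimes>\<^bsub>list_group (map (fib M) as)\<^esub> ms')
      = act M \<omega> as ms \<otimes>\<^bsub>fib M (opn A \<omega> as)\<^esub> act M \<omega> as ms'"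
  using hom_mult[OF act_hom] by (simp add: carrier_list_group)

lemma ones_in_listset:
  "as \<in> tuples n (carrier A) \<Longrightarrow>
    map (\<lambda>a. \<one>\<^bsub>fib M a\<^esub>) as \<in> listset (map (\<lambda>a. carrier (fib M a)) as)"
  by (intro map_in_listset monoid.one_closed fib_monoid) (rule tuples_set)

text \<open>The trivial tuple is idempotent, so its image is an idempotent of a group. This uses
  only that \<open>act\<close> is closed and multiplicative, without establishing that
  \<open>list_group\<close> is a group.\<close>

lemma act_one:
  assumes "\<omega> \<in> \<Omega> n" "as \<in> tuples n (carrier A)"
  shows "act M \<omega> as (map (\<lambda>a. \<one>\<^bsub>fib M a\<^esub>) as) = \<one>\<^bsub>fib M (opn A \<omega> as)\<^esub>"
proof -
  let ?ones = "map (\<lambda>a. \<one>\<^bsub>fib M a\<^esub>) as" and ?G = "fib M (opn A \<omega> as)"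
  have "?ones \<otimes>\<^bsub>list_group (map (fib M) as)\<^esub> ?ones = ?ones"
    using tuples_set[OF assms(2)] fib_monoid
    by (intro nth_equalityI) (auto intro!: monoid.l_one monoid.one_closed)
  then have "act M \<omega> as ?ones \<otimes>\<^bsub>?G\<^esub> act M \<omega> as ?ones = act M \<omega> as ?ones"
    using act_mult[OF assms ones_in_listset ones_in_listset] assms(2) by metis
  moreover have "group ?G" using opn_closed[OF assms] by (rule fib_group)
  ultimately show ?thesis
    using act_closed[OF assms ones_in_listset[OF assms(2)]] by (metis group.l_cancel_one')
qed

lemma act_inv:
  assumes "\<omega> \<in> \<Omega> n" "as \<in> tuples n (carrier A)" "ms \<in> listset (map (\<lambda>a. carrier (fib M a)) as)"
  shows "act M \<omega> as (map2 (\<lambda>a m. inv\<^bsub>fib M a\<^esub> m) as ms) = inv\<^bsub>fib M (opn A \<omega> as)\<^esub> act M \<omega> as ms"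
proof -
  let ?inv = "map2 (\<lambda>a m. inv\<^bsub>fib M a\<^esub> m) as ms" and ?G = "fib M (opn A \<omega> as)"
  have G: "group ?G" using opn_closed[OF assms(1,2)] by (rule fib_group)
  have inv: "?inv \<in> listset (map (\<lambda>a. carrier (fib M a)) as)"
    using tuples_set[OF assms(2)] fib_group
    by (intro map2_in_listset[OF assms(3)]) (simp add: group.inv_closed)
  have "?inv \<otimes>\<^bsub>list_group (map (fib M) as)\<^esub> ms = map (\<lambda>a. \<one>\<^bsub>fib M a\<^esub>) as"
    using assms(3) tuples_set[OF assms(2)] fib_group
    by (intro nth_equalityI) (auto simp: in_listset_map_iff group.l_inv)
  then have "act M \<omega> as ?inv \<otimes>\<^bsub>?G\<^esub> act M \<omega> as ms = \<one>\<^bsub>?G\<^esub>"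
    using act_mult[OF assms(1,2) inv assms(3)] act_one[OF assms(1,2)] by metis
  then show ?thesis
    using group.inv_equality[OF G] act_closed[OF assms(1,2)] inv assms(3) by metis
qed

text \<open>Inserting \<open>m\<close> into the trivial tuple is multiplicative in \<open>m\<close>,
  because the other entries satisfy \<open>\<one> \<otimes> \<one> = \<one>\<close>; then
  \<open>act\<close> is applied.\<close>

lemma act_at_hom:
  assumes \<omega>: "\<omega> \<in> \<Omega> n" and as: "as \<in> tuples n (carrier A)" and i: "i < n"
  shows "act_at M \<omega> as i \<in> hom (fib M (as ! i)) (fib M (opn A \<omega> as))"
proof -
  let ?s = "\<lambda>x. (map (\<lambda>a. \<one>\<^bsub>fib M a\<^esub>) as)[i := x]"
  note len = tuples_length[OF as] and mon = fib_monoid[OF tuples_nth[OF as]]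
  have s_in: "?s x \<in> listset (map (\<lambda>a. carrier (fib M a)) as)" if "x \<in> carrier (fib M (as ! i))" for x
    using that i len tuples_set[OF as] fib_monoid
    by (intro single_in_listset) (auto simp: monoid.one_closed)
  have s_mult: "?s (x \<otimes>\<^bsub>fib M (as ! i)\<^esub> y) = ?s x \<otimes>\<^bsub>list_group (map (fib M) as)\<^esub> ?s y" for x y
    using len i mon by (intro nth_equalityI) (auto simp: nth_list_update monoid.l_one monoid.one_closed)
  have "(\<lambda>x. act M \<omega> as (?s x)) \<in> hom (fib M (as ! i)) (fib M (opn A \<omega> as))"
    by (rule homI) (simp_all add: act_closed[OF \<omega> as s_in] s_mult act_mult[OF \<omega> as s_in s_in])
  then show ?thesis unfolding act_at_def by (simp add: hom_restrict_iff mon[OF i])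
qed

end

section \<open>Module homomorphisms: extensionality, composition, pointwise product and
  inverse\<close>

lemma module_hom_fib: "\<phi> \<in> module_hom \<Omega> A M N \<Longrightarrow> a \<in> carrier A \<Longrightarrow> \<phi> a \<in> hom (fib M a) (fib N a)"
  by (auto simp: module_hom_def)

lemma module_hom_closed:
  "\<phi> \<in> module_hom \<Omega> A M N \<Longrightarrow> a \<in> carrier A \<Longrightarrow> m \<in> carrier (fib M a) \<Longrightarrow> \<phi> a m \<in> carrier (fib N a)"
  by (meson hom_in_carrier module_hom_fib)

lemma module_hom_act:
  "\<lbrakk>\<phi> \<in> module_hom \<Omega> A M N; \<omega> \<in> \<Omega> n; as \<in> tuples n (carrier A);
    ms \<in> listset (map (\<lambda>a. carrier (fib M a)) as)\<rbrakk> \<Longrightarrow>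
    \<phi> (opn A \<omega> as) (act M \<omega> as ms) = act N \<omega> as (map2 \<phi> as ms)"
  unfolding module_hom_def by blast

lemma module_hom_eqI:
  assumes "\<phi> \<in> module_hom \<Omega> A M N" "\<psi> \<in> module_hom \<Omega> A M N"
    and "\<And>a m. a \<in> carrier A \<Longrightarrow> m \<in> carrier (fib M a) \<Longrightarrow> \<phi> a m = \<psi> a m"
  shows "\<phi> = \<psi>"
proof (rule extensionalityI[of _ "carrier A"])
  fix a assume a: "a \<in> carrier A"
  with assms(1,2) have "\<phi> a \<in> extensional (carrier (fib M a))" "\<psi> a \<in> extensional (carrier (fib M a))"
    by (auto simp: module_hom_def)
  then show "\<phi> a = \<psi> a" by (rule extensionalityI) (rule assms(3)[OF a])
qed (use assms(1,2) in \<open>auto simp: module_hom_def PiE_def\<close>)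

text \<open>\<open>module_hom\<close> demands functions extensional in the index and in the element,
  so that equality of homomorphisms is equality of functions. Restricting in both arguments does no
  harm, since \<open>opn\<close> and \<open>act\<close> stay within the carriers.\<close>

lemma module_hom_restrictI:
  assumes M: "overalgebra_module \<Omega> A M"
    and hom: "\<And>a. a \<in> carrier A \<Longrightarrow> \<psi> a \<in> hom (fib M a) (fib N a)"
    and act: "\<And>n \<omega> as ms. \<lbrakk>\<omega> \<in> \<Omega> n; as \<in> tuples n (carrier A);
      ms \<in> listset (map (\<lambda>a. carrier (fib M a)) as)\<rbrakk> \<Longrightarrow>
      \<psi> (opn A \<omega> as) (act M \<omega> as ms) = act N \<omega> as (map2 \<psi> as ms)"
  shows "(\<lambda>a\<in>carrier A. \<lambda>m\<in>carrier (fib M a). \<psi> a m) \<in> module_hom \<Omega> A M N"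
proof -
  interpret overalgebra_module \<Omega> A M by (rule M)
  let ?\<phi> = "\<lambda>a\<in>carrier A. \<lambda>m\<in>carrier (fib M a). \<psi> a m"
  have "restrict (\<psi> a) (carrier (fib M a)) \<in> hom (fib M a) (fib N a)" if "a \<in> carrier A" for a
    using hom[OF that] by (simp add: hom_restrict_iff fib_monoid[OF that])
  moreover have "?\<phi> (opn A \<omega> as) (act M \<omega> as ms) = act N \<omega> as (map2 ?\<phi> as ms)"
    if "\<omega> \<in> \<Omega> n" "as \<in> tuples n (carrier A)" "ms \<in> listset (map (\<lambda>a. carrier (fib M a)) as)"
    for n \<omega> as ms
  proof -
    have "map2 ?\<phi> as ms = map2 \<psi> as ms"
      using tuples_set[OF that(2)] by (intro map2_cong_listset[OF that(3)]) simp
    moreover have "?\<phi> (opn A \<omega> as) (act M \<omega> as ms) = act N \<omega> as (map2 \<psi> as ms)"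
      using act[OF that] act_closed[OF that] opn_closed[OF that(1,2)] by simp
    ultimately show ?thesis by (simp only:)
  qed
  ultimately show ?thesis
    unfolding module_hom_def by (intro CollectI conjI allI ballI) (simp_all only: restrict_PiE_iff, auto)
qed

lemma module_hom_id:
  assumes "overalgebra_module \<Omega> A M"
  shows "(\<lambda>a\<in>carrier A. \<lambda>m\<in>carrier (fib M a). m) \<in> module_hom \<Omega> A M M"
proof (rule module_hom_restrictI[OF assms])
  fix n \<omega> as ms assume "ms \<in> listset (map (\<lambda>a. carrier (fib M a)) as)"
  then have "map2 (\<lambda>a m. m) as ms = ms"
    by (intro nth_equalityI) (auto simp: in_listset_map_iff)
  then show "act M \<omega> as ms = act M \<omega> as (map2 (\<lambda>a m. m) as ms)" by simp
qed (simp add: hom_def)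

lemma map2_map2: "map2 g as (map2 f as xs) = map2 (\<lambda>a x. g a (f a x)) as xs"
  by (induction as xs rule: list_induct2') auto

lemma module_hom_compose:
  assumes M: "overalgebra_module \<Omega> A M"
    and \<phi>: "\<phi> \<in> module_hom \<Omega> A M N" and \<psi>: "\<psi> \<in> module_hom \<Omega> A N L"
  shows "(\<lambda>a\<in>carrier A. \<lambda>m\<in>carrier (fib M a). \<psi> a (\<phi> a m)) \<in> module_hom \<Omega> A M L"
proof (rule module_hom_restrictI[OF M])
  fix a assume "a \<in> carrier A"
  then show "(\<lambda>m. \<psi> a (\<phi> a m)) \<in> hom (fib M a) (fib L a)"
    using hom_compose[OF module_hom_fib[OF \<phi>] module_hom_fib[OF \<psi>]] by (simp add: comp_def)
next
  fix n \<omega> as ms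
  assume *: "\<omega> \<in> \<Omega> n" "as \<in> tuples n (carrier A)" "ms \<in> listset (map (\<lambda>a. carrier (fib M a)) as)"
  have "map2 \<phi> as ms \<in> listset (map (\<lambda>a. carrier (fib N a)) as)"
    using tuples_set[OF *(2)] module_hom_closed[OF \<phi>] by (intro map2_in_listset[OF *(3)]) auto
  then show "\<psi> (opn A \<omega> as) (\<phi> (opn A \<omega> as) (act M \<omega> as ms)) = act L \<omega> as (map2 (\<lambda>a m. \<psi> a (\<phi> a m)) as ms)"
    using module_hom_act[OF \<phi> *] module_hom_act[OF \<psi> *(1,2)] by (simp add: map2_map2)
qed

context
  fixes \<Omega> :: "nat \<Rightarrow> 'f set" and A :: "('f, 'a) alg" and M :: "('f, 'a, 'm) module_data"
    and N :: "('f, 'a, 'n) module_data"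
  assumes M: "overalgebra_module \<Omega> A M" and N: "overalgebra_module \<Omega> A N"
begin

interpretation N: overalgebra_module \<Omega> A N by (rule N)

text \<open>Commutativity of the fibres of \<open>N\<close> gives additivity in each fibre.
  Compatibility with the operations comes from additivity of \<open>act N\<close> on the product of
  fibres. The lemma gives additivity of the action in \<open>m\<close> and also lets homomorphisms
  out of \<open>Z b\<close> be added up.\<close>

lemma module_hom_mult:
  assumes \<phi>: "\<phi> \<in> module_hom \<Omega> A M N" and \<psi>: "\<psi> \<in> module_hom \<Omega> A M N"
  shows "(\<lambda>a\<in>carrier A. \<lambda>m\<in>carrier (fib M a). \<phi> a m \<otimes>\<^bsub>fib N a\<^esub> \<psi> a m) \<in> module_hom \<Omega> A M N"
proof (rule module_hom_restrictI[OF M])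
  fix a assume a: "a \<in> carrier A"
  show "(\<lambda>m. \<phi> a m \<otimes>\<^bsub>fib N a\<^esub> \<psi> a m) \<in> hom (fib M a) (fib N a)"
    using comm_group.hom_group_mult[OF N.fib_comm_group[OF a] module_hom_fib[OF \<phi> a]
      module_hom_fib[OF \<psi> a]] .
next
  fix n \<omega> as ms
  assume *: "\<omega> \<in> \<Omega> n" "as \<in> tuples n (carrier A)" "ms \<in> listset (map (\<lambda>a. carrier (fib M a)) as)"
  have cl: "map2 \<chi> as ms \<in> listset (map (\<lambda>a. carrier (fib N a)) as)"
    if "\<chi> \<in> module_hom \<Omega> A M N" for \<chi>
    using tuples_set[OF *(2)] module_hom_closed[OF that] by (intro map2_in_listset[OF *(3)]) auto
  have "map2 (\<lambda>a m. \<phi> a m \<otimes>\<^bsub>fib N a\<^esub> \<psi> a m) as ms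
      = map2 \<phi> as ms \<otimes>\<^bsub>list_group (map (fib N) as)\<^esub> map2 \<psi> as ms"
    using *(3) by (intro nth_equalityI) (auto simp: in_listset_map_iff)
  then show "\<phi> (opn A \<omega> as) (act M \<omega> as ms) \<otimes>\<^bsub>fib N (opn A \<omega> as)\<^esub> \<psi> (opn A \<omega> as) (act M \<omega> as ms)
      = act N \<omega> as (map2 (\<lambda>a m. \<phi> a m \<otimes>\<^bsub>fib N a\<^esub> \<psi> a m) as ms)"
    using N.act_mult[OF *(1,2) cl[OF \<phi>] cl[OF \<psi>]] module_hom_act[OF \<phi> *] module_hom_act[OF \<psi> *]
    by simp
qed

lemma module_hom_inv:
  assumes \<phi>: "\<phi> \<in> module_hom \<Omega> A M N"
  shows "(\<lambda>a\<in>carrier A. \<lambda>m\<in>carrier (fib M a). inv\<^bsub>fib N a\<^esub> \<phi> a m) \<in> module_hom \<Omega> A M N"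
proof (rule module_hom_restrictI[OF M])
  fix a assume a: "a \<in> carrier A"
  interpret Na: comm_group "fib N a" by (rule N.fib_comm_group[OF a])
  show "(\<lambda>m. inv\<^bsub>fib N a\<^esub> \<phi> a m) \<in> hom (fib M a) (fib N a)"
    using module_hom_fib[OF \<phi> a] by (auto simp: hom_def Pi_iff Na.inv_mult)
next
  fix n \<omega> as ms
  assume *: "\<omega> \<in> \<Omega> n" "as \<in> tuples n (carrier A)" "ms \<in> listset (map (\<lambda>a. carrier (fib M a)) as)"
  have "map2 \<phi> as ms \<in> listset (map (\<lambda>a. carrier (fib N a)) as)"
    using tuples_set[OF *(2)] module_hom_closed[OF \<phi>] by (intro map2_in_listset[OF *(3)]) auto
  from N.act_inv[OF *(1,2) this]
  show "inv\<^bsub>fib N (opn A \<omega> as)\<^esub> \<phi> (opn A \<omega> as) (act M \<omega> as ms)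
      = act N \<omega> as (map2 (\<lambda>a m. inv\<^bsub>fib N a\<^esub> \<phi> a m) as ms)"
    by (simp add: module_hom_act[OF \<phi> *] map2_map2)
qed

end


section \<open>Quotient modules\<close>

lemma submodule_subgroup: "submodule \<Omega> A M S \<Longrightarrow> a \<in> carrier A \<Longrightarrow> subgroup (S a) (fib M a)"
  by (simp add: submodule_def)

lemma submodule_act:
  "\<lbrakk>submodule \<Omega> A M S; \<omega> \<in> \<Omega> n; as \<in> tuples n (carrier A); ms \<in> listset (map S as)\<rbrakk> \<Longrightarrow>
    act M \<omega> as ms \<in> S (opn A \<omega> as)"
  unfolding submodule_def by blast

text \<open>Independence of representatives: any other choice differs from \<open>ms\<close> by a
  tuple with entries in \<open>S\<close>, \<open>act\<close> is additive, and it sends that tuple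
  into \<open>S\<close>. All facts about the quotient operations are read off from this
  formula.\<close>

lemma act_quotient_module:
  assumes M: "overalgebra_module \<Omega> A M" and S: "submodule \<Omega> A M S"
    and \<omega>: "\<omega> \<in> \<Omega> n" and as: "as \<in> tuples n (carrier A)"
    and ms: "ms \<in> listset (map (\<lambda>a. carrier (fib M a)) as)"
  shows "act (quotient_module A M S) \<omega> as (map2 (\<lambda>a m. S a #>\<^bsub>fib M a\<^esub> m) as ms)
    = S (opn A \<omega> as) #>\<^bsub>fib M (opn A \<omega> as)\<^esub> act M \<omega> as ms"
proof -
  interpret overalgebra_module \<Omega> A M by (rule M)
  let ?a = "opn A \<omega> as" and ?Cs = "map2 (\<lambda>a m. S a #>\<^bsub>fib M a\<^esub> m) as ms"
  have len: "length as = n" "length ms = n"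
    using as ms by (auto simp: tuples_def in_listset_map_iff)
  have a: "?a \<in> carrier A" by (rule opn_closed[OF \<omega> as])
  have sub: "subgroup (S (as ! i)) (fib M (as ! i))" "as ! i \<in> carrier A" if "i < n" for i
    using submodule_subgroup[OF S] tuples_nth[OF as that] by auto
  have "S ?a #>\<^bsub>fib M ?a\<^esub> act M \<omega> as ns = S ?a #>\<^bsub>fib M ?a\<^esub> act M \<omega> as ms"
    if ns: "ns \<in> listset ?Cs" for ns
  proof -
    have nsi: "ns ! i \<in> S (as ! i) #>\<^bsub>fib M (as ! i)\<^esub> ms ! i" if "i < n" for i
      using ns len that by (auto simp: in_listset_iff list_all2_conv_all_nth)
    have "length ns = n" using ns len by (auto simp: in_listset_iff list_all2_conv_all_nth)
    have "\<exists>s. s \<in> S (as ! i) \<and> ns ! i = s \<otimes>\<^bsub>fib M (as ! i)\<^esub> ms ! i" if "i < n" for i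
      using nsi[OF that] by (auto simp: r_coset_def)
    then obtain ss where ss: "length ss = n"
      "\<And>i. i < n \<Longrightarrow> ss ! i \<in> S (as ! i) \<and> ns ! i = ss ! i \<otimes>\<^bsub>fib M (as ! i)\<^esub> ms ! i"
      by (rule list_choice[where P = "\<lambda>i s. s \<in> S (as ! i) \<and> ns ! i = s \<otimes>\<^bsub>fib M (as ! i)\<^esub> ms ! i"]) auto
    have ssS: "ss \<in> listset (map S as)" using ss len by (simp add: in_listset_map_iff)
    then have ssM: "ss \<in> listset (map (\<lambda>a. carrier (fib M a)) as)"
      using sub len by (auto simp: in_listset_map_iff dest: subgroup.mem_carrier)
    have "ns = ss \<otimes>\<^bsub>list_group (map (fib M) as)\<^esub> ms"
      using ss len \<open>length ns = n\<close> by (intro nth_equalityI) auto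
    then have eq: "act M \<omega> as ns = act M \<omega> as ss \<otimes>\<^bsub>fib M ?a\<^esub> act M \<omega> as ms"
      using act_mult[OF \<omega> as ssM ms] by simp
    have "act M \<omega> as ns \<in> S ?a #>\<^bsub>fib M ?a\<^esub> act M \<omega> as ms"
      unfolding eq r_coset_def using submodule_act[OF S \<omega> as ssS] by blast
    from group.repr_independence[OF fib_group[OF a] this act_closed[OF \<omega> as ms] submodule_subgroup[OF S a]]
    show ?thesis by simp
  qed
  \<comment> \<open>The union is over a nonempty set, since \<open>ms\<close> is itself a choice of
    representatives; hence the union of equal cosets is that coset.\<close>
  moreover have "ms \<in> listset ?Cs"
    using sub ms len fib_group
    by (auto simp: in_listset_map_iff in_listset_iff list_all2_conv_all_nth intro!: group.rcos_self)
  ultimately have "(\<Union>ns\<in>listset ?Cs. S ?a #>\<^bsub>fib M ?a\<^esub> act M \<omega> as ns)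
      = S ?a #>\<^bsub>fib M ?a\<^esub> act M \<omega> as ms"
    by blast
  then show ?thesis by (simp only: quotient_module_def module_data.simps)
qed

lemma carrier_fib_quotient_module:
  "carrier (fib (quotient_module A M S) a) = (\<lambda>m. S a #>\<^bsub>fib M a\<^esub> m) ` carrier (fib M a)"
  by (simp add: quotient_module_def carrier_FactGroup)

lemma listset_quotient_moduleE:
  assumes "Cs \<in> listset (map (\<lambda>a. carrier (fib (quotient_module A M S) a)) as)"
  obtains ms where "ms \<in> listset (map (\<lambda>a. carrier (fib M a)) as)"
    "Cs = map2 (\<lambda>a m. S a #>\<^bsub>fib M a\<^esub> m) as ms"
proof -
  have "\<exists>m. m \<in> carrier (fib M (as ! i)) \<and> Cs ! i = S (as ! i) #>\<^bsub>fib M (as ! i)\<^esub> m" if "i < length as" for i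
    using assms that by (auto simp: in_listset_map_iff carrier_fib_quotient_module)
  then obtain ms where ms: "length ms = length as" "\<And>i. i < length as \<Longrightarrow>
      ms ! i \<in> carrier (fib M (as ! i)) \<and> Cs ! i = S (as ! i) #>\<^bsub>fib M (as ! i)\<^esub> ms ! i"
    by (rule list_choice[where P = "\<lambda>i m. m \<in> carrier (fib M (as ! i)) \<and>
      Cs ! i = S (as ! i) #>\<^bsub>fib M (as ! i)\<^esub> m"]) auto
  show thesis
  proof (rule that)
    show "Cs = map2 (\<lambda>a m. S a #>\<^bsub>fib M a\<^esub> m) as ms"
      using ms assms by (intro nth_equalityI) (auto simp: in_listset_map_iff)
  qed (use ms in \<open>simp add: in_listset_map_iff\<close>)
qed

lemma rcos_mult_quotient_module:
  assumes M: "overalgebra_module \<Omega> A M" and S: "submodule \<Omega> A M S" and a: "a \<in> carrier A"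
    and m: "m \<in> carrier (fib M a)" "m' \<in> carrier (fib M a)"
  shows "(S a #>\<^bsub>fib M a\<^esub> m) \<otimes>\<^bsub>fib (quotient_module A M S) a\<^esub> (S a #>\<^bsub>fib M a\<^esub> m')
    = S a #>\<^bsub>fib M a\<^esub> (m \<otimes>\<^bsub>fib M a\<^esub> m')"
  using normal.rcos_sum[OF comm_group.subgroup_imp_normal[OF
      overalgebra_module.fib_comm_group[OF M a] submodule_subgroup[OF S a]] m]
  by (simp add: quotient_module_def)

lemma overalgebra_module_quotient:
  assumes M: "overalgebra_module \<Omega> A M" and S: "submodule \<Omega> A M S"
  shows "overalgebra_module \<Omega> A (quotient_module A M S)"
proof -
  interpret overalgebra_module \<Omega> A M by (rule M)
  let ?Q = "quotient_module A M S"
  show ?thesis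
  proof (rule overalgebra_module.intro[OF universal_algebra_axioms], rule overalgebra_module_axioms.intro)
    fix a assume "a \<in> carrier A"
    then show "comm_group (fib ?Q a)"
      using comm_group.abelian_FactGroup[OF fib_comm_group submodule_subgroup[OF S]]
      by (simp add: quotient_module_def)
  next
    fix \<omega> n as assume \<omega>: "\<omega> \<in> \<Omega> n" and as: "as \<in> tuples n (carrier A)"
    let ?a = "opn A \<omega> as"
    have a: "?a \<in> carrier A" by (rule opn_closed[OF \<omega> as])
    show "act ?Q \<omega> as \<in> hom (list_group (map (fib ?Q) as)) (fib ?Q ?a)"
    proof (rule homI)
      fix Cs assume "Cs \<in> carrier (list_group (map (fib ?Q) as))"
      then obtain ms where ms: "ms \<in> listset (map (\<lambda>a. carrier (fib M a)) as)"
        "Cs = map2 (\<lambda>a m. S a #>\<^bsub>fib M a\<^esub> m) as ms"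
        unfolding carrier_list_group by (rule listset_quotient_moduleE)
      then show "act ?Q \<omega> as Cs \<in> carrier (fib ?Q ?a)"
        using act_quotient_module[OF M S \<omega> as ms(1)] act_closed[OF \<omega> as ms(1)]
        by (simp add: carrier_fib_quotient_module)
      fix Ds assume "Ds \<in> carrier (list_group (map (fib ?Q) as))"
      then obtain ns where ns: "ns \<in> listset (map (\<lambda>a. carrier (fib M a)) as)"
        "Ds = map2 (\<lambda>a m. S a #>\<^bsub>fib M a\<^esub> m) as ns"
        unfolding carrier_list_group by (rule listset_quotient_moduleE)
      let ?p = "ms \<otimes>\<^bsub>list_group (map (fib M) as)\<^esub> ns"
      have "Cs \<otimes>\<^bsub>list_group (map (fib ?Q) as)\<^esub> Ds = map2 (\<lambda>a m. S a #>\<^bsub>fib M a\<^esub> m) as ?p"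
        using ms ns tuples_nth[OF as] tuples_length[OF as]
        by (intro nth_equalityI) (auto simp: in_listset_map_iff rcos_mult_quotient_module[OF M S])
      moreover have "?p \<in> listset (map (\<lambda>a. carrier (fib M a)) as)"
        using ms ns tuples_set[OF as] fib_group by (intro list_group_mult_closed) auto
      ultimately show "act ?Q \<omega> as (Cs \<otimes>\<^bsub>list_group (map (fib ?Q) as)\<^esub> Ds)
          = act ?Q \<omega> as Cs \<otimes>\<^bsub>fib ?Q ?a\<^esub> act ?Q \<omega> as Ds"
        using ms ns act_quotient_module[OF M S \<omega> as] act_closed[OF \<omega> as]
        by (simp add: act_mult[OF \<omega> as] rcos_mult_quotient_module[OF M S a])
    qed
  qed
qed


section \<open>Universal property of the modulization\<close>

text \<open>\<open>pact_pt\<close> says that the operations are pointed maps. For modules the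
  corresponding fact is \<open>act_one\<close>, a consequence of additivity; pointed sets have no
  addition to derive it from.\<close>

locale pointed_overalgebra = universal_algebra \<Omega> A
  for \<Omega> :: "nat \<Rightarrow> 'f set" and A :: "('f, 'a) alg" +
  fixes P :: "('f, 'a, 'p) pointed_data"
  assumes pt_closed: "a \<in> carrier A \<Longrightarrow> pt P a \<in> pset P a"
    and pact_closed: "\<lbrakk>\<omega> \<in> \<Omega> n; as \<in> tuples n (carrier A); ps \<in> listset (map (pset P) as)\<rbrakk> \<Longrightarrow>
      pact P \<omega> as ps \<in> pset P (opn A \<omega> as)"
    and pact_pt: "\<lbrakk>\<omega> \<in> \<Omega> n; as \<in> tuples n (carrier A)\<rbrakk> \<Longrightarrow>
      pact P \<omega> as (map (pt P) as) = pt P (opn A \<omega> as)"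

lemma pointed_hom_closed:
  "\<phi> \<in> pointed_hom \<Omega> A P Q \<Longrightarrow> a \<in> carrier A \<Longrightarrow> p \<in> pset P a \<Longrightarrow> \<phi> a p \<in> pset Q a"
  unfolding pointed_hom_def by blast

lemma pointed_hom_pt: "\<phi> \<in> pointed_hom \<Omega> A P Q \<Longrightarrow> a \<in> carrier A \<Longrightarrow> \<phi> a (pt P a) = pt Q a"
  unfolding pointed_hom_def by blast

lemma pointed_hom_pact:
  "\<lbrakk>\<phi> \<in> pointed_hom \<Omega> A P Q; \<omega> \<in> \<Omega> n; as \<in> tuples n (carrier A); ps \<in> listset (map (pset P) as)\<rbrakk> \<Longrightarrow>
    \<phi> (opn A \<omega> as) (pact P \<omega> as ps) = pact Q \<omega> as (map2 \<phi> as ps)"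
  unfolding pointed_hom_def by blast

lemma pointed_hom_eqI:
  assumes "\<phi> \<in> pointed_hom \<Omega> A P Q" "\<psi> \<in> pointed_hom \<Omega> A P Q"
    and "\<And>a p. a \<in> carrier A \<Longrightarrow> p \<in> pset P a \<Longrightarrow> \<phi> a p = \<psi> a p"
  shows "\<phi> = \<psi>"
proof (rule extensionalityI[of _ "carrier A"])
  fix a assume a: "a \<in> carrier A"
  with assms(1,2) have "\<phi> a \<in> extensional (pset P a)" "\<psi> a \<in> extensional (pset P a)"
    by (auto simp: pointed_hom_def PiE_def Pi_def)
  then show "\<phi> a = \<psi> a" by (rule extensionalityI) (rule assms(3)[OF a])
qed (use assms(1,2) in \<open>auto simp: pointed_hom_def PiE_def\<close>)

lemma forget_simps [simp]:
  "pset (forget M) a = carrier (fib M a)" "pt (forget M) a = \<one>\<^bsub>fib M a\<^esub>" "pact (forget M) = act M"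
  by (simp_all add: forget_def)

context pointed_overalgebra
begin

lemma pointed_hom_restrictI:
  assumes cl: "\<And>a p. a \<in> carrier A \<Longrightarrow> p \<in> pset P a \<Longrightarrow> \<psi> a p \<in> pset Q a"
    and pt: "\<And>a. a \<in> carrier A \<Longrightarrow> \<psi> a (pt P a) = pt Q a"
    and act: "\<And>n \<omega> as ps. \<lbrakk>\<omega> \<in> \<Omega> n; as \<in> tuples n (carrier A); ps \<in> listset (map (pset P) as)\<rbrakk> \<Longrightarrow>
      \<psi> (opn A \<omega> as) (pact P \<omega> as ps) = pact Q \<omega> as (map2 \<psi> as ps)"
  shows "(\<lambda>a\<in>carrier A. \<lambda>p\<in>pset P a. \<psi> a p) \<in> pointed_hom \<Omega> A P Q"
proof -
  let ?\<phi> = "\<lambda>a\<in>carrier A. \<lambda>p\<in>pset P a. \<psi> a p"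
  have "?\<phi> (opn A \<omega> as) (pact P \<omega> as ps) = pact Q \<omega> as (map2 ?\<phi> as ps)"
    if "\<omega> \<in> \<Omega> n" "as \<in> tuples n (carrier A)" "ps \<in> listset (map (pset P) as)"
    for n \<omega> as ps
  proof -
    have "map2 ?\<phi> as ps = map2 \<psi> as ps"
      using tuples_set[OF that(2)] by (intro map2_cong_listset[OF that(3)]) simp
    moreover have "?\<phi> (opn A \<omega> as) (pact P \<omega> as ps) = pact Q \<omega> as (map2 \<psi> as ps)"
      using act[OF that] pact_closed[OF that] opn_closed[OF that(1,2)] by simp
    ultimately show ?thesis by (simp only:)
  qed
  moreover have "?\<phi> \<in> (\<Pi>\<^sub>E a\<in>carrier A. {h \<in> pset P a \<rightarrow>\<^sub>E pset Q a. h (pt P a) = pt Q a})"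
    using cl pt pt_closed by auto
  ultimately show ?thesis unfolding pointed_hom_def by blast
qed

section \<open>The free module on a pointed overalgebra\<close>

abbreviation "F \<equiv> free_module P"

lemma fib_free_module [simp]: "fib F a = free_Abelian_group (pset P a)"
  by (simp add: free_module_def)

lemma pact_single_closed:
  assumes "\<omega> \<in> \<Omega> n" "as \<in> tuples n (carrier A)" "i < n" "p \<in> pset P (as ! i)"
  shows "pact P \<omega> as ((map (pt P) as)[i := p]) \<in> pset P (opn A \<omega> as)"
  using assms pt_closed tuples_set[OF assms(2)]
  by (intro pact_closed[OF assms(1,2)] single_in_listset) (simp_all add: tuples_length)

lemma overalgebra_module_free: "overalgebra_module \<Omega> A F"
proof (rule overalgebra_module.intro[OF universal_algebra_axioms], rule overalgebra_module_axioms.intro)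
  fix a assume "a \<in> carrier A"
  then show "comm_group (fib F a)" by (simp add: abelian_free_Abelian_group)
next
  fix \<omega> n as assume \<omega>: "\<omega> \<in> \<Omega> n" and as: "as \<in> tuples n (carrier A)"
  show "act F \<omega> as \<in> hom (list_group (map (fib F) as)) (fib F (opn A \<omega> as))"
  proof (rule homI)
    fix ms assume ms: "ms \<in> carrier (list_group (map (fib F) as))"
    have "frag_extend (\<lambda>p. frag_of (pact P \<omega> as ((map (pt P) as)[i := p]))) (ms ! i)
        \<in> carrier (free_Abelian_group (pset P (opn A \<omega> as)))" if "i < length as" for i
    proof -
      have "Poly_Mapping.keys (ms ! i) \<subseteq> pset P (as ! i)"
        using ms that unfolding carrier_list_group by (simp add: in_listset_map_iff)
      then show ?thesis
        using keys_frag_extend[of "\<lambda>p. frag_of (pact P \<omega> as ((map (pt P) as)[i := p]))" "ms ! i"]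
          pact_single_closed[OF \<omega> as] that tuples_length[OF as] by fastforce
    qed
    then show "act F \<omega> as ms \<in> carrier (fib F (opn A \<omega> as))"
      unfolding fib_free_module by (simp only: free_module_def module_data.simps)
        (rule sum_closed_free_Abelian_group, simp)
  next
    fix ms ms'
    show "act F \<omega> as (ms \<otimes>\<^bsub>list_group (map (fib F) as)\<^esub> ms')
        = act F \<omega> as ms \<otimes>\<^bsub>fib F (opn A \<omega> as)\<^esub> act F \<omega> as ms'"
      by (simp add: free_module_def frag_extend_add sum.distrib)
  qed
qed

sublocale F: overalgebra_module \<Omega> A F by (rule overalgebra_module_free)

lemma act_free_module_single:
  assumes "i < length as"
  shows "act F \<omega> as ((map (\<lambda>a. 0) as)[i := m])
    = frag_extend (\<lambda>p. frag_of (pact P \<omega> as ((map (pt P) as)[i := p]))) m"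
proof -
  have "act F \<omega> as ((map (\<lambda>a. 0) as)[i := m]) = (\<Sum>j<length as. if j = i
      then frag_extend (\<lambda>p. frag_of (pact P \<omega> as ((map (pt P) as)[i := p]))) m else 0)"
    unfolding free_module_def module_data.simps
    by (rule sum.cong) (use assms in \<open>auto simp: nth_list_update\<close>)
  then show ?thesis using assms by simp
qed

text \<open>The relations defining the kernel are written with the one-argument maps. As a sum these
  maps give \<open>act F\<close> at a tuple of generators, so the relations say that
  \<open>frag_of\<close> commutes with the operations modulo the kernel.\<close>

lemma sum_act_at_free_module:
  assumes "as \<in> tuples n (carrier A)" "ps \<in> listset (map (pset P) as)"
  shows "(\<Sum>i<n. act_at F \<omega> as i (frag_of (ps ! i))) = act F \<omega> as (map frag_of ps)"
proof -
  have "act_at F \<omega> as i (frag_of (ps ! i)) = frag_of (pact P \<omega> as ((map (pt P) as)[i := ps ! i]))"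
    if "i < n" for i
    using assms that act_free_module_single[of i as \<omega> "frag_of (ps ! i)"]
    by (simp add: act_at_def in_listset_map_iff tuples_length)
  then show ?thesis
    using assms by (simp add: free_module_def in_listset_map_iff tuples_length)
qed

section \<open>The kernel of the modulization and the unit\<close>

abbreviation "K \<equiv> modulization_kernel \<Omega> A P"

text \<open>The families whose intersection is \<open>K\<close>, with the relation in terms of
  \<open>act F\<close> at a tuple of generators: in this form a homomorphism can be applied to it
  directly.\<close>

definition contains_kernel :: "('a \<Rightarrow> ('p \<Rightarrow>\<^sub>0 int) set) \<Rightarrow> bool" where
  "contains_kernel S \<longleftrightarrow> submodule \<Omega> A F S \<and> (\<forall>b\<in>carrier A. frag_of (pt P b) \<in> S b) \<and>
     (\<forall>n. \<forall>\<omega>\<in>\<Omega> n. \<forall>as\<in>tuples n (carrier A). \<forall>ps\<in>listset (map (pset P) as).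
        frag_of (pact P \<omega> as ps) - act F \<omega> as (map frag_of ps) \<in> S (opn A \<omega> as))"

lemma modulization_kernel_eq: "K a = \<Inter> {S a | S. contains_kernel S}"
proof -
  have "contains_kernel S \<longleftrightarrow> submodule \<Omega> A F S \<and> (\<forall>b\<in>carrier A. frag_of (pt P b) \<in> S b) \<and>
     (\<forall>n. \<forall>\<omega>\<in>\<Omega> n. \<forall>as\<in>tuples n (carrier A). \<forall>ps\<in>listset (map (pset P) as).
        frag_of (pact P \<omega> as ps) - (\<Sum>i<n. act_at F \<omega> as i (frag_of (ps ! i))) \<in> S (opn A \<omega> as))" for S
    unfolding contains_kernel_def by (simp add: sum_act_at_free_module cong: ball_cong)
  then show ?thesis unfolding modulization_kernel_def by simp
qed

lemma frags_in_listset: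
  assumes "ps \<in> listset (map (pset P) as)"
  shows "map frag_of ps \<in> listset (map (\<lambda>a. carrier (fib F a)) as)"
  using assms by (simp add: in_listset_map_iff)

text \<open>Shows that the intersection defining \<open>K\<close> is taken over a nonempty
  collection, so that it is an intersection of subgroups.\<close>

lemma contains_kernel_carrier: "contains_kernel (\<lambda>a. carrier (fib F a))"
proof -
  have "frag_of (pact P \<omega> as ps) - act F \<omega> as (map frag_of ps) \<in> carrier (fib F (opn A \<omega> as))"
    if "\<omega> \<in> \<Omega> n" "as \<in> tuples n (carrier A)" "ps \<in> listset (map (pset P) as)" for n \<omega> as ps
    using F.act_closed[OF that(1,2) frags_in_listset[OF that(3)]] pact_closed[OF that]
      keys_diff[of "frag_of (pact P \<omega> as ps)" "act F \<omega> as (map frag_of ps)"]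
    by auto
  moreover have "submodule \<Omega> A F (\<lambda>a. carrier (fib F a))"
    using F.act_closed F.fib_group unfolding submodule_def
    by (auto simp only: group.subgroup_self)
  ultimately show ?thesis
    unfolding contains_kernel_def using pt_closed by auto
qed

lemma kernel_least: "contains_kernel S \<Longrightarrow> K a \<subseteq> S a"
  unfolding modulization_kernel_eq by blast

text \<open>Every defining condition passes to intersections. For the operations, a tuple from
  \<open>K\<close> is a tuple from each competing family, hence its image lies in each of
  them.\<close>

lemma contains_kernel_K: "contains_kernel K"
proof -
  have "subgroup (K a) (fib F a)" if "a \<in> carrier A" for a
    unfolding modulization_kernel_eq
  proof (rule group.subgroups_Inter[OF F.fib_group[OF that]])
    fix H assume "H \<in> {S a | S. contains_kernel S}"
    then show "subgroup H (fib F a)"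
      using submodule_subgroup[OF _ that] unfolding contains_kernel_def by blast
  qed (use contains_kernel_carrier in blast)
  moreover have "act F \<omega> as ms \<in> K (opn A \<omega> as)"
    if "\<omega> \<in> \<Omega> n" "as \<in> tuples n (carrier A)" "ms \<in> listset (map K as)" for n \<omega> as ms
  proof -
    have "act F \<omega> as ms \<in> S (opn A \<omega> as)" if S: "contains_kernel S" for S
    proof (rule submodule_act)
      show "submodule \<Omega> A F S" using S by (simp add: contains_kernel_def)
      show "ms \<in> listset (map S as)"
        using \<open>ms \<in> listset (map K as)\<close> kernel_least[OF S] by (auto simp: in_listset_map_iff)
    qed fact+
    then show ?thesis unfolding modulization_kernel_eq by blast
  qed
  ultimately have "submodule \<Omega> A F K" unfolding submodule_def by blast
  moreover have "frag_of (pt P b) \<in> K b" if "b \<in> carrier A" for b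
    using that unfolding modulization_kernel_eq contains_kernel_def by blast
  moreover have "frag_of (pact P \<omega> as ps) - act F \<omega> as (map frag_of ps) \<in> K (opn A \<omega> as)"
    if "\<omega> \<in> \<Omega> n" "as \<in> tuples n (carrier A)" "ps \<in> listset (map (pset P) as)" for n \<omega> as ps
    using that unfolding modulization_kernel_eq contains_kernel_def by blast
  ultimately show ?thesis unfolding contains_kernel_def by blast
qed

lemma submodule_K: "submodule \<Omega> A F K"
  using contains_kernel_K by (simp add: contains_kernel_def)

lemma overalgebra_module_modulization: "overalgebra_module \<Omega> A (modulization \<Omega> A P)"
  unfolding modulization_def
  by (rule overalgebra_module_quotient[OF overalgebra_module_free submodule_K])

sublocale MP: overalgebra_module \<Omega> A "modulization \<Omega> A P"
  by (rule overalgebra_module_modulization)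

abbreviation "\<eta> \<equiv> modulization_unit \<Omega> A P"

lemma unit_closed: "a \<in> carrier A \<Longrightarrow> p \<in> pset P a \<Longrightarrow> \<eta> a p \<in> carrier (fib (modulization \<Omega> A P) a)"
  by (auto simp: modulization_def carrier_fib_quotient_module modulization_unit_def)

lemma unit_pt:
  assumes "a \<in> carrier A" shows "\<eta> a (pt P a) = \<one>\<^bsub>fib (modulization \<Omega> A P) a\<^esub>"
proof -
  have "frag_of (pt P a) \<in> K a" using contains_kernel_K assms by (simp add: contains_kernel_def)
  then show ?thesis
    using group.coset_join2[OF F.fib_group[OF assms] _ submodule_subgroup[OF submodule_K assms]]
      pt_closed[OF assms]
    by (simp add: modulization_unit_def modulization_def quotient_module_def)
qed

lemma unit_pact:
  assumes \<omega>: "\<omega> \<in> \<Omega> n" and as: "as \<in> tuples n (carrier A)" and ps: "ps \<in> listset (map (pset P) as)"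
  shows "\<eta> (opn A \<omega> as) (pact P \<omega> as ps) = act (modulization \<Omega> A P) \<omega> as (map2 \<eta> as ps)"
proof -
  let ?a = "opn A \<omega> as" and ?m = "act F \<omega> as (map frag_of ps)"
  have a: "?a \<in> carrier A" by (rule opn_closed[OF \<omega> as])
  note fr = frags_in_listset[OF ps]
  have "map2 \<eta> as ps = map2 (\<lambda>a m. K a #>\<^bsub>fib F a\<^esub> m) as (map frag_of ps)"
    using ps by (intro nth_equalityI) (auto simp: modulization_unit_def in_listset_map_iff)
  then have "act (modulization \<Omega> A P) \<omega> as (map2 \<eta> as ps) = K ?a #>\<^bsub>fib F ?a\<^esub> ?m"
    using act_quotient_module[OF overalgebra_module_free submodule_K \<omega> as fr]
    by (simp only: modulization_def)
  also have "\<dots> = K ?a #>\<^bsub>fib F ?a\<^esub> frag_of (pact P \<omega> as ps)"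
  proof (rule group.repr_independence[OF F.fib_group[OF a]])
    have "frag_of (pact P \<omega> as ps) - ?m \<in> K ?a"
      using contains_kernel_K \<omega> as ps unfolding contains_kernel_def by blast
    \<comment> \<open>With \<open>x\<close> the generator on the left, the witness comes from
      \<open>x = (x - ?m) + ?m\<close>; the difference is one of the relations put into
      \<open>K\<close>.\<close>
    then show "frag_of (pact P \<omega> as ps) \<in> K ?a #>\<^bsub>fib F ?a\<^esub> ?m"
      unfolding r_coset_def by (force intro: bexI[of _ "frag_of (pact P \<omega> as ps) - ?m"])
  qed (use F.act_closed[OF \<omega> as fr] submodule_subgroup[OF submodule_K a] in auto)
  finally show ?thesis by (simp add: modulization_unit_def)
qed

text \<open>The generators of the free abelian group generate it, and their classes are the values
  of the unit. This is how claims about arbitrary arrows reduce to claims about classes of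
  polynomials.\<close>

lemma modulization_induct [consumes 2, case_names unit mult inv]:
  assumes a: "a \<in> carrier A" and z: "z \<in> carrier (fib (modulization \<Omega> A P) a)"
    and unit: "\<And>p. p \<in> pset P a \<Longrightarrow> Q (\<eta> a p)"
    and mult: "\<And>z z'. \<lbrakk>z \<in> carrier (fib (modulization \<Omega> A P) a); z' \<in> carrier (fib (modulization \<Omega> A P) a);
      Q z; Q z'\<rbrakk> \<Longrightarrow> Q (z \<otimes>\<^bsub>fib (modulization \<Omega> A P) a\<^esub> z')"
    and inv: "\<And>z. \<lbrakk>z \<in> carrier (fib (modulization \<Omega> A P) a); Q z\<rbrakk> \<Longrightarrow>
      Q (inv\<^bsub>fib (modulization \<Omega> A P) a\<^esub> z)"
  shows "Q z"
proof -
  let ?N = "fib (modulization \<Omega> A P) a"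
  interpret N: comm_group ?N by (rule MP.fib_comm_group[OF a])
  have normal: "K a \<lhd> fib F a"
    by (rule comm_group.subgroup_imp_normal[OF F.fib_comm_group[OF a] submodule_subgroup[OF submodule_K a]])
  have N_eq: "?N = fib F a Mod K a" by (simp add: modulization_def quotient_module_def)
  have hom: "(\<lambda>m. K a #>\<^bsub>fib F a\<^esub> m) \<in> hom (fib F a) ?N"
    unfolding N_eq by (rule normal.r_coset_hom_Mod[OF normal])
  then interpret pr: group_hom "fib F a" ?N "\<lambda>m. K a #>\<^bsub>fib F a\<^esub> m"
    by (simp add: group_hom_def group_hom_axioms_def F.fib_group a del: fib_free_module)
  obtain m where m: "Poly_Mapping.keys m \<subseteq> pset P a" "z = K a #>\<^bsub>fib F a\<^esub> m"
    using z by (auto simp: modulization_def carrier_fib_quotient_module)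
  have "Q (K a #>\<^bsub>fib F a\<^esub> m)"
    using m(1)
  proof (induction m rule: free_Abelian_group_induct[consumes 1, case_names zero diff frag])
    case zero
    \<comment> \<open>The class of 0 is the class of the basepoint by \<open>unit_pt\<close>, so the
      zero element falls under the \<open>unit\<close> case.\<close>
    have "Q (\<eta> a (pt P a))" by (rule unit[OF pt_closed[OF a]])
    then show ?case using pr.hom_one unit_pt[OF a] by simp
  next
    case (diff x y)
    then have xy: "x \<in> carrier (fib F a)" "y \<in> carrier (fib F a)" by simp_all
    have "x - y = x \<otimes>\<^bsub>fib F a\<^esub> inv\<^bsub>fib F a\<^esub> y" using xy by simp
    then have "K a #>\<^bsub>fib F a\<^esub> (x - y)
        = (K a #>\<^bsub>fib F a\<^esub> x) \<otimes>\<^bsub>?N\<^esub> inv\<^bsub>?N\<^esub> (K a #>\<^bsub>fib F a\<^esub> y)"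
      using pr.hom_mult[OF xy(1) F.fib_group[OF a, THEN group.inv_closed, OF xy(2)]] pr.hom_inv[OF xy(2)]
      by (simp only:)
    moreover have "Q ((K a #>\<^bsub>fib F a\<^esub> x) \<otimes>\<^bsub>?N\<^esub> inv\<^bsub>?N\<^esub> (K a #>\<^bsub>fib F a\<^esub> y))"
      using pr.hom_closed[OF xy(1)] pr.hom_closed[OF xy(2)]
      by (intro mult inv N.inv_closed diff(3) diff(4))
    ultimately show ?case by (simp only:)
  next
    case (frag p)
    then show ?case using unit by (simp add: modulization_unit_def)
  qed
  with m(2) show ?thesis by simp
qed

lemma modulization_hom_eqI:
  assumes \<theta>: "\<theta> \<in> module_hom \<Omega> A (modulization \<Omega> A P) M" and \<theta>': "\<theta>' \<in> module_hom \<Omega> A (modulization \<Omega> A P) M"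
    and M: "overalgebra_module \<Omega> A M"
    and eq: "\<And>a p. a \<in> carrier A \<Longrightarrow> p \<in> pset P a \<Longrightarrow> \<theta> a (\<eta> a p) = \<theta>' a (\<eta> a p)"
  shows "\<theta> = \<theta>'"
proof (rule module_hom_eqI[OF \<theta> \<theta>'])
  fix a z assume a: "a \<in> carrier A" and z: "z \<in> carrier (fib (modulization \<Omega> A P) a)"
  have gh: "group_hom (fib (modulization \<Omega> A P) a) (fib M a) (\<chi> a)"
    if "\<chi> \<in> module_hom \<Omega> A (modulization \<Omega> A P) M" for \<chi>
    using MP.fib_group[OF a] overalgebra_module.fib_group[OF M a] module_hom_fib[OF that a]
    by (simp add: group_hom_def group_hom_axioms_def)
  from a z show "\<theta> a z = \<theta>' a z"
  proof (induction rule: modulization_induct)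
    case (mult z z')
    then show ?case using group_hom.hom_mult[OF gh] \<theta> \<theta>' by metis
  next
    case (inv z)
    then show ?case using group_hom.hom_inv[OF gh] \<theta> \<theta>' by metis
  qed (rule eq[OF a])
qed

text \<open>Extend \<open>\<phi>\<close> freely to \<open>h\<close> on each fibre. As
  \<open>h\<close> commutes with the operations, its kernels form a submodule; as
  \<open>\<phi>\<close> is pointed and commutes with the operations, they contain the relations.
  Minimality of \<open>K\<close> lets \<open>h\<close> factor through the quotient.\<close>

lemma modulization_extension:
  assumes M: "overalgebra_module \<Omega> A M" and \<phi>: "\<phi> \<in> pointed_hom \<Omega> A P (forget M)"
  obtains \<theta> where "\<theta> \<in> module_hom \<Omega> A (modulization \<Omega> A P) M"
    "\<And>a p. a \<in> carrier A \<Longrightarrow> p \<in> pset P a \<Longrightarrow> \<theta> a (\<eta> a p) = \<phi> a p"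
proof -
  interpret M: overalgebra_module \<Omega> A M by (rule M)
  have "\<exists>h. h \<in> hom (fib F a) (fib M a) \<and> (\<forall>p\<in>pset P a. h (frag_of p) = \<phi> a p)"
    if a: "a \<in> carrier A" for a
  proof -
    have "\<phi> a ` pset P a \<subseteq> carrier (fib M a)" using pointed_hom_closed[OF \<phi> a] by auto
    then obtain h where "h \<in> hom (free_Abelian_group (pset P a)) (fib M a)"
      "\<And>p. p \<in> pset P a \<Longrightarrow> h (frag_of p) = \<phi> a p"
      using comm_group.free_Abelian_group_universal[OF M.fib_comm_group[OF a]] by blast
    then show ?thesis by auto
  qed
  then obtain h where h: "\<And>a. a \<in> carrier A \<Longrightarrow> h a \<in> hom (fib F a) (fib M a)"
    and h_frag: "\<And>a p. a \<in> carrier A \<Longrightarrow> p \<in> pset P a \<Longrightarrow> h a (frag_of p) = \<phi> a p"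
    by metis
  have gh: "group_hom (fib F a) (fib M a) (h a)" if "a \<in> carrier A" for a
    using h[OF that] F.fib_group[OF that] M.fib_group[OF that]
    by (simp add: group_hom_def group_hom_axioms_def del: fib_free_module)
  have h_zero: "h a 0 = \<one>\<^bsub>fib M a\<^esub>" if "a \<in> carrier A" for a
    using group_hom.hom_one[OF gh[OF that]] by simp
  have h_diff: "h a (x - y) = h a x \<otimes>\<^bsub>fib M a\<^esub> inv\<^bsub>fib M a\<^esub> h a y"
    if "a \<in> carrier A" "Poly_Mapping.keys x \<subseteq> pset P a" "Poly_Mapping.keys y \<subseteq> pset P a" for a x y
  proof -
    have "x - y = x \<otimes>\<^bsub>fib F a\<^esub> inv\<^bsub>fib F a\<^esub> y" using that by simp
    then show ?thesis
      using group_hom.hom_mult[OF gh[OF that(1)], of x "inv\<^bsub>fib F a\<^esub> y"]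
        group_hom.hom_inv[OF gh[OF that(1)], of y] that by simp
  qed
  \<comment> \<open>Only on generators is \<open>h\<close> known, so two inductions are nested: one
    over the tuple leaves a single nontrivial entry \<open>m\<close>, and one over \<open>m\<close>
    leaves a generator \<open>p\<close>. There the claim is that \<open>\<phi>\<close> respects the
    operation at basepoints with one entry replaced by \<open>p\<close>.\<close>
  have h_act: "h (opn A \<omega> as) (act F \<omega> as ms) = act M \<omega> as (map2 h as ms)"
    if \<omega>: "\<omega> \<in> \<Omega> n" and as: "as \<in> tuples n (carrier A)"
      and ms: "ms \<in> listset (map (\<lambda>a. carrier (fib F a)) as)" for \<omega> n as ms
    using ms
  proof (induction rule: list_group_induct)
    case (group a)
    then show ?case using F.fib_group tuples_set[OF as] by blast
  next
    case one
    have "map2 h as (map (\<lambda>a. \<one>\<^bsub>fib F a\<^esub>) as) = map (\<lambda>a. \<one>\<^bsub>fib M a\<^esub>) as"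
      using h_zero tuples_nth[OF as] tuples_length[OF as] by (intro nth_equalityI) auto
    then show ?case
      using F.act_one[OF \<omega> as] M.act_one[OF \<omega> as] h_zero[OF opn_closed[OF \<omega> as]] by simp
  next
    case (single i m)
    have i: "i < n" using single tuples_length[OF as] by simp
    note ai = tuples_nth[OF as i] and a = opn_closed[OF \<omega> as]
    let ?s = "\<lambda>x. (map (\<lambda>a. \<one>\<^bsub>fib M a\<^esub>) as)[i := x]"
    have map2_single: "map2 h as ((map (\<lambda>a. \<one>\<^bsub>fib F a\<^esub>) as)[i := x]) = ?s (h (as ! i) x)" for x
      using h_zero tuples_nth[OF as] tuples_length[OF as] i
      by (intro nth_equalityI) (auto simp: nth_list_update)
    have act_single: "act F \<omega> as ((map (\<lambda>a. \<one>\<^bsub>fib F a\<^esub>) as)[i := x])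
        = frag_extend (\<lambda>p. frag_of (pact P \<omega> as ((map (pt P) as)[i := p]))) x" for x
      using act_free_module_single[of i as] single(1) by simp
    have "(\<lambda>x. act M \<omega> as (?s x)) \<in> hom (fib M (as ! i)) (fib M (opn A \<omega> as))"
      using M.act_at_hom[OF \<omega> as i] by (simp add: act_at_def hom_restrict_iff M.fib_monoid[OF ai])
    then have s_gh: "group_hom (fib M (as ! i)) (fib M (opn A \<omega> as)) (\<lambda>x. act M \<omega> as (?s x))"
      using M.fib_group ai a by (simp add: group_hom_def group_hom_axioms_def)
    have "Poly_Mapping.keys m \<subseteq> pset P (as ! i)" using single by simp
    then have "h (opn A \<omega> as) (act F \<omega> as ((map (\<lambda>a. \<one>\<^bsub>fib F a\<^esub>) as)[i := m]))
        = act M \<omega> as (?s (h (as ! i) m))"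
      unfolding act_single
    proof (induction m rule: free_Abelian_group_induct[consumes 1, case_names zero diff frag])
      case zero
      show ?case using h_zero a ai group_hom.hom_one[OF s_gh] by simp
    next
      case (diff x y)
      let ?e = "frag_extend (\<lambda>p. frag_of (pact P \<omega> as ((map (pt P) as)[i := p])))"
      have keys: "Poly_Mapping.keys (?e w) \<subseteq> pset P (opn A \<omega> as)" if "Poly_Mapping.keys w \<subseteq> pset P (as ! i)" for w
        using keys_frag_extend[of "\<lambda>p. frag_of (pact P \<omega> as ((map (pt P) as)[i := p]))" w]
          pact_single_closed[OF \<omega> as i] that by fastforce
      have cl: "h (as ! i) w \<in> carrier (fib M (as ! i))" if "Poly_Mapping.keys w \<subseteq> pset P (as ! i)" for w
        using group_hom.hom_closed[OF gh[OF ai]] that by simp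
      show ?case
        using diff h_diff[OF ai] h_diff[OF a keys keys] group_hom.hom_mult[OF s_gh] group_hom.hom_inv[OF s_gh]
          cl M.fib_group[OF ai]
        by (simp add: frag_extend_diff group.inv_closed)
    next
      case (frag p)
      have "h (opn A \<omega> as) (frag_of (pact P \<omega> as ((map (pt P) as)[i := p])))
          = \<phi> (opn A \<omega> as) (pact P \<omega> as ((map (pt P) as)[i := p]))"
        by (rule h_frag[OF a pact_single_closed[OF \<omega> as i frag]])
      also have "\<dots> = act M \<omega> as (map2 \<phi> as ((map (pt P) as)[i := p]))"
        using pointed_hom_pact[OF \<phi> \<omega> as] frag single(1) pt_closed tuples_set[OF as]
        by (simp add: single_in_listset)
      also have "map2 \<phi> as ((map (pt P) as)[i := p]) = ?s (\<phi> (as ! i) p)"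
        using pointed_hom_pt[OF \<phi>] tuples_nth[OF as] tuples_length[OF as] i
        by (intro nth_equalityI) (auto simp: nth_list_update)
      finally show ?case using h_frag[OF ai frag] by simp
    qed
    then show ?case unfolding map2_single .
  next
    case (mult xs ys)
    note a = opn_closed[OF \<omega> as]
    have cl: "map2 h as zs \<in> listset (map (\<lambda>a. carrier (fib M a)) as)"
      if "zs \<in> listset (map (\<lambda>a. carrier (fib F a)) as)" for zs
      using tuples_set[OF as] group_hom.hom_closed[OF gh]
      by (intro map2_in_listset[OF that]) auto
    have "map2 h as (xs \<otimes>\<^bsub>list_group (map (fib F) as)\<^esub> ys)
        = map2 h as xs \<otimes>\<^bsub>list_group (map (fib M) as)\<^esub> map2 h as ys"
      using mult(1,2) tuples_nth[OF as] tuples_length[OF as] hom_mult[OF h]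
      by (intro nth_equalityI) (auto simp: in_listset_map_iff)
    then show ?case
      using mult M.act_mult[OF \<omega> as cl cl] F.act_mult[OF \<omega> as]
        hom_mult[OF h[OF a]] F.act_closed[OF \<omega> as] by metis
  qed
  \<comment> \<open>The kernels of \<open>h\<close> are made a competitor in the intersection
    defining \<open>K\<close>.\<close>
  have "contains_kernel (\<lambda>a. kernel (fib F a) (fib M a) (h a))"
    unfolding contains_kernel_def
  proof (intro conjI allI ballI)
    show "submodule \<Omega> A F (\<lambda>a. kernel (fib F a) (fib M a) (h a))"
      unfolding submodule_def
    proof (intro conjI allI ballI)
      fix a assume "a \<in> carrier A"
      then show "subgroup (kernel (fib F a) (fib M a) (h a)) (fib F a)"
        by (intro group_hom.subgroup_kernel gh)
    next
      fix n \<omega> as ms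
      assume *: "\<omega> \<in> \<Omega> n" "as \<in> tuples n (carrier A)"
        and ms: "ms \<in> listset (map (\<lambda>a. kernel (fib F a) (fib M a) (h a)) as)"
      have msF: "ms \<in> listset (map (\<lambda>a. carrier (fib F a)) as)"
        using ms by (auto simp: in_listset_map_iff kernel_def)
      have "map2 h as ms = map (\<lambda>a. \<one>\<^bsub>fib M a\<^esub>) as"
        using ms by (intro nth_equalityI) (auto simp: in_listset_map_iff kernel_def)
      then show "act F \<omega> as ms \<in> kernel (fib F (opn A \<omega> as)) (fib M (opn A \<omega> as)) (h (opn A \<omega> as))"
        using h_act[OF * msF] F.act_closed[OF * msF] M.act_one[OF *] by (simp add: kernel_def)
    qed
  next
    fix b assume "b \<in> carrier A"
    then show "frag_of (pt P b) \<in> kernel (fib F b) (fib M b) (h b)"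
      using h_frag pt_closed pointed_hom_pt[OF \<phi>] by (simp add: kernel_def)
  next
    fix n \<omega> as ps
    assume *: "\<omega> \<in> \<Omega> n" "as \<in> tuples n (carrier A)" and ps: "ps \<in> listset (map (pset P) as)"
    let ?a = "opn A \<omega> as" and ?x = "frag_of (pact P \<omega> as ps)" and ?y = "act F \<omega> as (map frag_of ps)"
    note a = opn_closed[OF *] and fr = frags_in_listset[OF ps]
    have keys: "Poly_Mapping.keys ?x \<subseteq> pset P ?a" "Poly_Mapping.keys ?y \<subseteq> pset P ?a"
      using pact_closed[OF * ps] F.act_closed[OF * fr] by auto
    have "h ?a ?y = act M \<omega> as (map2 h as (map frag_of ps))" by (rule h_act[OF * fr])
    also have "map2 h as (map frag_of ps) = map2 \<phi> as ps"
      using ps h_frag tuples_nth[OF *(2)] tuples_length[OF *(2)]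
      by (intro nth_equalityI) (auto simp: in_listset_map_iff)
    also have "act M \<omega> as (map2 \<phi> as ps) = h ?a ?x"
      using pointed_hom_pact[OF \<phi> * ps] h_frag[OF a pact_closed[OF * ps]] by simp
    finally have "h ?a ?y = h ?a ?x" .
    moreover have "h ?a ?x \<in> carrier (fib M ?a)"
      using group_hom.hom_closed[OF gh[OF a]] keys by simp
    ultimately have "h ?a (?x - ?y) = \<one>\<^bsub>fib M ?a\<^esub>"
      using h_diff[OF a keys] group.r_inv[OF M.fib_group[OF a]] by simp
    then show "?x - ?y \<in> kernel (fib F ?a) (fib M ?a) (h ?a)"
      using keys keys_diff[of ?x ?y] by (auto simp: kernel_def)
  qed
  then have K: "K a \<subseteq> kernel (fib F a) (fib M a) (h a)" for a by (rule kernel_least)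
  have "\<exists>g. g \<in> hom (fib (modulization \<Omega> A P) a) (fib M a) \<and>
      (\<forall>x\<in>carrier (fib F a). g (K a #>\<^bsub>fib F a\<^esub> x) = h a x)" if a: "a \<in> carrier A" for a
  proof -
    have "K a \<lhd> fib F a"
      by (rule comm_group.subgroup_imp_normal[OF F.fib_comm_group[OF a] submodule_subgroup[OF submodule_K a]])
    from group_hom.FactGroup_universal_kernel[OF gh[OF a] this K] show ?thesis
      unfolding modulization_def quotient_module_def module_data.simps by metis
  qed
  then obtain g where g: "\<And>a. a \<in> carrier A \<Longrightarrow> g a \<in> hom (fib (modulization \<Omega> A P) a) (fib M a)"
    and g_h: "\<And>a x. a \<in> carrier A \<Longrightarrow> x \<in> carrier (fib F a) \<Longrightarrow> g a (K a #>\<^bsub>fib F a\<^esub> x) = h a x"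
    by metis
  let ?\<theta> = "\<lambda>a\<in>carrier A. \<lambda>z\<in>carrier (fib (modulization \<Omega> A P) a). g a z"
  have "?\<theta> \<in> module_hom \<Omega> A (modulization \<Omega> A P) M"
  proof (rule module_hom_restrictI[OF overalgebra_module_modulization g])
    fix n \<omega> as Cs
    assume *: "\<omega> \<in> \<Omega> n" "as \<in> tuples n (carrier A)"
      and "Cs \<in> listset (map (\<lambda>a. carrier (fib (modulization \<Omega> A P) a)) as)"
    then obtain ms where ms: "ms \<in> listset (map (\<lambda>a. carrier (fib F a)) as)"
      "Cs = map2 (\<lambda>a m. K a #>\<^bsub>fib F a\<^esub> m) as ms"
      unfolding modulization_def by (elim listset_quotient_moduleE)
    have "map2 g as Cs = map2 h as ms"
      unfolding ms(2) map2_map2 using tuples_set[OF *(2)] g_h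
      by (intro map2_cong_listset[OF ms(1)]) blast
    then show "g (opn A \<omega> as) (act (modulization \<Omega> A P) \<omega> as Cs) = act M \<omega> as (map2 g as Cs)"
      using act_quotient_module[OF overalgebra_module_free submodule_K * ms(1)] h_act[OF * ms(1)]
        g_h[OF opn_closed[OF *] F.act_closed[OF * ms(1)]] ms(2)
      unfolding modulization_def by metis
  qed
  moreover have "?\<theta> a (\<eta> a p) = \<phi> a p" if "a \<in> carrier A" "p \<in> pset P a" for a p
    using g_h[OF that(1), of "frag_of p"] h_frag[OF that] unit_closed[OF that] that
    by (simp add: modulization_unit_def)
  ultimately show thesis by (rule that)
qed

end


section \<open>Unary polynomials\<close>

text \<open>Elements are classes of terms, and an operation on classes is the class of the compound
  term: induction on terms, carried to the quotient.\<close>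

lemma presented_alg_induct [consumes 3, case_names gen opn]:
  assumes E: "E \<subseteq> terms \<Omega> UNIV \<times> terms \<Omega> UNIV" and R: "R \<subseteq> terms \<Omega> X \<times> terms \<Omega> X"
    and C: "C \<in> carrier (presented_alg \<Omega> E X R)"
    and gen: "\<And>x. x \<in> X \<Longrightarrow> P (presented_gen \<Omega> E X R x)"
    and opn: "\<And>\<omega> n Cs. \<lbrakk>\<omega> \<in> \<Omega> n; Cs \<in> tuples n (carrier (presented_alg \<Omega> E X R)); \<And>C. C \<in> set Cs \<Longrightarrow> P C\<rbrakk> \<Longrightarrow>
      P (opn (presented_alg \<Omega> E X R) \<omega> Cs)"
  shows "P C"
proof -
  let ?\<Theta> = "presented_cong \<Omega> E X R"
  obtain t where t: "t \<in> terms \<Omega> X" "C = ?\<Theta> `` {t}"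
    using C unfolding carrier_presented_alg[OF E R] by blast
  have "P (?\<Theta> `` {t})"
    using t(1)
  proof induction
    case (Var x)
    then show ?case using gen by (simp add: presented_gen_def)
  next
    case (App \<omega> n ts)
    then have ts: "ts \<in> tuples n (terms \<Omega> X)" by (auto simp: tuples_def)
    have "P (opn (presented_alg \<Omega> E X R) \<omega> (map (\<lambda>t. ?\<Theta> `` {t}) ts))"
      by (rule opn[OF App(1)])
        (use App in \<open>auto simp: tuples_def carrier_presented_alg[OF E R]\<close>)
    then show ?case by (simp only: opn_presented_alg[OF E R App(1) ts])
  qed
  with t(2) show ?thesis by simp
qed

section \<open>The algebra of unary polynomials: induction, universal property, evaluation\<close>

lemma map_tuples: "xs \<in> tuples n S \<Longrightarrow> (\<And>x. x \<in> S \<Longrightarrow> f x \<in> T) \<Longrightarrow> map f xs \<in> tuples n T"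
  by (auto simp: tuples_def)

locale algebra_in_variety =
  fixes \<Omega> :: "nat \<Rightarrow> 'f set" and E :: "(('f, nat) trm \<times> ('f, nat) trm) set" and A :: "('f, 'a) alg"
  assumes identities: "E \<subseteq> terms \<Omega> UNIV \<times> terms \<Omega> UNIV" and A_in_variety: "in_variety \<Omega> E A"
begin

sublocale universal_algebra \<Omega> A
  using A_in_variety by (simp add: in_variety_def)

abbreviation "U \<equiv> Pol1 \<Omega> E A"
abbreviation "cst \<equiv> pol_const \<Omega> E A"
abbreviation "var \<equiv> pol_var \<Omega> E A"
abbreviation "ev \<equiv> pol_eval \<Omega> E A"
abbreviation "Free \<equiv> free_alg \<Omega> E {()}"

lemma Free_in_variety: "in_variety \<Omega> E Free"
  by (rule in_variety_free_alg[OF identities])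

lemma U_in_variety: "in_variety \<Omega> E U"
  unfolding Pol1_def by (rule in_variety_coprod[OF identities A_in_variety Free_in_variety])

sublocale U: universal_algebra \<Omega> U
  using U_in_variety by (simp add: in_variety_def)

lemma free_gen_closed: "free_gen \<Omega> E {()} () \<in> carrier Free"
  using presented_gen_closed[OF identities, of "{}" "{()}" "()"] by (simp add: free_alg_def free_gen_def)

lemma cst_hom: "(\<lambda>a\<in>carrier A. cst a) \<in> alg_hom \<Omega> A U"
  unfolding pol_const_def Pol1_def
  by (rule coprod_insertion_hom(1)[OF identities A_in_variety Free_in_variety])

lemma Inr_hom: "(\<lambda>y\<in>carrier Free. coprod_in \<Omega> E A Free (Inr y)) \<in> alg_hom \<Omega> Free U"
  unfolding Pol1_def by (rule coprod_insertion_hom(2)[OF identities A_in_variety Free_in_variety])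

lemma cst_closed: "a \<in> carrier A \<Longrightarrow> cst a \<in> carrier U"
  using alg_hom_closed[OF cst_hom] by fastforce

lemma var_closed: "var \<in> carrier U"
  using alg_hom_closed[OF Inr_hom free_gen_closed] free_gen_closed by (simp add: pol_var_def)

lemma cst_opn:
  assumes "\<omega> \<in> \<Omega> n" "as \<in> tuples n (carrier A)"
  shows "opn U \<omega> (map cst as) = cst (opn A \<omega> as)"
proof -
  have "map (\<lambda>a\<in>carrier A. cst a) as = map cst as" using assms(2) by (auto simp: tuples_def)
  moreover have "opn U \<omega> (map (\<lambda>a\<in>carrier A. cst a) as) = cst (opn A \<omega> as)"
    using alg_hom_opn[OF cst_hom assms] opn_closed[OF assms] by simp
  ultimately show ?thesis by (simp only:)
qed

text \<open>The presentation of the coproduct has every element of \<open>Free\<close> as a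
  generator, not only the free one. An inner induction over \<open>Free\<close> reduces these to
  \<open>var\<close>, with \<open>Inr_hom\<close> carrying the operations of \<open>Free\<close>
  over to \<open>U\<close>.\<close>

lemma Pol1_induct [consumes 1, case_names cst var opn]:
  assumes u: "u \<in> carrier U"
    and cst: "\<And>a. a \<in> carrier A \<Longrightarrow> P (cst a)"
    and var: "P var"
    and opn: "\<And>\<omega> n us. \<lbrakk>\<omega> \<in> \<Omega> n; us \<in> tuples n (carrier U); \<And>u. u \<in> set us \<Longrightarrow> P u\<rbrakk> \<Longrightarrow> P (opn U \<omega> us)"
  shows "P u"
proof -
  let ?R = "diagram \<Omega> Inl A \<union> diagram \<Omega> Inr Free" and ?X = "carrier A <+> carrier Free"
  have R: "?R \<subseteq> terms \<Omega> ?X \<times> terms \<Omega> ?X"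
    using diagram_in_terms[OF universal_algebra_axioms, of Inl ?X]
      diagram_in_terms[of \<Omega> Free Inr ?X] Free_in_variety by (auto simp: in_variety_def)
  have Inr: "P (coprod_in \<Omega> E A Free (Inr y))" if "y \<in> carrier Free" for y
  proof -
    have "y \<in> carrier (presented_alg \<Omega> E {()} {})" using that by (simp add: free_alg_def)
    then have "P (coprod_in \<Omega> E A Free (Inr y))"
    proof (induction rule: presented_alg_induct[OF identities empty_subsetI, consumes 1, case_names gen opn])
      case (gen x)
      then show ?case using var by (simp add: pol_var_def free_gen_def)
    next
      case (opn \<omega> n ys)
      then have ys: "ys \<in> tuples n (carrier Free)" by (simp add: free_alg_def)
      let ?i = "\<lambda>y\<in>carrier Free. coprod_in \<Omega> E A Free (Inr y)"
      have "P (opn U \<omega> (map ?i ys))"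
      proof (rule assms(4)[OF opn(1)])
        show "map ?i ys \<in> tuples n (carrier U)" using alg_hom_closed[OF Inr_hom] by (rule map_tuples[OF ys])
        fix u assume "u \<in> set (map ?i ys)"
        then show "P u" using opn(3) ys by (auto simp: tuples_def)
      qed
      then have "P (?i (opn Free \<omega> ys))" by (simp only: alg_hom_opn[OF Inr_hom opn(1) ys])
      moreover have "opn Free \<omega> ys \<in> carrier Free"
        using Free_in_variety universal_algebra.opn_closed[of \<Omega> Free \<omega> n ys] opn(1) ys
        by (simp add: in_variety_def)
      ultimately show ?case by (simp add: free_alg_def)
    qed
    then show ?thesis .
  qed
  have "u \<in> carrier (presented_alg \<Omega> E ?X ?R)" using u by (simp add: Pol1_def coprod_def)
  then show ?thesis
  proof (induction rule: presented_alg_induct[OF identities R, consumes 1, case_names gen opn])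
    case (gen x)
    then show ?case using Inr cst by (auto simp: coprod_in_def pol_const_def)
  next
    case (opn \<omega> n Cs)
    then show ?case using assms(4)[of \<omega> n Cs] by (simp add: Pol1_def coprod_def)
  qed
qed

lemma Pol1_universal:
  assumes C: "in_variety \<Omega> E C" and h: "h \<in> alg_hom \<Omega> A C" and c: "c \<in> carrier C"
  obtains g where "g \<in> alg_hom \<Omega> U C" "\<And>a. a \<in> carrier A \<Longrightarrow> g (cst a) = h a" "g var = c"
proof -
  obtain k where k: "k \<in> alg_hom \<Omega> Free C" "k (free_gen \<Omega> E {()} ()) = c"
    using free_alg_universal[OF identities C, of "{()}" "\<lambda>_. c"] c by auto
  obtain g where "g \<in> alg_hom \<Omega> U C" "\<forall>a\<in>carrier A. g (cst a) = h a"
    "\<forall>y\<in>carrier Free. g (coprod_in \<Omega> E A Free (Inr y)) = k y"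
    using coprod_universal[OF identities A_in_variety Free_in_variety C h k(1)]
    unfolding Pol1_def pol_const_def by blast
  then show thesis using that[of g] free_gen_closed k(2) by (simp add: pol_var_def)
qed

lemma ev_props:
  assumes "b \<in> carrier A"
  shows ev_hom: "ev b \<in> alg_hom \<Omega> U A"
    and ev_cst: "a \<in> carrier A \<Longrightarrow> ev b (cst a) = a"
    and ev_var: "ev b var = b"
  using theI'[OF pol_eval_unique_exists[OF identities A_in_variety assms]]
  unfolding pol_eval_def by blast+

lemma ev_closed: "b \<in> carrier A \<Longrightarrow> u \<in> carrier U \<Longrightarrow> ev b u \<in> carrier A"
  by (rule alg_hom_closed[OF ev_hom])

lemma ev_opn:
  "\<lbrakk>b \<in> carrier A; \<omega> \<in> \<Omega> n; us \<in> tuples n (carrier U)\<rbrakk> \<Longrightarrow> ev b (opn U \<omega> us) = opn A \<omega> (map (ev b) us)"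
  by (rule alg_hom_opn[OF ev_hom])

section \<open>The pointed overalgebra of polynomials and its freeness on the variable\<close>

abbreviation "Ub \<equiv> pol_overalg \<Omega> E A"

lemma pol_overalg_simps [simp]:
  "u \<in> pset (Ub b) a \<longleftrightarrow> u \<in> carrier U \<and> ev b u = a"
  "pt (Ub b) = cst" "pact (Ub b) \<omega> as us = opn U \<omega> us"
  by (simp_all add: pol_overalg_def)

text \<open>The fibres of \<open>Ub b\<close> are disjoint, so a list of polynomials determines its
  list of indices. Later formulas can therefore speak of \<open>us\<close> alone, with indices
  \<open>map (ev b) us\<close>.\<close>

lemma listset_pol_overalgD:
  assumes "us \<in> listset (map (pset (Ub b)) as)" "as \<in> tuples n (carrier A)"
  shows "us \<in> tuples n (carrier U)" "map (ev b) us = as"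
  using assms by (auto simp: in_listset_map_iff tuples_length intro!: tuplesI nth_equalityI)

lemma listset_pol_overalgI:
  assumes "us \<in> tuples n (carrier U)"
  shows "us \<in> listset (map (pset (Ub b)) (map (ev b) us))"
  unfolding in_listset_map_iff using tuples_nth[OF assms] tuples_length[OF assms] by simp

lemma pointed_overalgebra_Ub:
  assumes b: "b \<in> carrier A"
  shows "pointed_overalgebra \<Omega> A (Ub b)"
proof (rule pointed_overalgebra.intro[OF universal_algebra_axioms], rule pointed_overalgebra_axioms.intro)
  fix a assume "a \<in> carrier A"
  then show "pt (Ub b) a \<in> pset (Ub b) a" using cst_closed ev_cst[OF b] by simp
next
  fix \<omega> n as us
  assume *: "\<omega> \<in> \<Omega> n" "as \<in> tuples n (carrier A)" "us \<in> listset (map (pset (Ub b)) as)"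
  note us = listset_pol_overalgD[OF *(3,2)]
  show "pact (Ub b) \<omega> as us \<in> pset (Ub b) (opn A \<omega> as)"
    using U.opn_closed[OF *(1) us(1)] ev_opn[OF b *(1) us(1)] us(2) by simp
next
  fix \<omega> n as assume "\<omega> \<in> \<Omega> n" "as \<in> tuples n (carrier A)"
  then show "pact (Ub b) \<omega> as (map (pt (Ub b)) as) = pt (Ub b) (opn A \<omega> as)"
    using cst_opn by simp
qed

lemma pol_hom_opn:
  assumes \<phi>: "\<phi> \<in> pointed_hom \<Omega> A (Ub b) Q" and b: "b \<in> carrier A"
    and \<omega>: "\<omega> \<in> \<Omega> n" and us: "us \<in> tuples n (carrier U)"
  shows "\<phi> (ev b (opn U \<omega> us)) (opn U \<omega> us) = pact Q \<omega> (map (ev b) us) (map (\<lambda>u. \<phi> (ev b u) u) us)"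
proof -
  have "map2 \<phi> (map (ev b) us) us = map (\<lambda>u. \<phi> (ev b u) u) us"
    by (induction us) auto
  moreover have "map (ev b) us \<in> tuples n (carrier A)"
    using ev_closed[OF b] by (rule map_tuples[OF us])
  ultimately show ?thesis
    using pointed_hom_pact[OF \<phi> \<omega> _ listset_pol_overalgI[OF us]] ev_opn[OF b \<omega> us] by simp
qed

text \<open>A pointed homomorphism has no freedom on constants, since they are the basepoints of
  \<open>Ub b\<close>; induction on polynomials leaves only the value at \<open>var\<close>.\<close>

lemma pol_hom_eqI:
  assumes \<phi>: "\<phi> \<in> pointed_hom \<Omega> A (Ub b) Q" and \<psi>: "\<psi> \<in> pointed_hom \<Omega> A (Ub b) Q"
    and b: "b \<in> carrier A" and var: "\<phi> b var = \<psi> b var"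
  shows "\<phi> = \<psi>"
proof (rule pointed_hom_eqI[OF \<phi> \<psi>])
  have *: "\<phi> (ev b u) u = \<psi> (ev b u) u" if "u \<in> carrier U" for u
    using that
  proof (induction u rule: Pol1_induct)
    case (cst a)
    then show ?case using pointed_hom_pt[OF \<phi>] pointed_hom_pt[OF \<psi>] ev_cst[OF b] by simp
  next
    case var
    show ?case using assms(4) ev_var[OF b] by simp
  next
    case (opn \<omega> n us)
    then have "map (\<lambda>u. \<phi> (ev b u) u) us = map (\<lambda>u. \<psi> (ev b u) u) us" by simp
    then show ?case by (simp only: pol_hom_opn[OF \<phi> b opn(1,2)] pol_hom_opn[OF \<psi> b opn(1,2)])
  qed
  fix a u assume "u \<in> pset (Ub b) a"
  then show "\<phi> a u = \<psi> a u" using *[of u] by auto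
qed

text \<open>Common source of two pointed homomorphisms: \<open>s\<close> is the second projection
  when \<open>C\<close> is a total algebra, and the identity when \<open>C\<close> is
  \<open>U\<close> itself.\<close>

lemma pol_hom_of_alg_hom:
  assumes g: "g \<in> alg_hom \<Omega> U C" and b: "b \<in> carrier A"
    and cl: "\<And>u. u \<in> carrier U \<Longrightarrow> s (g u) \<in> pset Q (ev b u)"
    and pt: "\<And>a. a \<in> carrier A \<Longrightarrow> s (g (cst a)) = pt Q a"
    and act: "\<And>n \<omega> us. \<lbrakk>\<omega> \<in> \<Omega> n; us \<in> tuples n (carrier U)\<rbrakk> \<Longrightarrow>
      s (opn C \<omega> (map g us)) = pact Q \<omega> (map (ev b) us) (map (\<lambda>u. s (g u)) us)"
  shows "(\<lambda>a\<in>carrier A. \<lambda>u\<in>pset (Ub b) a. s (g u)) \<in> pointed_hom \<Omega> A (Ub b) Q"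
proof (rule pointed_overalgebra.pointed_hom_restrictI[OF pointed_overalgebra_Ub[OF b]])
  fix \<omega> n as us
  assume *: "\<omega> \<in> \<Omega> n" "as \<in> tuples n (carrier A)" "us \<in> listset (map (pset (Ub b)) as)"
  note us = listset_pol_overalgD[OF *(3,2)]
  have "map2 (\<lambda>a u. s (g u)) as us = map (\<lambda>u. s (g u)) us"
    using *(3) by (intro nth_equalityI) (auto simp: in_listset_map_iff)
  then show "s (g (pact (Ub b) \<omega> as us)) = pact Q \<omega> as (map2 (\<lambda>a u. s (g u)) as us)"
    using act[OF *(1) us(1)] alg_hom_opn[OF g *(1) us(1)] us(2) by simp
qed (use cl pt in auto)

text \<open>Membership of the total algebra in the variety enters here: it allows \<open>U\<close>
  to be mapped there, and the second components of the values form the pointed homomorphism.\<close>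

lemma pol_hom_total:
  assumes M: "overalgebra_module \<Omega> A M" and V: "in_variety \<Omega> E (total_alg A M)"
    and b: "b \<in> carrier A" and m: "m \<in> carrier (fib M b)"
  obtains \<phi> where "\<phi> \<in> pointed_hom \<Omega> A (Ub b) (forget M)" "\<phi> b var = m"
proof -
  interpret M: overalgebra_module \<Omega> A M by (rule M)
  let ?h = "\<lambda>a\<in>carrier A. (a, \<one>\<^bsub>fib M a\<^esub>)"
  \<comment> \<open>The zero section is a homomorphism because operations send the trivial tuple to
    the identity.\<close>
  have "?h \<in> alg_hom \<Omega> A (total_alg A M)"
  proof (rule alg_homI)
    fix n \<omega> as assume *: "\<omega> \<in> \<Omega> n" "as \<in> tuples n (carrier A)"
    have "map fst (map ?h as) = as" "map snd (map ?h as) = map (\<lambda>a. \<one>\<^bsub>fib M a\<^esub>) as"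
      using tuples_set[OF *(2)] by (auto intro!: map_idI)
    then show "?h (opn A \<omega> as) = opn (total_alg A M) \<omega> (map ?h as)"
      using M.act_one[OF *] opn_closed[OF *] by (simp add: total_alg_def del: map_map)
  qed (auto simp: total_alg_def intro: monoid.one_closed M.fib_monoid)
  moreover have "(b, m) \<in> carrier (total_alg A M)" using b m by (simp add: total_alg_def)
  ultimately obtain g where g: "g \<in> alg_hom \<Omega> U (total_alg A M)"
    and g_cst: "\<And>a. a \<in> carrier A \<Longrightarrow> g (cst a) = ?h a" and g_var: "g var = (b, m)"
    by (rule Pol1_universal[OF V]) (rule that)
  \<comment> \<open>First projection after \<open>g\<close> and evaluation at \<open>b\<close> agree
    on constants and on \<open>var\<close>. This places \<open>snd (g u)\<close> in the fibre over
    \<open>ev b u\<close>.\<close>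
  have fst_g: "fst (g u) = ev b u" if "u \<in> carrier U" for u
    using that
  proof (induction u rule: Pol1_induct)
    case (opn \<omega> n us)
    then have eq: "map (\<lambda>u. fst (g u)) us = map (ev b) us" by simp
    show ?case
      by (simp add: alg_hom_opn[OF g opn(1,2)] ev_opn[OF b opn(1,2)] total_alg_def comp_def eq)
  qed (simp_all add: g_cst g_var ev_cst ev_var b)
  let ?\<phi> = "\<lambda>a\<in>carrier A. \<lambda>u\<in>pset (Ub b) a. snd (g u)"
  have "?\<phi> \<in> pointed_hom \<Omega> A (Ub b) (forget M)"
  proof (rule pol_hom_of_alg_hom[OF g b])
    fix u assume u: "u \<in> carrier U"
    then show "snd (g u) \<in> pset (forget M) (ev b u)"
      using alg_hom_closed[OF g u] fst_g[OF u] by (auto simp: total_alg_def)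
  next
    fix n \<omega> us assume *: "\<omega> \<in> \<Omega> n" "us \<in> tuples n (carrier U)"
    have eq: "map (\<lambda>u. fst (g u)) us = map (ev b) us" using fst_g tuples_set[OF *(2)] by simp
    show "snd (opn (total_alg A M) \<omega> (map g us))
        = pact (forget M) \<omega> (map (ev b) us) (map (\<lambda>u. snd (g u)) us)"
      by (simp add: total_alg_def comp_def eq)
  qed (simp add: g_cst)
  moreover have "?\<phi> b var = m" using b var_closed ev_var[OF b] g_var by simp
  ultimately show thesis by (rule that)
qed

text \<open>The endomorphism \<open>g\<close> of \<open>U\<close> that fixes the constants and sends
  \<open>x\<close> to \<open>w\<close> is substitution. Since \<open>u(w)\<close> evaluated at
  \<open>c\<close> is \<open>u\<close> evaluated at \<open>w(c)\<close>, it maps fibres of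
  \<open>Ub (ev c w)\<close> to fibres of \<open>Ub c\<close> with the same index.\<close>

lemma pol_hom_subst:
  assumes c: "c \<in> carrier A" and w: "w \<in> carrier U"
  obtains \<phi> where "\<phi> \<in> pointed_hom \<Omega> A (Ub (ev c w)) (Ub c)" "\<phi> (ev c w) var = w"
proof -
  let ?b = "ev c w"
  have b: "?b \<in> carrier A" by (rule ev_closed[OF c w])
  obtain g where g: "g \<in> alg_hom \<Omega> U U"
    and g_cst: "\<And>a. a \<in> carrier A \<Longrightarrow> g (cst a) = (\<lambda>a\<in>carrier A. cst a) a" and g_var: "g var = w"
    by (rule Pol1_universal[OF U_in_variety cst_hom w]) (rule that)
  have ev_g: "ev c (g u) = ev ?b u" if "u \<in> carrier U" for u
    using that
  proof (induction u rule: Pol1_induct)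
    case (opn \<omega> n us)
    have gus: "map g us \<in> tuples n (carrier U)"
      using alg_hom_closed[OF g] by (rule map_tuples[OF opn(2)])
    have eq: "map (ev c) (map g us) = map (ev ?b) us" using opn by simp
    show ?case
      by (simp only: alg_hom_opn[OF g opn(1,2)] ev_opn[OF c opn(1) gus] ev_opn[OF b opn(1,2)] eq)
  qed (simp_all add: g_cst g_var ev_cst ev_var b c)
  let ?\<phi> = "\<lambda>a\<in>carrier A. \<lambda>u\<in>pset (Ub ?b) a. g u"
  have "?\<phi> \<in> pointed_hom \<Omega> A (Ub ?b) (Ub c)"
    by (rule pol_hom_of_alg_hom[OF g b, of "\<lambda>u. u"]) (simp_all add: alg_hom_closed[OF g] ev_g g_cst)
  moreover have "?\<phi> ?b var = w" using b var_closed ev_var[OF b] g_var by simp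
  ultimately show thesis by (rule that)
qed


section \<open>The action of the enveloping ringoid\<close>

abbreviation "Z \<equiv> env_module \<Omega> E A"
abbreviation "elt \<equiv> env_elem \<Omega> E A"

lemma env_elem_eq: "elt b u = modulization_unit \<Omega> A (Ub b) (ev b u) u"
  by (simp add: env_elem_def)

context
  fixes b assumes b: "b \<in> carrier A"
begin

interpretation P: pointed_overalgebra \<Omega> A "Ub b" by (rule pointed_overalgebra_Ub[OF b])

lemma overalgebra_module_env: "overalgebra_module \<Omega> A (Z b)"
  unfolding env_module_def by (rule P.overalgebra_module_modulization)

lemma env_elem_closed: "u \<in> carrier U \<Longrightarrow> elt b u \<in> carrier (fib (Z b) (ev b u))"
  unfolding env_elem_eq env_module_def by (rule P.unit_closed) (simp_all add: ev_closed b)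

lemma env_var_closed: "elt b var \<in> carrier (fib (Z b) b)"
  using env_elem_closed[OF var_closed] ev_var[OF b] by simp

text \<open>Constants are the basepoints of \<open>Ub b\<close>, and modulization sends basepoints
  to zero.\<close>

lemma env_elem_cst: "a \<in> carrier A \<Longrightarrow> elt b (cst a) = \<one>\<^bsub>fib (Z b) a\<^esub>"
  using P.unit_pt by (simp add: env_elem_eq env_module_def ev_cst[OF b])

lemma env_elem_opn:
  assumes "\<omega> \<in> \<Omega> n" "us \<in> tuples n (carrier U)"
  shows "elt b (opn U \<omega> us) = act (Z b) \<omega> (map (ev b) us) (map (elt b) us)"
proof -
  have "map2 (modulization_unit \<Omega> A (Ub b)) (map (ev b) us) us = map (elt b) us"
    by (induction us) (auto simp: env_elem_eq)
  moreover have "map (ev b) us \<in> tuples n (carrier A)"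
    using ev_closed[OF b] by (rule map_tuples[OF assms(2)])
  ultimately show ?thesis
    using P.unit_pact[OF assms(1) _ listset_pol_overalgI[OF assms(2)]] ev_opn[OF b assms]
    by (simp add: env_elem_eq env_module_def)
qed

lemma env_induct [consumes 2, case_names elem mult inv]:
  assumes "a \<in> carrier A" "z \<in> carrier (fib (Z b) a)"
    and "\<And>u. \<lbrakk>u \<in> carrier U; ev b u = a\<rbrakk> \<Longrightarrow> Q (elt b u)"
    and "\<And>z z'. \<lbrakk>z \<in> carrier (fib (Z b) a); z' \<in> carrier (fib (Z b) a); Q z; Q z'\<rbrakk> \<Longrightarrow>
      Q (z \<otimes>\<^bsub>fib (Z b) a\<^esub> z')"
    and "\<And>z. \<lbrakk>z \<in> carrier (fib (Z b) a); Q z\<rbrakk> \<Longrightarrow> Q (inv\<^bsub>fib (Z b) a\<^esub> z)"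
  shows "Q z"
proof (rule P.modulization_induct[where Q = Q, OF assms(1) assms(2)[unfolded env_module_def]], goal_cases)
  case (1 u)
  then show ?case using assms(3)[of u] by (auto simp: env_elem_eq)
next
  case (2 z z')
  then show ?case by (rule assms(4)[unfolded env_module_def])
next
  case (3 z)
  then show ?case by (rule assms(5)[unfolded env_module_def])
qed

text \<open>Composing with the unit turns a module homomorphism out of \<open>Z b\<close> into a
  pointed homomorphism out of \<open>Ub b\<close>, where \<open>var\<close> determines everything.
  It serves uniqueness here and the comparison with \<open>pol_act\<close> later.\<close>

lemma env_hom_pointed:
  assumes "\<theta> \<in> module_hom \<Omega> A (Z b) M" "overalgebra_module \<Omega> A M"
  shows "(\<lambda>a\<in>carrier A. \<lambda>u\<in>pset (Ub b) a. \<theta> a (elt b u)) \<in> pointed_hom \<Omega> A (Ub b) (forget M)"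
proof (rule P.pointed_hom_restrictI)
  fix a u assume "a \<in> carrier A" "u \<in> pset (Ub b) a"
  then show "\<theta> a (elt b u) \<in> pset (forget M) a"
    using module_hom_closed[OF assms(1)] env_elem_closed by auto
next
  fix a assume a: "a \<in> carrier A"
  have "group_hom (fib (Z b) a) (fib M a) (\<theta> a)"
    using overalgebra_module.fib_group[OF overalgebra_module_env a]
      overalgebra_module.fib_group[OF assms(2) a] module_hom_fib[OF assms(1) a]
    by (simp add: group_hom_def group_hom_axioms_def)
  then show "\<theta> a (elt b (pt (Ub b) a)) = pt (forget M) a"
    using group_hom.hom_one env_elem_cst[OF a] by force
next
  fix n \<omega> as us
  assume *: "\<omega> \<in> \<Omega> n" "as \<in> tuples n (carrier A)" "us \<in> listset (map (pset (Ub b)) as)"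
  note us = listset_pol_overalgD[OF *(3,2)]
  have "map (elt b) us \<in> listset (map (\<lambda>a. carrier (fib (Z b) a)) as)"
    using *(3) env_elem_closed by (fastforce simp: in_listset_map_iff)
  then have "\<theta> (opn A \<omega> as) (act (Z b) \<omega> as (map (elt b) us)) = act M \<omega> as (map2 \<theta> as (map (elt b) us))"
    by (rule module_hom_act[OF assms(1) *(1,2)])
  moreover have "map2 \<theta> as (map (elt b) us) = map2 (\<lambda>a u. \<theta> a (elt b u)) as us"
    by (simp add: zip_map2 case_prod_unfold)
  ultimately show "\<theta> (opn A \<omega> as) (elt b (pact (Ub b) \<omega> as us))
      = pact (forget M) \<omega> as (map2 (\<lambda>a u. \<theta> a (elt b u)) as us)"
    using env_elem_opn[OF *(1) us(1)] us(2) by simp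
qed

text \<open>Two steps: the composites with the unit agree because they agree at \<open>var\<close>,
  and the classes of polynomials generate the fibres.\<close>

lemma env_hom_eqI:
  assumes \<theta>: "\<theta> \<in> module_hom \<Omega> A (Z b) M" and \<theta>': "\<theta>' \<in> module_hom \<Omega> A (Z b) M"
    and M: "overalgebra_module \<Omega> A M" and var: "\<theta> b (elt b var) = \<theta>' b (elt b var)"
  shows "\<theta> = \<theta>'"
proof -
  have "(\<lambda>a\<in>carrier A. \<lambda>u\<in>pset (Ub b) a. \<theta> a (elt b u)) = (\<lambda>a\<in>carrier A. \<lambda>u\<in>pset (Ub b) a. \<theta>' a (elt b u))"
    using env_hom_pointed[OF \<theta> M] env_hom_pointed[OF \<theta>' M] b
    by (rule pol_hom_eqI) (use var b var_closed ev_var[OF b] in simp)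
  then have *: "(\<lambda>u\<in>pset (Ub b) a. \<theta> a (elt b u)) = (\<lambda>u\<in>pset (Ub b) a. \<theta>' a (elt b u))"
    if "a \<in> carrier A" for a
    using that by (metis (no_types, lifting) restrict_apply')
  have "\<theta> a (modulization_unit \<Omega> A (Ub b) a u) = \<theta>' a (modulization_unit \<Omega> A (Ub b) a u)"
    if "a \<in> carrier A" "u \<in> pset (Ub b) a" for a u
    using fun_cong[OF *[OF that(1)], of u] that by (auto simp: env_elem_eq)
  then show ?thesis
    using P.modulization_hom_eqI[of \<theta> M \<theta>'] \<theta> \<theta>' M by (simp add: env_module_def)
qed

lemma env_hom_exists:
  assumes M: "overalgebra_module \<Omega> A M" and \<phi>: "\<phi> \<in> pointed_hom \<Omega> A (Ub b) (forget M)"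
  obtains \<theta> where "\<theta> \<in> module_hom \<Omega> A (Z b) M" "\<theta> b (elt b var) = \<phi> b var"
proof -
  obtain \<theta> where \<theta>: "\<theta> \<in> module_hom \<Omega> A (modulization \<Omega> A (Ub b)) M"
    "\<And>a p. a \<in> carrier A \<Longrightarrow> p \<in> pset (Ub b) a \<Longrightarrow> \<theta> a (modulization_unit \<Omega> A (Ub b) a p) = \<phi> a p"
    using P.modulization_extension[OF M \<phi>] by metis
  then have "\<theta> b (elt b var) = \<phi> b var"
    using \<theta>(2)[OF b, of var] var_closed ev_var[OF b] by (simp add: env_elem_eq)
  with \<theta>(1) show thesis using that by (simp add: env_module_def)
qed

end

text \<open>
  Every module totally in the variety qualifies, but so does every \<open>Z c\<close>: this is all that
  composition in the enveloping ringoid needs, and it is easier to obtain than membership of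
  \<open>total_alg A (Z c)\<close> in the variety.
\<close>

definition env_extendable :: "('f, 'a, 'm) module_data \<Rightarrow> bool" where
  "env_extendable M \<longleftrightarrow> overalgebra_module \<Omega> A M \<and>
     (\<forall>b\<in>carrier A. \<forall>m\<in>carrier (fib M b). \<exists>\<theta>\<in>module_hom \<Omega> A (Z b) M. \<theta> b (elt b var) = m)"

lemma env_extendable_total:
  assumes "overalgebra_module \<Omega> A M" "in_variety \<Omega> E (total_alg A M)"
  shows "env_extendable M"
  unfolding env_extendable_def
  using assms pol_hom_total[OF assms] env_hom_exists[OF _ assms(1)] by metis

text \<open>Induction on the target value \<open>m\<close>. Classes of polynomials are attained by
  substitution followed by the unit; products and inverses are attained by pointwise products and
  inverses of the homomorphisms already found.\<close>

lemma env_extendable_env: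
  assumes c: "c \<in> carrier A"
  shows "env_extendable (Z c)"
  unfolding env_extendable_def
proof (intro conjI ballI)
  note M = overalgebra_module_env[OF c]
  show "overalgebra_module \<Omega> A (Z c)" by (rule M)
  fix b m assume b: "b \<in> carrier A" and m: "m \<in> carrier (fib (Z c) b)"
  note B = overalgebra_module_env[OF b] and x = env_var_closed[OF b]
  from b m show "\<exists>\<theta>\<in>module_hom \<Omega> A (Z b) (Z c). \<theta> b (elt b var) = m"
  proof (induction rule: env_induct[OF c, consumes 2, case_names elem mult inv])
    case (elem w)
    \<comment> \<open>substitution of \<open>w\<close> for the variable\<close>
    obtain \<phi> where \<phi>: "\<phi> \<in> pointed_hom \<Omega> A (Ub b) (Ub c)" "\<phi> b var = w"
      using pol_hom_subst[OF c elem(1)] elem(2) by metis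
    let ?\<psi> = "\<lambda>a\<in>carrier A. \<lambda>u\<in>pset (Ub b) a. elt c (\<phi> a u)"
    have "?\<psi> \<in> pointed_hom \<Omega> A (Ub b) (forget (Z c))"
    proof (rule pointed_overalgebra.pointed_hom_restrictI[OF pointed_overalgebra_Ub[OF b]])
      fix a u assume "a \<in> carrier A" "u \<in> pset (Ub b) a"
      then show "elt c (\<phi> a u) \<in> pset (forget (Z c)) a"
        using pointed_hom_closed[OF \<phi>(1)] env_elem_closed[OF c, of "\<phi> a u"] by fastforce
    next
      fix a assume "a \<in> carrier A"
      then show "elt c (\<phi> a (pt (Ub b) a)) = pt (forget (Z c)) a"
        using pointed_hom_pt[OF \<phi>(1)] env_elem_cst[OF c] by simp
    next
      fix n \<omega> as us
      assume *: "\<omega> \<in> \<Omega> n" "as \<in> tuples n (carrier A)" "us \<in> listset (map (pset (Ub b)) as)"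
      have "map2 \<phi> as us \<in> listset (map (pset (Ub c)) as)"
        using pointed_hom_closed[OF \<phi>(1)] tuples_set[OF *(2)] by (intro map2_in_listset[OF *(3)]) blast
      note us = listset_pol_overalgD[OF this *(2)]
      have eq: "map (elt c) (map2 \<phi> as us) = map2 (\<lambda>a u. elt c (\<phi> a u)) as us"
        by (simp add: case_prod_unfold)
      have "\<phi> (opn A \<omega> as) (pact (Ub b) \<omega> as us) = opn U \<omega> (map2 \<phi> as us)"
        using pointed_hom_pact[OF \<phi>(1) *] by simp
      then show "elt c (\<phi> (opn A \<omega> as) (pact (Ub b) \<omega> as us))
          = pact (forget (Z c)) \<omega> as (map2 (\<lambda>a u. elt c (\<phi> a u)) as us)"
        by (simp only: env_elem_opn[OF c *(1) us(1)] us(2) forget_simps eq)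
    qed
    from env_hom_exists[OF b M this] show ?case
      using b var_closed ev_var[OF b] \<phi>(2) by auto
  next
    case (mult z z')
    then obtain \<theta> \<theta>' where "\<theta> \<in> module_hom \<Omega> A (Z b) (Z c)" "\<theta> b (elt b var) = z"
      "\<theta>' \<in> module_hom \<Omega> A (Z b) (Z c)" "\<theta>' b (elt b var) = z'" by blast
    with module_hom_mult[OF B M this(1,3)] b x show ?case by (intro bexI) simp_all
  next
    case (inv z)
    then obtain \<theta> where "\<theta> \<in> module_hom \<Omega> A (Z b) (Z c)" "\<theta> b (elt b var) = z" by blast
    with module_hom_inv[OF B M this(1)] b x show ?case by (intro bexI) simp_all
  qed
qed

section \<open>The action of arrows on a module to which homomorphisms extend\<close>

context
  fixes M :: "('f, 'a, 'm) module_data" assumes ext: "env_extendable M"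
begin

interpretation M: overalgebra_module \<Omega> A M using ext by (simp add: env_extendable_def)

text \<open>Removes the definite description: to compute \<open>env_extend\<close> it is enough to
  exhibit one homomorphism with the right value at the class of \<open>x\<close>.\<close>

lemma env_extend_eq:
  assumes "b \<in> carrier A" "\<theta> \<in> module_hom \<Omega> A (Z b) M" "\<theta> b (elt b var) = m"
  shows "env_extend \<Omega> E A M b m = \<theta>"
  unfolding env_extend_def
proof (rule the_equality)
  fix \<theta>' assume "\<theta>' \<in> module_hom \<Omega> A (Z b) M \<and> \<theta>' b (elt b var) = m"
  then show "\<theta>' = \<theta>"
    using assms by (intro env_hom_eqI[OF assms(1) _ assms(2) M.overalgebra_module_axioms]) simp_all
qed (use assms in simp)

lemma env_extend_props:
  assumes "b \<in> carrier A" "m \<in> carrier (fib M b)"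
  shows env_extend_hom: "env_extend \<Omega> E A M b m \<in> module_hom \<Omega> A (Z b) M"
    and env_extend_var: "env_extend \<Omega> E A M b m b (elt b var) = m"
proof -
  obtain \<theta> where "\<theta> \<in> module_hom \<Omega> A (Z b) M" "\<theta> b (elt b var) = m"
    using ext assms by (auto simp: env_extendable_def)
  with env_extend_eq[OF assms(1) this]
  show "env_extend \<Omega> E A M b m \<in> module_hom \<Omega> A (Z b) M" "env_extend \<Omega> E A M b m b (elt b var) = m"
    by auto
qed

abbreviation "ea \<equiv> env_act \<Omega> E A M"

lemma env_act_hom:
  "\<lbrakk>a \<in> carrier A; b \<in> carrier A; m \<in> carrier (fib M b)\<rbrakk> \<Longrightarrow> (\<lambda>z. ea a b z m) \<in> hom (fib (Z b) a) (fib M a)"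
  unfolding env_act_def using module_hom_fib[OF env_extend_hom] by simp

lemma env_act_closed:
  "\<lbrakk>a \<in> carrier A; b \<in> carrier A; z \<in> carrier (fib (Z b) a); m \<in> carrier (fib M b)\<rbrakk> \<Longrightarrow> ea a b z m \<in> carrier (fib M a)"
  unfolding env_act_def using module_hom_closed[OF env_extend_hom] by simp

lemma env_act_mult_right:
  assumes "a \<in> carrier A" and b: "b \<in> carrier A" and "z \<in> carrier (fib (Z b) a)"
    and m: "m \<in> carrier (fib M b)" "m' \<in> carrier (fib M b)"
  shows "ea a b z (m \<otimes>\<^bsub>fib M b\<^esub> m') = ea a b z m \<otimes>\<^bsub>fib M a\<^esub> ea a b z m'"
proof -
  note hom = module_hom_mult[OF overalgebra_module_env[OF b] M.overalgebra_module_axioms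
      env_extend_hom[OF b m(1)] env_extend_hom[OF b m(2)]]
  show ?thesis
    unfolding env_act_def using env_extend_eq[OF b hom] assms env_var_closed[OF b]
    by (simp add: env_extend_var)
qed

lemma env_act_var: "b \<in> carrier A \<Longrightarrow> m \<in> carrier (fib M b) \<Longrightarrow> ea b b (elt b var) m = m"
  unfolding env_act_def by (rule env_extend_var)

text \<open>\<open>env_extend\<close> commutes with the operations. Both inclusions between the
  image and \<open>Z_sub\<close> rest on this formula: one uses it in the induction on polynomials,
  the other at a polynomial built from constants and one variable.\<close>

lemma env_act_opn:
  assumes b: "b \<in> carrier A" and \<omega>: "\<omega> \<in> \<Omega> n" and us: "us \<in> tuples n (carrier U)"
    and m: "m \<in> carrier (fib M b)"
  shows "ea (ev b (opn U \<omega> us)) b (elt b (opn U \<omega> us)) m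
    = act M \<omega> (map (ev b) us) (map (\<lambda>u. ea (ev b u) b (elt b u) m) us)"
proof -
  let ?\<theta> = "env_extend \<Omega> E A M b m" and ?as = "map (ev b) us"
  have as: "?as \<in> tuples n (carrier A)" using ev_closed[OF b] by (rule map_tuples[OF us])
  have "map (elt b) us \<in> listset (map (\<lambda>a. carrier (fib (Z b) a)) ?as)"
    unfolding in_listset_map_iff
    using env_elem_closed[OF b] tuples_nth[OF us] tuples_length[OF us] by simp
  note module_hom_act[OF env_extend_hom[OF b m] \<omega> as this]
  moreover have "map2 ?\<theta> ?as (map (elt b) us) = map (\<lambda>u. ?\<theta> (ev b u) (elt b u)) us"
    by (induction us) auto
  ultimately show ?thesis
    using env_elem_opn[OF b \<omega> us] ev_opn[OF b \<omega> us] unfolding env_act_def by simp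
qed

lemma env_act_cst:
  assumes "a \<in> carrier A" "b \<in> carrier A" "m \<in> carrier (fib M b)"
  shows "ea a b (elt b (cst a)) m = \<one>\<^bsub>fib M a\<^esub>"
proof -
  have "group_hom (fib (Z b) a) (fib M a) (\<lambda>z. ea a b z m)"
    using overalgebra_module.fib_group[OF overalgebra_module_env] M.fib_group env_act_hom assms
    by (simp add: group_hom_def group_hom_axioms_def)
  then show ?thesis using group_hom.hom_one env_elem_cst[OF assms(2,1)] by force
qed

text \<open>Composed with the unit, \<open>env_extend\<close> is a pointed homomorphism with value
  \<open>m\<close> at \<open>var\<close>; there is only one such, and \<open>pol_act\<close> is
  defined as it.\<close>

lemma env_act_elem:
  assumes b: "b \<in> carrier A" and m: "m \<in> carrier (fib M b)" and u: "u \<in> carrier U"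
  shows "ea (ev b u) b (elt b u) m = pol_act \<Omega> E A M b u m"
proof -
  let ?\<theta> = "env_extend \<Omega> E A M b m"
  let ?\<phi> = "\<lambda>a\<in>carrier A. \<lambda>u\<in>pset (Ub b) a. ?\<theta> a (elt b u)"
  have \<phi>: "?\<phi> \<in> pointed_hom \<Omega> A (Ub b) (forget M)"
    by (rule env_hom_pointed[OF b env_extend_hom[OF b m] M.overalgebra_module_axioms])
  have var: "?\<phi> b var = m"
    using b var_closed ev_var[OF b] env_extend_var[OF b m] by simp
  have "(THE \<phi>. \<phi> \<in> pointed_hom \<Omega> A (Ub b) (forget M) \<and> \<phi> b var = m) = ?\<phi>"
  proof (rule the_equality)
    fix \<psi> assume "\<psi> \<in> pointed_hom \<Omega> A (Ub b) (forget M) \<and> \<psi> b var = m"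
    then show "\<psi> = ?\<phi>" using var by (intro pol_hom_eqI[OF _ \<phi> b]) simp_all
  qed (use \<phi> var in blast)
  then show ?thesis
    unfolding pol_act_def env_act_def using ev_closed[OF b u] u by simp
qed

end

lemma env_act_assoc:
  assumes ext: "env_extendable M" and a: "a \<in> carrier A" and b: "b \<in> carrier A" and c: "c \<in> carrier A"
    and z: "z \<in> carrier (fib (Z b) a)" and z': "z' \<in> carrier (fib (Z c) b)" and m: "m \<in> carrier (fib M c)"
  shows "env_act \<Omega> E A M a c (env_act \<Omega> E A (Z c) a b z z') m
    = env_act \<Omega> E A M a b z (env_act \<Omega> E A M b c z' m)"
proof -
  note ext_c = env_extendable_env[OF c]
  note hom = module_hom_compose[OF overalgebra_module_env[OF b] env_extend_hom[OF ext_c b z']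
      env_extend_hom[OF ext c m]]
  show ?thesis
    unfolding env_act_def using env_extend_eq[OF ext b hom] env_extend_var[OF ext_c b z'] a b z
      env_var_closed[OF b]
    by simp
qed

end


section \<open>Ringoids of homomorphisms and subringoids\<close>

lemma hom_monoid_simps [simp]:
  "f \<in> carrier (hom_monoid G H) \<longleftrightarrow> f \<in> hom G H \<and> f \<in> extensional (carrier G)"
  "f \<otimes>\<^bsub>hom_monoid G H\<^esub> g = (\<lambda>x\<in>carrier G. f x \<otimes>\<^bsub>H\<^esub> g x)"
  "\<one>\<^bsub>hom_monoid G H\<^esub> = (\<lambda>x\<in>carrier G. \<one>\<^bsub>H\<^esub>)"
  by (simp_all add: hom_monoid_def)

text \<open>Commutativity of \<open>H\<close> makes pointwise products and inverses homomorphisms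
  again. Extensionality is what makes the identity law an equality of functions.\<close>

lemma comm_group_hom_monoid:
  assumes G: "monoid G" and H: "comm_group H"
  shows "comm_group (hom_monoid G H)"
proof -
  interpret H: comm_group H by (rule H)
  note [simp] = hom_restrict_iff[OF G]
  show ?thesis
  proof (rule comm_groupI)
    fix f g assume "f \<in> carrier (hom_monoid G H)" "g \<in> carrier (hom_monoid G H)"
    then show "f \<otimes>\<^bsub>hom_monoid G H\<^esub> g \<in> carrier (hom_monoid G H)"
      using H.hom_group_mult[of f G g] by simp
    from \<open>f \<in> _\<close> \<open>g \<in> _\<close> show "f \<otimes>\<^bsub>hom_monoid G H\<^esub> g = g \<otimes>\<^bsub>hom_monoid G H\<^esub> f"
      by (auto simp: hom_def Pi_iff H.m_comm)
  next
    show "\<one>\<^bsub>hom_monoid G H\<^esub> \<in> carrier (hom_monoid G H)"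
      by (simp add: hom_def monoid.m_closed[OF G])
  next
    fix f g h assume "f \<in> carrier (hom_monoid G H)" "g \<in> carrier (hom_monoid G H)"
      "h \<in> carrier (hom_monoid G H)"
    then show "f \<otimes>\<^bsub>hom_monoid G H\<^esub> g \<otimes>\<^bsub>hom_monoid G H\<^esub> h
        = f \<otimes>\<^bsub>hom_monoid G H\<^esub> (g \<otimes>\<^bsub>hom_monoid G H\<^esub> h)"
      by (auto simp: hom_def Pi_iff H.m_assoc)
  next
    fix f assume f: "f \<in> carrier (hom_monoid G H)"
    then show "\<one>\<^bsub>hom_monoid G H\<^esub> \<otimes>\<^bsub>hom_monoid G H\<^esub> f = f"
      by (auto simp: hom_def Pi_iff intro!: extensionalityI[of _ "carrier G"])
    let ?g = "\<lambda>x\<in>carrier G. inv\<^bsub>H\<^esub> f x"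
    have "?g \<in> carrier (hom_monoid G H)"
      using f by (auto simp: hom_def Pi_iff H.inv_mult monoid.m_closed[OF G])
    moreover have "?g \<otimes>\<^bsub>hom_monoid G H\<^esub> f = \<one>\<^bsub>hom_monoid G H\<^esub>"
      using f by (auto simp: hom_def Pi_iff)
    ultimately show "\<exists>g\<in>carrier (hom_monoid G H). g \<otimes>\<^bsub>hom_monoid G H\<^esub> f = \<one>\<^bsub>hom_monoid G H\<^esub>"
      by blast
  qed
qed

lemma End_ringoid_simps [simp]:
  "robj (End_ringoid A M) = carrier A" "rhom (End_ringoid A M) a b = hom_monoid (fib M b) (fib M a)"
  "rcomp (End_ringoid A M) a b c = compose (carrier (fib M c))"
  "rid (End_ringoid A M) a = (\<lambda>m\<in>carrier (fib M a). m)"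
  by (simp_all add: End_ringoid_def)

lemma (in overalgebra_module) ringoid_End: "ringoid (End_ringoid A M)"
proof (rule ringoid.intro)
  fix a b c f g
  assume *: "a \<in> robj (End_ringoid A M)" "b \<in> robj (End_ringoid A M)" "c \<in> robj (End_ringoid A M)"
    and fg: "f \<in> carrier (rhom (End_ringoid A M) a b)" "g \<in> carrier (rhom (End_ringoid A M) b c)"
  have "monoid (fib M c)" using * fib_monoid by simp
  then show "rcomp (End_ringoid A M) a b c f g \<in> carrier (rhom (End_ringoid A M) a c)"
    using fg hom_compose[of g "fib M c" "fib M b" f "fib M a"]
    by (simp add: compose_def hom_restrict_iff comp_def)
  {
    fix f' assume "f' \<in> carrier (rhom (End_ringoid A M) a b)"
    then show "rcomp (End_ringoid A M) a b c (f \<otimes>\<^bsub>rhom (End_ringoid A M) a b\<^esub> f') g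
        = rcomp (End_ringoid A M) a b c f g \<otimes>\<^bsub>rhom (End_ringoid A M) a c\<^esub> rcomp (End_ringoid A M) a b c f' g"
      using fg by (auto simp: compose_def hom_def Pi_iff)
  }
  {
    fix g' assume "g' \<in> carrier (rhom (End_ringoid A M) b c)"
    then show "rcomp (End_ringoid A M) a b c f (g \<otimes>\<^bsub>rhom (End_ringoid A M) b c\<^esub> g')
        = rcomp (End_ringoid A M) a b c f g \<otimes>\<^bsub>rhom (End_ringoid A M) a c\<^esub> rcomp (End_ringoid A M) a b c f g'"
      using fg by (auto simp: compose_def hom_def Pi_iff)
  }
  fix d h assume "h \<in> carrier (rhom (End_ringoid A M) c d)"
  then show "rcomp (End_ringoid A M) a c d (rcomp (End_ringoid A M) a b c f g) h
      = rcomp (End_ringoid A M) a b d f (rcomp (End_ringoid A M) b c d g h)"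
    using fg by (auto simp: compose_def hom_def Pi_iff)
next
  fix a b f
  assume *: "a \<in> robj (End_ringoid A M)" "b \<in> robj (End_ringoid A M)"
  show "comm_group (rhom (End_ringoid A M) a b)"
    using * by (simp add: comm_group_hom_monoid fib_monoid fib_comm_group)
  show "rid (End_ringoid A M) a \<in> carrier (rhom (End_ringoid A M) a a)"
    using * fib_monoid by (simp add: hom_def monoid.m_closed)
  assume f: "f \<in> carrier (rhom (End_ringoid A M) a b)"
  then show "rcomp (End_ringoid A M) a a b (rid (End_ringoid A M) a) f = f"
    by (auto simp: compose_def hom_def Pi_iff intro!: extensionalityI[of _ "carrier (fib M b)"])
  from f show "rcomp (End_ringoid A M) a b b f (rid (End_ringoid A M) b) = f"
    by (auto simp: compose_def intro!: extensionalityI[of _ "carrier (fib M b)"])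
qed

lemma subringoid_subgroup:
  "\<lbrakk>subringoid X S; a \<in> robj X; b \<in> robj X\<rbrakk> \<Longrightarrow> subgroup (S a b) (rhom X a b)"
  by (simp add: subringoid_def)

lemma subringoid_rid: "\<lbrakk>subringoid X S; a \<in> robj X\<rbrakk> \<Longrightarrow> rid X a \<in> S a a"
  by (simp add: subringoid_def)

lemma subringoid_rcomp:
  "\<lbrakk>subringoid X S; a \<in> robj X; b \<in> robj X; c \<in> robj X; f \<in> S a b; g \<in> S b c\<rbrakk> \<Longrightarrow> rcomp X a b c f g \<in> S a c"
  by (simp add: subringoid_def)

context ringoid
begin

lemma rhom_group: "a \<in> robj X \<Longrightarrow> b \<in> robj X \<Longrightarrow> group (rhom X a b)"
  using rhom_comm_group comm_group.axioms(2) by blast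

lemma ringoid_restrict:
  assumes S: "subringoid X S"
  shows "ringoid (restrict_ringoid X S)"
proof -
  have cl: "f \<in> carrier (rhom X a b)" if "a \<in> robj X" "b \<in> robj X" "f \<in> S a b" for a b f
    using subgroup.mem_carrier[OF subringoid_subgroup[OF S that(1,2)] that(3)] .
  have "comm_group ((rhom X a b)\<lparr>carrier := S a b\<rparr>)" if "a \<in> robj X" "b \<in> robj X" for a b
  proof (rule group.group_comm_groupI[OF subgroup.subgroup_is_group[OF subringoid_subgroup[OF S that] rhom_group[OF that]]])
    fix f g assume "f \<in> carrier ((rhom X a b)\<lparr>carrier := S a b\<rparr>)" "g \<in> carrier ((rhom X a b)\<lparr>carrier := S a b\<rparr>)"
    then show "f \<otimes>\<^bsub>(rhom X a b)\<lparr>carrier := S a b\<rparr>\<^esub> g = g \<otimes>\<^bsub>(rhom X a b)\<lparr>carrier := S a b\<rparr>\<^esub> f"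
      using comm_monoid.m_comm[OF comm_group.axioms(1)[OF rhom_comm_group[OF that]]] cl[OF that] by simp
  qed
  then show ?thesis
    using subringoid_rid[OF S] subringoid_rcomp[OF S] cl
    by (intro ringoid.intro)
      (simp_all add: restrict_ringoid_def rcomp_add_left rcomp_add_right rcomp_assoc rid_left rid_right)
qed

lemma subringoid_carrier: "subringoid X (\<lambda>a b. carrier (rhom X a b))"
  unfolding subringoid_def using rcomp_closed rid_closed rhom_group group.subgroup_self by blast

text \<open>As \<open>G\<close> consists of arrows of \<open>X\<close>, the family of all arrows is
  one of the competitors; hence the intersection is over a nonempty collection.\<close>

lemma subringoid_generated:
  assumes G: "\<And>c d. c \<in> robj X \<Longrightarrow> d \<in> robj X \<Longrightarrow> G c d \<subseteq> carrier (rhom X c d)"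
  shows "subringoid X (generated_subringoid X G)"
  unfolding subringoid_def
proof (intro conjI ballI)
  fix a b assume ab: "a \<in> robj X" "b \<in> robj X"
  show "subgroup (generated_subringoid X G a b) (rhom X a b)"
    unfolding generated_subringoid_def
  proof (rule group.subgroups_Inter[OF rhom_group[OF ab]])
    show "{S a b | S. subringoid X S \<and> (\<forall>c\<in>robj X. \<forall>d\<in>robj X. G c d \<subseteq> S c d)} \<noteq> {}"
      using subringoid_carrier G by blast
    fix H assume "H \<in> {S a b | S. subringoid X S \<and> (\<forall>c\<in>robj X. \<forall>d\<in>robj X. G c d \<subseteq> S c d)}"
    then obtain S where "subringoid X S" "H = S a b" by blast
    then show "subgroup H (rhom X a b)" using subringoid_subgroup ab by simp
  qed
next
  fix a assume "a \<in> robj X"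
  then show "rid X a \<in> generated_subringoid X G a a"
    by (auto simp: generated_subringoid_def subringoid_rid)
next
  fix a b c f g
  assume *: "a \<in> robj X" "b \<in> robj X" "c \<in> robj X"
    and fg: "f \<in> generated_subringoid X G a b" "g \<in> generated_subringoid X G b c"
  have "rcomp X a b c f g \<in> S a c"
    if S: "subringoid X S" "\<forall>c\<in>robj X. \<forall>d\<in>robj X. G c d \<subseteq> S c d" for S
  proof (rule subringoid_rcomp[OF S(1) *])
    show "f \<in> S a b" using fg(1) S unfolding generated_subringoid_def by blast
    show "g \<in> S b c" using fg(2) S unfolding generated_subringoid_def by blast
  qed
  then show "rcomp X a b c f g \<in> generated_subringoid X G a c"
    by (auto simp: generated_subringoid_def)
qed

end

lemma generated_subringoid_least:
  "\<lbrakk>subringoid X S; \<And>c d. c \<in> robj X \<Longrightarrow> d \<in> robj X \<Longrightarrow> G c d \<subseteq> S c d\<rbrakk> \<Longrightarrow>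
    generated_subringoid X G a b \<subseteq> S a b"
  unfolding generated_subringoid_def by blast

lemma generated_subringoid_contains:
  "\<lbrakk>a \<in> robj X; b \<in> robj X\<rbrakk> \<Longrightarrow> G a b \<subseteq> generated_subringoid X G a b"
  unfolding generated_subringoid_def by blast

text \<open>With the identity on objects, composable arrows of the image have composable preimages.
  This is why the image is closed under composition.\<close>

lemma subringoid_image:
  assumes "ringoid_hom X Y (\<lambda>a. a) f" and obj: "robj X = robj Y"
  shows "subringoid Y (\<lambda>a b. f a b ` carrier (rhom X a b))"
proof -
  interpret ringoid_hom X Y "\<lambda>a. a" f by fact
  show ?thesis
    unfolding subringoid_def
  proof (intro conjI ballI)
    fix a b assume ab: "a \<in> robj Y" "b \<in> robj Y"
    then have "group_hom (rhom X a b) (rhom Y a b) (f a b)"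
      using source.rhom_group target.rhom_group additive obj
      by (simp add: group_hom_def group_hom_axioms_def)
    then show "subgroup (f a b ` carrier (rhom X a b)) (rhom Y a b)"
      by (rule group_hom.img_is_subgroup)
  next
    fix a assume "a \<in> robj Y"
    then show "rid Y a \<in> f a a ` carrier (rhom X a a)"
      using preserves_rid source.rid_closed obj by (metis image_eqI)
  next
    fix a b c g h
    assume *: "a \<in> robj Y" "b \<in> robj Y" "c \<in> robj Y"
      and "g \<in> f a b ` carrier (rhom X a b)" "h \<in> f b c ` carrier (rhom X b c)"
    then obtain z z' where z: "z \<in> carrier (rhom X a b)" "g = f a b z"
      and z': "z' \<in> carrier (rhom X b c)" "h = f b c z'" by blast
    show "rcomp Y a b c g h \<in> f a c ` carrier (rhom X a c)"
      using preserves_rcomp[of a b c z z'] source.rcomp_closed[of a b c z z'] * z z' obj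
      by (metis image_eqI)
  qed
qed

section \<open>The subringoid generated by the one-argument operations\<close>

context overalgebra_module
begin

lemma op_homs_closed: "op_homs \<Omega> A M a b \<subseteq> carrier (rhom (End_ringoid A M) a b)"
  using act_at_hom by (auto simp: op_homs_def) (auto simp: act_at_def)

lemma subringoid_Z_sub: "subringoid (End_ringoid A M) (Z_sub \<Omega> A M)"
  unfolding Z_sub_def by (rule ringoid.subringoid_generated[OF ringoid_End op_homs_closed])

text \<open>Closure of \<open>Z_sub\<close> under combining arrows with a common source by an n-ary
  operation. It is the operation step of the induction on polynomials, stated without reference to
  polynomials.\<close>

lemma Z_sub_act:
  assumes b: "b \<in> carrier A" and \<omega>: "\<omega> \<in> \<Omega> n" and as: "as \<in> tuples n (carrier A)"
    and gs: "gs \<in> listset (map (\<lambda>a. Z_sub \<Omega> A M a b) as)"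
  shows "(\<lambda>m\<in>carrier (fib M b). act M \<omega> as (map (\<lambda>g. g m) gs)) \<in> Z_sub \<Omega> A M (opn A \<omega> as) b"
proof -
  let ?X = "End_ringoid A M" and ?a = "opn A \<omega> as"
  \<comment> \<open>\<open>?F a\<close> is the group of arrows of \<open>Z_sub\<close> from
    \<open>b\<close> to \<open>a\<close>. Thus \<open>gs\<close> is an element of a product of
    groups, and the list induction runs over arrows in place of elements of fibres.\<close>
  let ?F = "\<lambda>a. (rhom ?X a b)\<lparr>carrier := Z_sub \<Omega> A M a b\<rparr>"
  let ?H = "\<lambda>gs. \<lambda>m\<in>carrier (fib M b). act M \<omega> as (map (\<lambda>g. g m) gs)"
  note a = opn_closed[OF \<omega> as]
  have sub: "subgroup (Z_sub \<Omega> A M a b) (rhom ?X a b)" if "a \<in> carrier A" for a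
    using subringoid_subgroup[OF subringoid_Z_sub] that b by simp
  have cl: "g m \<in> carrier (fib M a)" if "a \<in> carrier A" "g \<in> Z_sub \<Omega> A M a b" "m \<in> carrier (fib M b)" for a g m
    using subgroup.mem_carrier[OF sub[OF that(1)] that(2)] that(3)
    by (auto intro: hom_in_carrier)
  have maps: "map (\<lambda>g. g m) gs \<in> listset (map (\<lambda>a. carrier (fib M a)) as)"
    if "gs \<in> listset (map (\<lambda>a. carrier (?F a)) as)" "m \<in> carrier (fib M b)" for gs m
    using that cl tuples_nth[OF as] tuples_length[OF as] by (auto simp: in_listset_map_iff)
  from gs have "gs \<in> listset (map (\<lambda>a. carrier (?F a)) as)" by simp
  then show ?thesis
  proof (induction rule: list_group_induct)
    case (group a)
    then have "a \<in> carrier A" by (rule tuples_set[OF as])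
    then show ?case
      using subgroup.subgroup_is_group[OF sub ringoid.rhom_group[OF ringoid_End]] b by simp
  next
    case one
    have "?H (map (\<lambda>a. \<one>\<^bsub>?F a\<^esub>) as) = \<one>\<^bsub>rhom ?X ?a b\<^esub>"
      using act_one[OF \<omega> as] by (auto simp: comp_def)
    then show ?case using subgroup.one_closed[OF sub[OF a]] by (simp only:)
  next
    case (single i g)
    have i: "i < n" using single(1) tuples_length[OF as] by simp
    note ai = tuples_nth[OF as i]
    have g: "g \<in> Z_sub \<Omega> A M (as ! i) b" using single by simp
    \<comment> \<open>With one nontrivial arrow \<open>g\<close>, the combined map is a generator of
      \<open>Z_sub\<close> composed with \<open>g\<close>.\<close>
    have "act_at M \<omega> as i \<in> op_homs \<Omega> A M ?a (as ! i)"
      unfolding op_homs_def using \<omega> as i by blast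
    then have "act_at M \<omega> as i \<in> Z_sub \<Omega> A M ?a (as ! i)"
      using generated_subringoid_contains[of ?a ?X "as ! i" "op_homs \<Omega> A M"] a ai
      unfolding Z_sub_def by auto
    from subringoid_rcomp[OF subringoid_Z_sub _ _ _ this g] a ai b
    have "compose (carrier (fib M b)) (act_at M \<omega> as i) g \<in> Z_sub \<Omega> A M ?a b" by simp
    also have "compose (carrier (fib M b)) (act_at M \<omega> as i) g = ?H ((map (\<lambda>a. \<one>\<^bsub>?F a\<^esub>) as)[i := g])"
    proof (rule extensionalityI[of _ "carrier (fib M b)"])
      fix m assume m: "m \<in> carrier (fib M b)"
      have "map (\<lambda>g. g m) ((map (\<lambda>a. \<one>\<^bsub>?F a\<^esub>) as)[i := g]) = (map (\<lambda>a. \<one>\<^bsub>fib M a\<^esub>) as)[i := g m]"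
        using m by (simp add: map_update comp_def)
      then show "compose (carrier (fib M b)) (act_at M \<omega> as i) g m
          = ?H ((map (\<lambda>a. \<one>\<^bsub>?F a\<^esub>) as)[i := g]) m"
        using cl[OF ai g m] m by (simp only: compose_def act_at_def restrict_apply' if_True)
    qed simp_all
    finally show ?case .
  next
    case (mult xs ys)
    have "?H (xs \<otimes>\<^bsub>list_group (map ?F as)\<^esub> ys) = ?H xs \<otimes>\<^bsub>rhom ?X ?a b\<^esub> ?H ys"
    proof (rule extensionalityI[of _ "carrier (fib M b)"])
      fix m assume m: "m \<in> carrier (fib M b)"
      have "map (\<lambda>g. g m) (xs \<otimes>\<^bsub>list_group (map ?F as)\<^esub> ys)
          = map (\<lambda>g. g m) xs \<otimes>\<^bsub>list_group (map (fib M) as)\<^esub> map (\<lambda>g. g m) ys"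
        using mult(1,2) m by (intro nth_equalityI) (auto simp: in_listset_map_iff)
      then show "?H (xs \<otimes>\<^bsub>list_group (map ?F as)\<^esub> ys) m = (?H xs \<otimes>\<^bsub>rhom ?X ?a b\<^esub> ?H ys) m"
        using act_mult[OF \<omega> as maps[OF mult(1) m] maps[OF mult(2) m]] m by simp
    qed simp_all
    then show ?case using subgroup.m_closed[OF sub[OF a] mult(3,4)] by (simp only:)
  qed
qed

end


section \<open>The representation on a module\<close>

context algebra_in_variety
begin

lemma env_ringoid_simps [simp]:
  "robj (env_ringoid \<Omega> E A) = carrier A" "rhom (env_ringoid \<Omega> E A) a b = fib (Z b) a"
  "rcomp (env_ringoid \<Omega> E A) a b c = env_act \<Omega> E A (Z c) a b" "rid (env_ringoid \<Omega> E A) b = elt b var"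
  by (simp_all add: env_ringoid_def fun_eq_iff)

text \<open>Additivity in the left factor and the left unit law are properties of
  \<open>env_extend\<close> itself; additivity in the right factor and associativity come from its
  uniqueness. All of it uses that each \<open>Z c\<close> is extendable.\<close>

lemma ringoid_env: "ringoid (env_ringoid \<Omega> E A)"
proof (rule ringoid.intro, unfold env_ringoid_simps)
  fix a b z assume *: "a \<in> carrier A" "b \<in> carrier A"
  show "comm_group (fib (Z b) a)"
    by (rule overalgebra_module.fib_comm_group[OF overalgebra_module_env[OF *(2)] *(1)])
  assume z: "z \<in> carrier (fib (Z b) a)"
  show "env_act \<Omega> E A (Z b) a a (elt a var) z = z"
    by (rule env_act_var[OF env_extendable_env[OF *(2)] *(1) z])
  \<comment> \<open>Right unit law: the identity of \<open>Z b\<close> sends the class of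
    \<open>x\<close> to itself, so it is the extension in question.\<close>
  have "env_extend \<Omega> E A (Z b) b (elt b var) = (\<lambda>a\<in>carrier A. \<lambda>m\<in>carrier (fib (Z b) a). m)"
    using * env_var_closed
    by (intro env_extend_eq env_extendable_env module_hom_id overalgebra_module_env) simp_all
  then show "env_act \<Omega> E A (Z b) a b z (elt b var) = z"
    unfolding env_act_def using * z by simp
next
  fix a b c z z' assume abc: "a \<in> carrier A" "b \<in> carrier A" "c \<in> carrier A"
    and z: "z \<in> carrier (fib (Z b) a)" and z': "z' \<in> carrier (fib (Z c) b)"
  note ext = env_extendable_env[OF abc(3)]
  show "env_act \<Omega> E A (Z c) a b z z' \<in> carrier (fib (Z c) a)"
    by (rule env_act_closed[OF ext abc(1,2) z z'])
  {
    fix y assume "y \<in> carrier (fib (Z b) a)"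
    then show "env_act \<Omega> E A (Z c) a b (z \<otimes>\<^bsub>fib (Z b) a\<^esub> y) z'
        = env_act \<Omega> E A (Z c) a b z z' \<otimes>\<^bsub>fib (Z c) a\<^esub> env_act \<Omega> E A (Z c) a b y z'"
      by (rule hom_mult[OF env_act_hom[OF ext abc(1,2) z'] z])
  }
  {
    fix y assume "y \<in> carrier (fib (Z c) b)"
    then show "env_act \<Omega> E A (Z c) a b z (z' \<otimes>\<^bsub>fib (Z c) b\<^esub> y)
        = env_act \<Omega> E A (Z c) a b z z' \<otimes>\<^bsub>fib (Z c) a\<^esub> env_act \<Omega> E A (Z c) a b z y"
      by (rule env_act_mult_right[OF ext abc(1,2) z z'])
  }
  fix d y assume "d \<in> carrier A" "y \<in> carrier (fib (Z d) c)"
  then show "env_act \<Omega> E A (Z d) a c (env_act \<Omega> E A (Z c) a b z z') y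
      = env_act \<Omega> E A (Z d) a b z (env_act \<Omega> E A (Z d) b c z' y)"
    by (intro env_act_assoc env_extendable_env abc z z')
next
  fix a assume "a \<in> carrier A"
  then show "elt a var \<in> carrier (fib (Z a) a)" by (rule env_var_closed)
qed

context
  fixes M :: "('f, 'a, 'm) module_data" assumes ext: "env_extendable M"
begin

interpretation M: overalgebra_module \<Omega> A M using ext by (simp add: env_extendable_def)

text \<open>Additivity of the action in \<open>m\<close> puts each value among the homomorphisms of
  fibres; additivity in \<open>z\<close> makes the assignment itself additive.\<close>

lemma env_rep_ringoid_hom: "ringoid_hom (env_ringoid \<Omega> E A) (End_ringoid A M) (\<lambda>a. a) (env_rep \<Omega> E A M)"
proof (rule ringoid_hom.intro[OF ringoid_env M.ringoid_End], rule ringoid_hom_axioms.intro,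
    unfold env_ringoid_simps End_ringoid_simps)
  fix a b assume ab: "a \<in> carrier A" "b \<in> carrier A"
  show "env_rep \<Omega> E A M a b \<in> hom (fib (Z b) a) (hom_monoid (fib M b) (fib M a))"
  proof (rule homI)
    fix z assume z: "z \<in> carrier (fib (Z b) a)"
    have "(\<lambda>m. env_act \<Omega> E A M a b z m) \<in> hom (fib M b) (fib M a)"
      by (rule homI) (simp_all add: env_act_closed[OF ext ab z] env_act_mult_right[OF ext ab z])
    then show "env_rep \<Omega> E A M a b z \<in> carrier (hom_monoid (fib M b) (fib M a))"
      using M.fib_monoid[OF ab(2)] by (simp add: env_rep_def hom_restrict_iff)
    fix z' assume "z' \<in> carrier (fib (Z b) a)"
    then show "env_rep \<Omega> E A M a b (z \<otimes>\<^bsub>fib (Z b) a\<^esub> z')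
        = env_rep \<Omega> E A M a b z \<otimes>\<^bsub>hom_monoid (fib M b) (fib M a)\<^esub> env_rep \<Omega> E A M a b z'"
      using hom_mult[OF env_act_hom[OF ext ab] z] by (auto simp: env_rep_def)
  qed
next
  fix a b c z z'
  assume *: "a \<in> carrier A" "b \<in> carrier A" "c \<in> carrier A"
    "z \<in> carrier (fib (Z b) a)" "z' \<in> carrier (fib (Z c) b)"
  then show "env_rep \<Omega> E A M a c (env_act \<Omega> E A (Z c) a b z z')
      = compose (carrier (fib M c)) (env_rep \<Omega> E A M a b z) (env_rep \<Omega> E A M b c z')"
    using env_act_assoc[OF ext *] env_act_closed[OF ext *(2,3,5)]
    by (auto simp: env_rep_def compose_def)
next
  fix a assume "a \<in> carrier A"
  then show "env_rep \<Omega> E A M a a (elt a var) = (\<lambda>m\<in>carrier (fib M a). m)"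
    using env_act_var[OF ext] by (auto simp: env_rep_def)
qed

lemma env_rep_elem_in_Z_sub:
  assumes b: "b \<in> carrier A" and u: "u \<in> carrier U"
  shows "env_rep \<Omega> E A M (ev b u) b (elt b u) \<in> Z_sub \<Omega> A M (ev b u) b"
  using u
proof (induction u rule: Pol1_induct)
  \<comment> \<open>Constants act as zero and the variable as the identity; a subringoid contains
    both.\<close>
  case (cst a)
  have eq: "env_rep \<Omega> E A M a b (elt b (cst a)) = \<one>\<^bsub>rhom (End_ringoid A M) a b\<^esub>"
    using env_act_cst[OF ext cst b] by (auto simp: env_rep_def)
  have "\<one>\<^bsub>rhom (End_ringoid A M) a b\<^esub> \<in> Z_sub \<Omega> A M a b"
    using subgroup.one_closed[OF subringoid_subgroup[OF M.subringoid_Z_sub]] cst b by simp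
  then show ?case by (simp only: eq ev_cst[OF b cst])
next
  case var
  have "env_rep \<Omega> E A M b b (elt b var) = rid (End_ringoid A M) b"
    using env_act_var[OF ext b] by (auto simp: env_rep_def)
  moreover have "rid (End_ringoid A M) b \<in> Z_sub \<Omega> A M b b"
    by (rule subringoid_rid[OF M.subringoid_Z_sub]) (simp add: b)
  ultimately show ?case by (simp only: ev_var[OF b])
next
  case (opn \<omega> n us)
  let ?gs = "map (\<lambda>u. env_rep \<Omega> E A M (ev b u) b (elt b u)) us" and ?as = "map (ev b) us"
  have as: "?as \<in> tuples n (carrier A)" using ev_closed[OF b] by (rule map_tuples[OF opn(2)])
  have "?gs \<in> listset (map (\<lambda>a. Z_sub \<Omega> A M a b) ?as)"
    unfolding in_listset_map_iff using opn(3) by simp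
  then have "(\<lambda>m\<in>carrier (fib M b). act M \<omega> ?as (map (\<lambda>g. g m) ?gs)) \<in> Z_sub \<Omega> A M (opn A \<omega> ?as) b"
    by (rule M.Z_sub_act[OF b opn(1) as])
  also have "(\<lambda>m\<in>carrier (fib M b). act M \<omega> ?as (map (\<lambda>g. g m) ?gs))
      = env_rep \<Omega> E A M (ev b (opn U \<omega> us)) b (elt b (opn U \<omega> us))"
    using env_act_opn[OF ext b opn(1,2)] by (auto simp: env_rep_def comp_def cong: map_cong)
  finally show ?case by (simp only: ev_opn[OF b opn(1,2)])
qed

text \<open>Classes of polynomials generate the hom-group, and the corresponding hom-set of
  \<open>Z_sub\<close> is a subgroup.\<close>

lemma env_rep_in_Z_sub:
  assumes a: "a \<in> carrier A" and b: "b \<in> carrier A" and z: "z \<in> carrier (fib (Z b) a)"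
  shows "env_rep \<Omega> E A M a b z \<in> Z_sub \<Omega> A M a b"
proof -
  interpret rep: ringoid_hom "env_ringoid \<Omega> E A" "End_ringoid A M" "\<lambda>a. a" "env_rep \<Omega> E A M"
    by (rule env_rep_ringoid_hom)
  let ?R = "rhom (End_ringoid A M) a b"
  have sub: "subgroup (Z_sub \<Omega> A M a b) ?R"
    using subringoid_subgroup[OF M.subringoid_Z_sub] a b by simp
  have gh: "group_hom (fib (Z b) a) ?R (env_rep \<Omega> E A M a b)"
    using rep.source.rhom_group rep.target.rhom_group rep.additive a b
    by (simp add: group_hom_def group_hom_axioms_def)
  from a z show ?thesis
  proof (induction rule: env_induct[OF b, consumes 2, case_names elem mult inv])
    case (elem u)
    then show ?case using env_rep_elem_in_Z_sub[OF b] by blast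
  next
    case (mult z z')
    then show ?case using group_hom.hom_mult[OF gh] subgroup.m_closed[OF sub] by metis
  next
    case (inv z)
    then show ?case using group_hom.hom_inv[OF gh] subgroup.m_inv_closed[OF sub] by metis
  qed
qed

lemma act_at_eq_env_rep:
  assumes \<omega>: "\<omega> \<in> \<Omega> n" and as: "as \<in> tuples n (carrier A)" and i: "i < n"
  obtains z where "z \<in> carrier (fib (Z (as ! i)) (opn A \<omega> as))"
    "act_at M \<omega> as i = env_rep \<Omega> E A M (opn A \<omega> as) (as ! i) z"
proof -
  \<comment> \<open>\<open>var\<close> stands at position \<open>i\<close> and constants elsewhere.
    Evaluation at \<open>as ! i\<close> gives back \<open>as\<close>, so the polynomial yields an
    arrow from \<open>as ! i\<close> to \<open>opn A \<omega> as\<close>.\<close>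
  let ?b = "as ! i" and ?us = "(map cst as)[i := var]"
  have b: "?b \<in> carrier A" by (rule tuples_nth[OF as i])
  note len = tuples_length[OF as]
  have us: "?us \<in> tuples n (carrier U)"
    using len i cst_closed tuples_nth[OF as] var_closed
    by (intro tuplesI) (auto simp: nth_list_update)
  have ev_us: "map (ev ?b) ?us = as"
    using len i tuples_nth[OF as] ev_cst[OF b] ev_var[OF b]
    by (intro nth_equalityI) (auto simp: nth_list_update)
  then have ev_u: "ev ?b (opn U \<omega> ?us) = opn A \<omega> as" using ev_opn[OF b \<omega> us] by simp
  show thesis
  proof (rule that)
    show "elt ?b (opn U \<omega> ?us) \<in> carrier (fib (Z ?b) (opn A \<omega> as))"
      using env_elem_closed[OF b U.opn_closed[OF \<omega> us]] ev_u by simp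
    have "env_act \<Omega> E A M (opn A \<omega> as) ?b (elt ?b (opn U \<omega> ?us)) m
        = act M \<omega> as ((map (\<lambda>a. \<one>\<^bsub>fib M a\<^esub>) as)[i := m])" if m: "m \<in> carrier (fib M ?b)" for m
    proof -
      \<comment> \<open>Constants act as zero and \<open>var\<close> as the identity, which leaves
        exactly the tuple in the definition of \<open>act_at\<close>.\<close>
      have "map (\<lambda>u. env_act \<Omega> E A M (ev ?b u) ?b (elt ?b u) m) ?us = (map (\<lambda>a. \<one>\<^bsub>fib M a\<^esub>) as)[i := m]"
        using len i tuples_nth[OF as] env_act_cst[OF ext _ b m] env_act_var[OF ext b m]
          ev_cst[OF b] ev_var[OF b]
        by (intro nth_equalityI) (auto simp: nth_list_update)
      then show ?thesis using env_act_opn[OF ext b \<omega> us m] by (simp only: ev_us ev_u)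
    qed
    then show "act_at M \<omega> as i = env_rep \<Omega> E A M (opn A \<omega> as) ?b (elt ?b (opn U \<omega> ?us))"
      by (auto simp: act_at_def env_rep_def)
  qed
qed

lemma env_rep_image:
  assumes a: "a \<in> carrier A" and b: "b \<in> carrier A"
  shows "env_rep \<Omega> E A M a b ` carrier (fib (Z b) a) = Z_sub \<Omega> A M a b"
proof
  show "env_rep \<Omega> E A M a b ` carrier (fib (Z b) a) \<subseteq> Z_sub \<Omega> A M a b"
    using env_rep_in_Z_sub[OF a b] by blast
  let ?S = "\<lambda>a b. env_rep \<Omega> E A M a b ` carrier (rhom (env_ringoid \<Omega> E A) a b)"
  have "Z_sub \<Omega> A M a b \<subseteq> ?S a b"
    unfolding Z_sub_def
  proof (rule generated_subringoid_least)
    show "subringoid (End_ringoid A M) ?S"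
      by (rule subringoid_image[OF env_rep_ringoid_hom]) simp
    fix c d show "op_homs \<Omega> A M c d \<subseteq> ?S c d"
    proof
      fix f assume "f \<in> op_homs \<Omega> A M c d"
      then obtain n \<omega> as i where *: "\<omega> \<in> \<Omega> n" "as \<in> tuples n (carrier A)" "i < n"
        "f = act_at M \<omega> as i" "c = opn A \<omega> as" "d = as ! i"
        unfolding op_homs_def by blast
      from act_at_eq_env_rep[OF *(1-3)] show "f \<in> ?S c d"
        using *(4-6) by (metis env_ringoid_simps(2) image_eqI)
    qed
  qed
  then show "Z_sub \<Omega> A M a b \<subseteq> env_rep \<Omega> E A M a b ` carrier (fib (Z b) a)" by simp
qed

text \<open>Passing from \<open>End_ringoid\<close> to \<open>Z_sub_ringoid\<close> changes only the
  carriers of the hom-groups, so the homomorphism laws carry over once the values are known to lie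
  in \<open>Z_sub\<close>.\<close>

lemma env_rep_cofaithful:
  "cofaithful_ringoid_hom (env_ringoid \<Omega> E A) (Z_sub_ringoid \<Omega> A M) (\<lambda>a. a) (env_rep \<Omega> E A M)"
proof -
  interpret rep: ringoid_hom "env_ringoid \<Omega> E A" "End_ringoid A M" "\<lambda>a. a" "env_rep \<Omega> E A M"
    by (rule env_rep_ringoid_hom)
  have simps: "robj (Z_sub_ringoid \<Omega> A M) = carrier A"
    "rhom (Z_sub_ringoid \<Omega> A M) a b = (rhom (End_ringoid A M) a b)\<lparr>carrier := Z_sub \<Omega> A M a b\<rparr>"
    "rcomp (Z_sub_ringoid \<Omega> A M) a b c = rcomp (End_ringoid A M) a b c"
    "rid (Z_sub_ringoid \<Omega> A M) a = rid (End_ringoid A M) a" for a b c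
    by (simp_all add: Z_sub_ringoid_def restrict_ringoid_def)
  have Z_sub: "ringoid (Z_sub_ringoid \<Omega> A M)"
    unfolding Z_sub_ringoid_def by (rule ringoid.ringoid_restrict[OF M.ringoid_End M.subringoid_Z_sub])
  have "ringoid_hom (env_ringoid \<Omega> E A) (Z_sub_ringoid \<Omega> A M) (\<lambda>a. a) (env_rep \<Omega> E A M)"
  proof (rule ringoid_hom.intro[OF ringoid_env Z_sub], rule ringoid_hom_axioms.intro, unfold simps)
    fix a b assume ab: "a \<in> robj (env_ringoid \<Omega> E A)" "b \<in> robj (env_ringoid \<Omega> E A)"
    show "env_rep \<Omega> E A M a b \<in> hom (rhom (env_ringoid \<Omega> E A) a b)
        ((rhom (End_ringoid A M) a b)\<lparr>carrier := Z_sub \<Omega> A M a b\<rparr>)"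
      using rep.additive[OF ab] env_rep_in_Z_sub ab by (simp add: hom_def Pi_iff)
  qed (use rep.obj_closed rep.preserves_rcomp rep.preserves_rid in simp_all)
  then show ?thesis
    by (rule cofaithful_ringoid_hom.intro, intro cofaithful_ringoid_hom_axioms.intro)
      (simp_all add: simps env_rep_image bij_betw_def)
qed

end

end

text \<open>The first two conjuncts justify the description of the representation: it is additive on
  each hom-set and sends the class of \<open>u\<close> to the action of \<open>u\<close>. The other
  three are the claims (1), (2) and (3). Targets come before sources in the indices, so an arrow
  from \<open>a\<close> to \<open>b\<close> carries \<open>b a\<close>.\<close>

theorem theorem10p1:
  fixes \<Omega> :: "nat \<Rightarrow> 'f set"
    and E :: "(('f, nat) trm \<times> ('f, nat) trm) set"
    and A :: "('f, 'a) alg"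
    and M :: "('f, 'a, 'm) module_data"
  assumes "E \<subseteq> terms \<Omega> UNIV \<times> terms \<Omega> UNIV"
    and "in_variety \<Omega> E A"
    and "overalgebra_module \<Omega> A M"
    and "in_variety \<Omega> E (total_alg A M)"
  shows "(\<forall>a\<in>carrier A. \<forall>b\<in>carrier A. env_rep \<Omega> E A M a b
            \<in> hom (rhom (env_ringoid \<Omega> E A) a b) (rhom (End_ringoid A M) a b))
      \<and> (\<forall>b\<in>carrier A. \<forall>u\<in>carrier (Pol1 \<Omega> E A). \<forall>m\<in>carrier (fib M b).
            env_rep \<Omega> E A M (pol_eval \<Omega> E A b u) b (env_elem \<Omega> E A b u) m = pol_act \<Omega> E A M b u m)
      \<and> ringoid_hom (env_ringoid \<Omega> E A) (End_ringoid A M) (\<lambda>a. a) (env_rep \<Omega> E A M)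
      \<and> (\<forall>a\<in>carrier A. \<forall>b\<in>carrier A. \<forall>z\<in>carrier (rhom (env_ringoid \<Omega> E A) b a).
            env_rep \<Omega> E A M b a z \<in> Z_sub \<Omega> A M b a)
      \<and> cofaithful_ringoid_hom (env_ringoid \<Omega> E A) (Z_sub_ringoid \<Omega> A M) (\<lambda>a. a) (env_rep \<Omega> E A M)"
proof -
  interpret algebra_in_variety \<Omega> E A using assms(1,2) by unfold_locales
  have ext: "env_extendable M" by (rule env_extendable_total[OF assms(3,4)])
  note rep = env_rep_ringoid_hom[OF ext]
  show ?thesis
  proof (intro conjI ballI)
    fix a b assume "a \<in> carrier A" "b \<in> carrier A"
    then show "env_rep \<Omega> E A M a b \<in> hom (rhom (env_ringoid \<Omega> E A) a b) (rhom (End_ringoid A M) a b)"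
      using ringoid_hom.additive[OF rep, of a b] by simp
  next
    fix b u m assume "b \<in> carrier A" "u \<in> carrier U" "m \<in> carrier (fib M b)"
    then show "env_rep \<Omega> E A M (ev b u) b (elt b u) m = pol_act \<Omega> E A M b u m"
      using env_act_elem[OF ext] by (simp add: env_rep_def)
  next
    fix a b z assume "a \<in> carrier A" "b \<in> carrier A" "z \<in> carrier (rhom (env_ringoid \<Omega> E A) b a)"
    then show "env_rep \<Omega> E A M b a z \<in> Z_sub \<Omega> A M b a"
      using env_rep_in_Z_sub[OF ext] by simp
  qed (rule rep env_rep_cofaithful[OF ext])+
qed

end
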